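(* Let $G$ be an open subset of $\mathbb{R}$. Let $A$ and $B$ be complex unital Banach algebras with continuous involutions, and let $\pi : G \to \mathcal{B}(A,B)$ be a real analytic map such that for every $\lambda \in G$ the value $\pi(\lambda)$ is a surjective (unital, continuous) $^*$-homomorphism $A \to B$. Suppose that for each $\lambda \in G$ and each $x \in \operatorname{Ker}\pi(\lambda)$ we have $\sigma(x) = \{0\}$. Let $q_1, q_2, \dots : G \to S(B)$ be finitely or countably infinitely many real analytic maps such that for all indices $i \neq j$ and each $\lambda \in G$ the idempotents $q_i(\lambda)$ and $q_j(\lambda)$ are orthogonal. Then there exist real analytic maps $p_1, p_2, \dots : G \to S(A)$, indexed by the same index set as the $q_i$'s, such that for all indices $i \neq j$ and each $\lambda \in G$ the idempotents $p_i(\lambda)$ and $p_j(\lambda)$ are orthogonal, and such that $\pi(\lambda)p_i(\lambda) = q_i(\lambda)$ for each index $i$ and each $\lambda \in G$.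
   Context: All Banach algebras are over $\mathbb{C}$ and unital; all Banach algebra homomorphisms are continuous and preserve $1$. $\mathcal{B}(A,B)$ is the Banach space of bounded linear operators from $A$ to $B$ (with the operator norm). For a Banach algebra $A$ with involution $^*$, $S(A) = \{p \in A : p^2 = p = p^*\}$ is the set of self-adjoint idempotents. The involutions are assumed continuous, but not necessarily isometric. A $^*$-homomorphism is an algebra homomorphism commuting with the involutions. A real analytic map $f$ from an open set $G \subset \mathbb{R}$ to a Banach space is a map that near each $x_0 \in G$ has a power series expansion $f(x) = \sum_{n=0}^\infty a_n (x-x_0)^n$ with coefficients $a_n$ in the Banach space; a real analytic map into $S(A)$ is a real analytic map into $A$ with values in $S(A)$. Two idempotents $e, f$ are orthogonal if $ef = fe = 0$. $\sigma(x)$ denotes the spectrum of $x$; for $x \in \operatorname{Ker}\pi(\lambda) \subset A$ it is taken with respect to $A$. *)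

theory Defs
  imports "HOL-Analysis.Analysis"
begin

section \<open>Complex unital Banach algebras\<close>

class scaleC =
  fixes scaleC :: "complex \<Rightarrow> 'a \<Rightarrow> 'a"  (infixr \<open>*\<^sub>C\<close> 75)

class complex_banach_algebra_1 = scaleC + real_normed_algebra_1 + banach +
  assumes scaleC_add_right: "a *\<^sub>C (x + y) = a *\<^sub>C x + a *\<^sub>C y"
    and scaleC_add_left: "(a + b) *\<^sub>C x = a *\<^sub>C x + b *\<^sub>C x"
    and scaleC_scaleC: "a *\<^sub>C (b *\<^sub>C x) = (a * b) *\<^sub>C x"
    and scaleR_scaleC: "r *\<^sub>R x = complex_of_real r *\<^sub>C x"
    and mult_scaleC_left: "(a *\<^sub>C x) * y = a *\<^sub>C (x * y)"
    and mult_scaleC_right: "x * (a *\<^sub>C y) = a *\<^sub>C (x * y)"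
    and norm_scaleC: "norm (a *\<^sub>C x) = cmod a * norm x"

instantiation complex :: complex_banach_algebra_1
begin

definition scaleC_complex :: "complex \<Rightarrow> complex \<Rightarrow> complex"
  where "scaleC_complex a x = a * x"

instance
  by standard (auto simp: scaleC_complex_def algebra_simps norm_mult scaleR_conv_of_real)

end

definition spectrum :: "'a::complex_banach_algebra_1 \<Rightarrow> complex set"
  where "spectrum x =
    {c. \<not> (\<exists>y. y * (c *\<^sub>C 1 - x) = 1 \<and> (c *\<^sub>C 1 - x) * y = 1)}"

section \<open>Involutions and $*$-homomorphisms\<close>

definition continuous_involution :: "('a::complex_banach_algebra_1 \<Rightarrow> 'a) \<Rightarrow> bool"
  where "continuous_involution star \<longleftrightarrow>
    (\<forall>x. star (star x) = x) \<and>
    (\<forall>x y. star (x + y) = star x + star y) \<and>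
    (\<forall>c x. star (c *\<^sub>C x) = cnj c *\<^sub>C star x) \<and>
    (\<forall>x y. star (x * y) = star y * star x) \<and>
    continuous_on UNIV star"

definition selfadjoint_idempotents :: "('a::complex_banach_algebra_1 \<Rightarrow> 'a) \<Rightarrow> 'a set"
  where "selfadjoint_idempotents star = {p. p\<^sup>2 = p \<and> star p = p}"

definition orthogonal_idempotents :: "'a::complex_banach_algebra_1 \<Rightarrow> 'a \<Rightarrow> bool"
  where "orthogonal_idempotents e f \<longleftrightarrow>
    e\<^sup>2 = e \<and> f\<^sup>2 = f \<and> e * f = 0 \<and> f * e = 0"

definition star_homomorphism ::
  "('a::complex_banach_algebra_1 \<Rightarrow> 'a) \<Rightarrow> ('b::complex_banach_algebra_1 \<Rightarrow> 'b)
    \<Rightarrow> ('a \<Rightarrow> 'b) \<Rightarrow> bool"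
  where "star_homomorphism starA starB h \<longleftrightarrow>
    (\<forall>x y. h (x + y) = h x + h y) \<and>
    (\<forall>c x. h (c *\<^sub>C x) = c *\<^sub>C h x) \<and>
    (\<forall>x y. h (x * y) = h x * h y) \<and>
    h 1 = 1 \<and>
    (\<forall>x. h (starA x) = starB (h x)) \<and>
    continuous_on UNIV h"

section \<open>Real analytic maps into Banach spaces\<close>

text \<open>
  Below this is also applied to maps into \<open>'a \<Rightarrow>\<^sub>L 'b\<close>, the bounded \<^emph>\<open>real\<close>-linear operators with
  the operator norm, all of whose values are complex-linear. The bounded complex-linear operators
  form a closed subspace with the same norm. The coefficients of an expansion of such a map lie in
  that subspace automatically, being scalar multiples of its derivatives, so it makes no
  difference in which of the two spaces the coefficients are taken.
\<close>

definition real_analytic_on :: "(real \<Rightarrow> 'a::banach) \<Rightarrow> real set \<Rightarrow> bool"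
  where "real_analytic_on f G \<longleftrightarrow>
    (\<forall>x0\<in>G. \<exists>a. \<exists>r>0. \<forall>x\<in>G. \<bar>x - x0\<bar> < r \<longrightarrow>
      (\<lambda>n. (x - x0) ^ n *\<^sub>R a n) sums f x)"

end

theory Submission
  imports Defs "HOL-Complex_Analysis.Complex_Analysis"
begin

text \<open>
  The main step is that an analytic family \<open>\<pi>\<close> of surjections lifts analytic maps. On a component of
  \<open>G\<close>, a Riemann map of a thin complex neighbourhood that is symmetric under conjugation makes \<open>\<pi>\<close>
  and \<open>q\<close> power series that converge on the unit disc. For a constant \<open>y\<close>, lifts \<open>x\<^sub>c\<close> with
  \<open>\<pi>(c) x\<^sub>c = y\<close> are glued by weights that are holomorphic on the disc and localized along the real axis. The
  error is a sum of holomorphic functions times constants, of total norm at most \<open>1/2\<close> near the real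
  axis, so the constants can be lifted again and the Neumann series converges. No bounded linear right
  inverse of \<open>\<pi>(c)\<close> is needed.

  Self-adjoint idempotents are then obtained from a self-adjoint lift \<open>f\<close>: as \<open>f\<^sup>2 - f\<close> is
  quasinilpotent, the binomial series of \<open>(1 + 4 (f\<^sup>2 - f))\<^sup>-\<^sup>1\<^sup>/\<^sup>2\<close> converges and depends analytically on
  the parameter. Orthogonality is achieved recursively.
\<close>

section \<open>Norming functionals\<close>

text \<open>The kernels of the surjections need not be complemented, so the lifts at a point c come
  from a bounded choice that is not known to be linear or continuous. Such a choice must never act
  on a vector that moves with the parameter: all dependence on the parameter sits in scalar
  functions, and the choices act on fixed vectors. This is what the disc is for: there \<pi>(c) -
  \<pi>(t) is the sum of (c^n - t^n) T_n with fixed operators T_n, over the whole domain at once.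
  The spaces are treated as real ones, so \<pi> has no values at complex points; only the scalar
  functions are extended, and they have to be real on the real axis, whence the symmetry of the
  Riemann map. The extension serves Cauchy's inequalities, which control infinite sums of analytic
  functions. Nonzero real analytic weights cannot vanish on an interval, so the weights leak; the
  leak has to beat an arbitrary growth of the lifting constants towards the boundary, and what
  remains is the error treated by the Neumann series.\<close>

definition sublinear :: "('a::real_normed_vector \<Rightarrow> real) \<Rightarrow> bool"
  where "sublinear p \<longleftrightarrow> (\<forall>x y. p (x + y) \<le> p x + p y) \<and> (\<forall>c x. c \<ge> 0 \<longrightarrow> p (c *\<^sub>R x) = c * p x)"

lemma sublinear_zero: "sublinear p \<Longrightarrow> p 0 = 0"
  unfolding sublinear_def by (metis mult_zero_left order_refl scaleR_zero_left)

lemma sublinear_neg: "sublinear p \<Longrightarrow> - p (- x) \<le> p x"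
  using sublinear_zero[of p] unfolding sublinear_def
  by (smt (verit) add.right_inverse)

text \<open>The standard minorant in the proof of Hahn-Banach by minimal sublinear functionals: it
  pushes the value at -y down to -p y. A minimal \<open>p\<close> equals all its shifts, and the
  bound by p (x + y) - p y then makes it superadditive.\<close>

definition sublinear_shift :: "('a::real_normed_vector \<Rightarrow> real) \<Rightarrow> 'a \<Rightarrow> 'a \<Rightarrow> real"
  where "sublinear_shift p y x = (INF t\<in>{0..}. p (x + t *\<^sub>R y) - t * p y)"

lemma sublinear_shift:
  assumes p: "sublinear p"
  shows "sublinear (sublinear_shift p y)" "sublinear_shift p y x \<le> p x"
    "sublinear_shift p y x \<le> p (x + y) - p y"
proof -
  have add: "p (u + v) \<le> p u + p v" for u v using p by (auto simp: sublinear_def)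
  have hom: "c \<ge> 0 \<Longrightarrow> p (c *\<^sub>R u) = c * p u" for c u using p by (auto simp: sublinear_def)
  have lb: "- p (- x) \<le> p (x + t *\<^sub>R y) - t * p y" if "t \<ge> 0" for t x
    using add[of "- x" "x + t *\<^sub>R y"] hom[OF that, of y] by simp
  have bdd: "bdd_below ((\<lambda>t. p (x + t *\<^sub>R y) - t * p y) ` {0..})" for x
    by (rule bdd_belowI2[where m = "- p (- x)"]) (use lb in auto)
  have low: "sublinear_shift p y x \<le> p (x + t *\<^sub>R y) - t * p y" if "t \<ge> 0" for t x
    unfolding sublinear_shift_def by (rule cINF_lower[OF bdd]) (use that in auto)
  have great: "c \<le> sublinear_shift p y x" if "\<And>t. t \<ge> 0 \<Longrightarrow> c \<le> p (x + t *\<^sub>R y) - t * p y" for c x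
    unfolding sublinear_shift_def by (rule cINF_greatest) (use that in auto)
  show "sublinear_shift p y x \<le> p x" using low[of 0 x] by simp
  show "sublinear_shift p y x \<le> p (x + y) - p y" using low[of 1 x] by simp
  have sub: "sublinear_shift p y (u + v) \<le> sublinear_shift p y u + sublinear_shift p y v" for u v
  proof -
    have *: "sublinear_shift p y (u + v) \<le> (p (u + s *\<^sub>R y) - s * p y) + (p (v + t *\<^sub>R y) - t * p y)"
      if "s \<ge> 0" "t \<ge> 0" for s t
    proof -
      have "p (u + v + (s + t) *\<^sub>R y) \<le> p (u + s *\<^sub>R y) + p (v + t *\<^sub>R y)"
        using add[of "u + s *\<^sub>R y" "v + t *\<^sub>R y"] by (simp add: algebra_simps)
      then show ?thesis using low[of "s + t" "u + v"] that by (simp add: algebra_simps)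
    qed
    have "sublinear_shift p y (u + v) - (p (u + s *\<^sub>R y) - s * p y) \<le> sublinear_shift p y v"
      if "s \<ge> 0" for s
      by (rule great) (use *[OF that] in \<open>auto simp: algebra_simps\<close>)
    then have "sublinear_shift p y (u + v) - sublinear_shift p y v \<le> sublinear_shift p y u"
      by (intro great) (auto simp: algebra_simps)
    then show ?thesis by simp
  qed
  have le: "sublinear_shift p y (c *\<^sub>R u) \<le> c * sublinear_shift p y u" if "c > 0" for c u
  proof -
    have "sublinear_shift p y (c *\<^sub>R u) / c \<le> sublinear_shift p y u"
    proof (rule great)
      fix t :: real assume "t \<ge> 0"
      have "sublinear_shift p y (c *\<^sub>R u) \<le> p (c *\<^sub>R u + (c * t) *\<^sub>R y) - (c * t) * p y"
        by (rule low) (use that \<open>t \<ge> 0\<close> in auto)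
      also have "c *\<^sub>R u + (c * t) *\<^sub>R y = c *\<^sub>R (u + t *\<^sub>R y)" by (simp add: algebra_simps)
      finally have "sublinear_shift p y (c *\<^sub>R u) \<le> c * (p (u + t *\<^sub>R y) - t * p y)"
        using hom[of c "u + t *\<^sub>R y"] that by (simp add: algebra_simps)
      then show "sublinear_shift p y (c *\<^sub>R u) / c \<le> p (u + t *\<^sub>R y) - t * p y"
        using that by (simp add: divide_le_eq mult.commute)
    qed
    then show ?thesis using that by (simp add: divide_le_eq mult.commute)
  qed
  have zero: "sublinear_shift p y 0 = 0"
  proof (rule antisym)
    show "sublinear_shift p y 0 \<le> 0" using low[of 0 0] sublinear_zero[OF p] by simp
    show "0 \<le> sublinear_shift p y 0" by (rule great) (auto simp: hom)
  qed
  have "sublinear_shift p y (c *\<^sub>R u) = c * sublinear_shift p y u" if "c \<ge> 0" for c u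
  proof (cases "c = 0")
    case True then show ?thesis using zero by simp
  next
    case False
    with that have c: "c > 0" by simp
    have "sublinear_shift p y ((1 / c) *\<^sub>R (c *\<^sub>R u)) \<le> (1 / c) * sublinear_shift p y (c *\<^sub>R u)"
      by (rule le) (use c in auto)
    then have "c * sublinear_shift p y u \<le> sublinear_shift p y (c *\<^sub>R u)"
      using c by (simp add: field_simps)
    with le[OF c, of u] show ?thesis by simp
  qed
  with sub show "sublinear (sublinear_shift p y)" by (auto simp: sublinear_def)
qed

text \<open>Zorn's lemma for the reversed order. The pointwise infimum of a chain is finite because
  p x \<ge> -p0 (-x) for each member, and it is subadditive because the smaller of two members
  serves for both summands.\<close>

lemma minimal_sublinear_exists:
  assumes p0: "sublinear p0"
  shows "\<exists>m. sublinear m \<and> m \<le> p0 \<and> (\<forall>p. sublinear p \<longrightarrow> p \<le> m \<longrightarrow> p = m)"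
proof -
  define A where "A = {p. sublinear p \<and> p \<le> p0}"
  define P where "P = (\<lambda>p q :: 'a \<Rightarrow> real. q \<le> p)"
  have "\<exists>m\<in>A. \<forall>a\<in>A. P m a \<longrightarrow> a = m"
  proof (rule predicate_Zorn)
    show "partial_order_on A (relation_of P A)"
      by (rule partial_order_on_relation_ofI) (auto simp: P_def)
  next
    fix C assume C: "C \<in> Chains (relation_of P A)"
    then have CA: "C \<subseteq> A" and tot: "\<And>p q. p \<in> C \<Longrightarrow> q \<in> C \<Longrightarrow> p \<le> q \<or> q \<le> p"
      by (auto simp: Chains_def relation_of_def P_def)
    show "\<exists>u\<in>A. \<forall>a\<in>C. P a u"
    proof (cases "C = {}")
      case True
      have "p0 \<in> A" using p0 by (simp add: A_def)
      with True show ?thesis by auto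
    next
      case False
      have sl: "sublinear p" "p \<le> p0" if "p \<in> C" for p using that CA by (auto simp: A_def)
      define u where "u = (\<lambda>x. INF p\<in>C. p x)"
      have bdd: "bdd_below ((\<lambda>p. p x) ` C)" for x
      proof (rule bdd_belowI2)
        fix p assume "p \<in> C"
        then show "- p0 (- x) \<le> p x"
          using sublinear_neg[of p x] sl[of p] by (smt (verit) le_funD)
      qed
      have low: "u x \<le> p x" if "p \<in> C" for p x
        unfolding u_def by (rule cINF_lower[OF bdd that])
      have great: "c \<le> u x" if "\<And>p. p \<in> C \<Longrightarrow> c \<le> p x" for c x
        unfolding u_def by (rule cINF_greatest[OF False]) (use that in auto)
      have sub: "u (x + y) \<le> u x + u y" for x y
      proof -
        have *: "u (x + y) \<le> p x + q y" if pq: "p \<in> C" "q \<in> C" for p q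
        proof -
          obtain m where m: "m \<in> C" "m \<le> p" "m \<le> q" using tot[OF pq] pq by blast
          have "u (x + y) \<le> m (x + y)" by (rule low[OF m(1)])
          also have "\<dots> \<le> m x + m y" using sl(1)[OF m(1)] by (auto simp: sublinear_def)
          also have "\<dots> \<le> p x + q y" using m(2,3) by (simp add: le_funD add_mono)
          finally show ?thesis .
        qed
        have "u (x + y) - p x \<le> u y" if "p \<in> C" for p
          by (rule great) (use *[OF that] in \<open>auto simp: algebra_simps\<close>)
        then have "u (x + y) - u y \<le> u x" by (intro great) (auto simp: algebra_simps)
        then show ?thesis by simp
      qed
      have hom: "u (c *\<^sub>R x) = c * u x" if "c \<ge> 0" for c x
      proof -
        have eq: "p (c *\<^sub>R x) = c * p x" if "p \<in> C" for p
          using sl(1)[OF that] \<open>c \<ge> 0\<close> by (auto simp: sublinear_def)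
        show ?thesis
        proof (cases "c = 0")
          case True
          have "p 0 = 0" if "p \<in> C" for p using sublinear_zero[OF sl(1)[OF that]] .
          then have "u 0 = 0" using low[of _ 0] great[of 0 0] False by (metis all_not_in_conv antisym order_refl)
          with True show ?thesis by simp
        next
          case c: False
          have "u (c *\<^sub>R x) / c \<le> u x"
            by (rule great) (use low eq c \<open>c \<ge> 0\<close> in \<open>fastforce simp: divide_le_eq mult.commute\<close>)
          moreover have "c * u x \<le> u (c *\<^sub>R x)"
            by (rule great) (simp add: eq low mult_left_mono \<open>c \<ge> 0\<close>)
          ultimately show ?thesis using c \<open>c \<ge> 0\<close> by (auto simp: divide_le_eq mult.commute)
        qed
      qed
      have "u \<le> p0"
      proof (rule le_funI)
        fix x obtain p where "p \<in> C" using False by auto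
        then show "u x \<le> p0 x" using low[of p x] sl(2)[of p] by (meson le_funD order_trans)
      qed
      with sub hom have "u \<in> A" by (auto simp: A_def sublinear_def)
      then show ?thesis using low by (auto simp: P_def le_fun_def)
    qed
  qed
  then obtain m where m: "sublinear m" "m \<le> p0" and
    min: "\<And>a. sublinear a \<Longrightarrow> a \<le> p0 \<Longrightarrow> a \<le> m \<Longrightarrow> a = m" by (auto simp: A_def P_def)
  show ?thesis
    by (rule exI[of _ m]) (use m min order_trans in blast)
qed

text \<open>A minimal sublinear functional is additive, hence linear. Starting from the shift of the
  norm along z, instead of the norm itself, gives m (-z) \<le> -norm z, and linearity turns this
  into m z \<ge> norm z.\<close>

theorem norming_functional:
  fixes z :: "'a::real_normed_vector"
  shows "\<exists>l :: 'a \<Rightarrow>\<^sub>L real. norm l \<le> 1 \<and> blinfun_apply l z = norm z"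
proof -
  have n: "sublinear (norm :: 'a \<Rightarrow> real)" by (auto simp: sublinear_def norm_triangle_ineq)
  define p0 where "p0 = sublinear_shift norm z"
  have p0: "sublinear p0" "p0 x \<le> norm x" "p0 (- z) \<le> - norm z" for x
    using sublinear_shift(1)[OF n, of z] sublinear_shift(2)[OF n, of z x]
      sublinear_shift(3)[OF n, of z "- z"] by (auto simp: p0_def)
  obtain m where m: "sublinear m" "m \<le> p0" and min: "\<And>p. sublinear p \<Longrightarrow> p \<le> m \<Longrightarrow> p = m"
    using minimal_sublinear_exists[OF p0(1)] by blast
  have add: "m (x + y) = m x + m y" for x y
  proof (rule antisym)
    show "m (x + y) \<le> m x + m y" using m(1) by (auto simp: sublinear_def)
    have "sublinear_shift m y = m"
      by (rule min) (use sublinear_shift[OF m(1)] in \<open>auto simp: le_fun_def\<close>)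
    then show "m x + m y \<le> m (x + y)" using sublinear_shift(3)[OF m(1), of y x] by simp
  qed
  have neg: "m (- x) = - m x" for x
    using add[of x "- x"] sublinear_zero[OF m(1)] by simp
  have hom: "m (c *\<^sub>R x) = c * m x" for c x
  proof (cases "c \<ge> 0")
    case True then show ?thesis using m(1) by (auto simp: sublinear_def)
  next
    case False
    then have "m ((- c) *\<^sub>R x) = (- c) * m x" using m(1) unfolding sublinear_def
      by (metis neg_0_le_iff_le linear)
    then show ?thesis using neg[of "(- c) *\<^sub>R x"] by simp
  qed
  have ub: "m x \<le> norm x" for x using m(2) p0(2)[of x] by (meson le_funD order_trans)
  have bd: "\<bar>m x\<bar> \<le> norm x" for x using ub[of x] ub[of "- x"] neg[of x] by simp
  have bl: "bounded_linear m"
    by (rule bounded_linear_intro[where K = 1]) (auto simp: add hom bd)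
  have "m z = norm z"
    using ub[of z] neg[of z] p0(3) m(2) by (smt (verit) le_funD)
  moreover have "norm (Blinfun m) \<le> 1"
    by (rule norm_blinfun_bound) (auto simp: bounded_linear_Blinfun_apply[OF bl] bd)
  ultimately show ?thesis by (intro exI[of _ "Blinfun m"]) (auto simp: bounded_linear_Blinfun_apply[OF bl])
qed

corollary eq_if_functionals_agree:
  fixes x y :: "'a::real_normed_vector"
  assumes "\<And>l :: 'a \<Rightarrow>\<^sub>L real. blinfun_apply l x = blinfun_apply l y"
  shows "x = y"
  using norming_functional[of "x - y"] assms by (auto simp: blinfun.diff_right)

corollary norm_le_if_functionals_le:
  fixes x :: "'a::real_normed_vector"
  assumes "\<And>l :: 'a \<Rightarrow>\<^sub>L real. norm l \<le> 1 \<Longrightarrow> \<bar>blinfun_apply l x\<bar> \<le> B"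
  shows "norm x \<le> B"
  using norming_functional[of x] assms by (metis abs_norm_cancel)

section \<open>Quasinilpotent elements\<close>

lemma sums_imp_higher_deriv:
  fixes h :: "complex \<Rightarrow> complex"
  assumes r: "r > 0" and sums: "\<And>z. z \<in> ball w r \<Longrightarrow> (\<lambda>n. c n * (z - w) ^ n) sums h z"
  shows "h holomorphic_on ball w r" and "(deriv ^^ n) h w = fact n * c n"
proof -
  show hol: "h holomorphic_on ball w r"
    by (rule power_series_holomorphic[OF sums])
  have "(\<lambda>z. h (w + z)) has_fps_expansion Abs_fps c"
  proof (rule has_fps_expansionI)
    have "\<forall>\<^sub>F z in nhds 0. z \<in> ball 0 r"
      by (rule eventually_nhds_in_open) (use r in auto)
    then show "\<forall>\<^sub>F z in nhds 0. (\<lambda>n. fps_nth (Abs_fps c) n * z ^ n) sums h (w + z)"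
    proof eventually_elim
      case (elim z)
      show ?case using sums[of "w + z"] elim by (auto simp: dist_norm)
    qed
  qed
  then have "fps_expansion (\<lambda>z. h (w + z)) 0 = Abs_fps c" by (rule fps_expansion_eqI)
  moreover have "(deriv ^^ n) h w = (deriv ^^ n) (\<lambda>z. h (w + z)) 0"
    by (subst higher_deriv_shift_0) (simp add: o_def)
  ultimately show "(deriv ^^ n) h w = fact n * c n"
    by (auto simp: fps_expansion_def fps_eq_iff field_simps)
qed

lemma taylor_coeff_bound:
  fixes h :: "complex \<Rightarrow> complex"
  assumes hol: "h holomorphic_on ball w R" and s: "0 < s" "s < R"
    and bd: "\<And>z. dist w z = s \<Longrightarrow> cmod (h z) \<le> B"
  shows "cmod ((deriv ^^ n) h w / fact n) * s ^ n \<le> B"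
proof -
  have "cmod ((deriv ^^ n) h w) \<le> fact n * B / s ^ n"
  proof (rule Cauchy_inequality)
    show "h holomorphic_on ball w s" using s by (intro holomorphic_on_subset[OF hol]) auto
    show "continuous_on (cball w s) h"
      using s by (intro holomorphic_on_imp_continuous_on holomorphic_on_subset[OF hol]) auto
  qed (use s bd in \<open>auto simp: dist_norm\<close>)
  then show ?thesis using s by (simp add: norm_divide field_simps)
qed

section \<open>Complex scalars and complex-linear functionals\<close>

lemma scaleC_simps:
  fixes x y :: "'a::complex_banach_algebra_1"
  shows "1 *\<^sub>C x = x" "0 *\<^sub>C x = 0" "a *\<^sub>C 0 = (0::'a)" "a *\<^sub>C (- x) = - (a *\<^sub>C x)"
    "a *\<^sub>C (x - y) = a *\<^sub>C x - a *\<^sub>C y" "(a - b) *\<^sub>C x = a *\<^sub>C x - b *\<^sub>C x"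
proof -
  show one: "1 *\<^sub>C x = x" for x :: 'a using scaleR_scaleC[of 1 x] by simp
  show "0 *\<^sub>C x = 0" using scaleR_scaleC[of 0 x] by simp
  show "a *\<^sub>C 0 = (0::'a)" using norm_scaleC[of a "0::'a"] by simp
  show neg: "a *\<^sub>C (- x) = - (a *\<^sub>C x)" for a and x :: 'a
  proof -
    have m: "- v = (- 1) *\<^sub>C v" for v :: 'a using scaleR_scaleC[of "- 1" v] by simp
    show ?thesis unfolding m[of x] m[of "a *\<^sub>C x"] scaleC_scaleC by simp
  qed
  show "a *\<^sub>C (x - y) = a *\<^sub>C x - a *\<^sub>C y"
    using scaleC_add_right[of a x "- y"] neg by simp
  show "(a - b) *\<^sub>C x = a *\<^sub>C x - b *\<^sub>C x"
    using scaleC_add_left[of "a - b" b x] by (simp add: algebra_simps)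
qed

text \<open>The complex-linear functional with real part \<open>l\<close>. Bounded operators are
  real-linear here, while Cauchy's inequalities for the resolvent need complex-valued holomorphic
  functions.\<close>

definition complexify :: "('a::complex_banach_algebra_1 \<Rightarrow>\<^sub>L real) \<Rightarrow> 'a \<Rightarrow> complex"
  where "complexify l v = Complex (l v) (- l (\<i> *\<^sub>C v))"

lemma complexify_add: "complexify l (u + v) = complexify l u + complexify l v"
  and complexify_diff: "complexify l (u - v) = complexify l u - complexify l v"
  by (auto simp: complexify_def complex_eq_iff scaleC_add_right scaleC_simps blinfun.add_right blinfun.diff_right)

lemma complexify_scaleC: "complexify l (c *\<^sub>C v) = c * complexify l v"
proof -
  have 1: "c *\<^sub>C v = Re c *\<^sub>R v + Im c *\<^sub>R (\<i> *\<^sub>C v)" for c and v :: 'a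
    by (subst complex_eq[of c]) (simp add: scaleC_add_left scaleC_scaleC scaleR_scaleC[where 'a = 'a] mult.commute del: complex_eq_iff)
  have "\<i> *\<^sub>C c *\<^sub>C v = (\<i> * c) *\<^sub>C v" by (simp add: scaleC_scaleC)
  then have 2: "\<i> *\<^sub>C c *\<^sub>C v = (- Im c) *\<^sub>R v + Re c *\<^sub>R (\<i> *\<^sub>C v)"
    using 1[of "\<i> * c" v] by simp
  show ?thesis unfolding complexify_def 2 unfolding 1[of c v]
    by (auto simp: complex_eq_iff blinfun.add_right blinfun.diff_right blinfun.minus_right blinfun.scaleR_right)
qed

lemma cmod_complexify_le: "cmod (complexify l v) \<le> 2 * norm l * norm v"
proof -
  have "cmod (complexify l v) \<le> \<bar>l v\<bar> + \<bar>l (\<i> *\<^sub>C v)\<bar>"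
    unfolding complexify_def using cmod_le[of "Complex (l v) (- l (\<i> *\<^sub>C v))"] by simp
  also have "\<bar>l v\<bar> \<le> norm l * norm v" using norm_blinfun[of l v] by simp
  also have "\<bar>l (\<i> *\<^sub>C v)\<bar> \<le> norm l * norm v"
    using norm_blinfun[of l "\<i> *\<^sub>C v"] by (simp add: norm_scaleC)
  finally show ?thesis by (simp add: mult_ac)
qed

lemma bounded_linear_complexify: "bounded_linear (complexify l)"
  by (rule bounded_linear_intro[where K = "2 * norm l"])
    (use cmod_complexify_le[of l] in \<open>auto simp: complexify_add complexify_scaleC scaleR_scaleC[where 'a = 'a] scaleR_conv_of_real mult_ac\<close>)

text \<open>The coefficients of the entire function \<open>z \<mapsto> l ((1 - z x)\<^sup>-\<^sup>1)\<close> satisfy Cauchy's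
  inequalities on every circle.\<close>
theorem quasinilpotent_power_bound:
  fixes x :: "'a::complex_banach_algebra_1"
  assumes "spectrum x = {0}" and s: "s > 0"
  shows "\<exists>B. \<forall>n. norm (x ^ n) * s ^ n \<le> B"
proof -
  have "\<exists>y. y * (1 - z *\<^sub>C x) = 1 \<and> (1 - z *\<^sub>C x) * y = 1" for z
  proof (cases "z = 0")
    case True then show ?thesis by (intro exI[of _ 1]) (simp add: scaleC_simps)
  next
    case False
    then have "1 / z \<notin> spectrum x" using assms by auto
    then obtain y where y: "y * ((1 / z) *\<^sub>C 1 - x) = 1" "((1 / z) *\<^sub>C 1 - x) * y = 1"
      by (auto simp: spectrum_def)
    have "1 - z *\<^sub>C x = z *\<^sub>C ((1 / z) *\<^sub>C 1 - x)"
      using False by (simp add: scaleC_simps scaleC_scaleC)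
    then have "(1 / z) *\<^sub>C y * (1 - z *\<^sub>C x) = 1" "(1 - z *\<^sub>C x) * (1 / z) *\<^sub>C y = 1"
      using y False by (simp_all only: mult_scaleC_left mult_scaleC_right scaleC_scaleC) (simp_all add: scaleC_simps)
    then show ?thesis by blast
  qed
  then obtain R where R: "\<And>z. R z * (1 - z *\<^sub>C x) = 1" "\<And>z. (1 - z *\<^sub>C x) * R z = 1" by metis
  \<comment> \<open>Resolvent identity; both the continuity of \<open>R\<close> and the derivative
    of its composition with a functional are read off from it.\<close>
  have res: "R z - R w = (z - w) *\<^sub>C (R z * x * R w)" for z w
  proof -
    have "R z * ((1 - w *\<^sub>C x) - (1 - z *\<^sub>C x)) * R w = R z - R w"
    proof -
      have "R z * (A - B) * R w = R z * (A * R w) - (R z * B) * R w" for A B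
        by (simp add: algebra_simps)
      then show ?thesis by (simp only: R(1)[of z] R(2)[of w]) simp
    qed
    moreover have "(1 - w *\<^sub>C x) - (1 - z *\<^sub>C x) = (z - w) *\<^sub>C x" by (simp add: scaleC_simps)
    ultimately show ?thesis by (simp add: mult_scaleC_left mult_scaleC_right)
  qed
  have cont: "isCont R w" for w
  proof -
    define K where "K = norm x * norm (R w)"
    have K: "K \<ge> 0" by (simp add: K_def)
    have d: "norm (R z - R w) \<le> cmod (z - w) * (norm (R z) * K)" for z
      unfolding res norm_scaleC K_def
      by (intro mult_left_mono order_trans[OF norm_mult_ineq])
        (auto simp: mult.assoc[symmetric] intro!: mult_right_mono norm_mult_ineq)
    \<comment> \<open>The estimate \<open>d\<close> contains the unknown norm (R z). For z close to
      w the difference is at most half of norm (R z), which bounds norm (R z) by 2 norm (R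
      w).\<close>
    have bound: "norm (R z - R w) \<le> cmod (z - w) * (2 * norm (R w) * K)"
      if z: "cmod (z - w) * K \<le> 1/2" for z
    proof -
      have "norm (R z) \<le> norm (R w) + norm (R z - R w)" using norm_triangle_ineq[of "R w" "R z - R w"] by simp
      also have "norm (R z - R w) \<le> norm (R z) * (cmod (z - w) * K)" using d[of z] by (simp add: mult_ac)
      also have "\<dots> \<le> norm (R z) * (1/2)" by (intro mult_left_mono z) auto
      finally have "norm (R z) \<le> 2 * norm (R w)" by simp
      then have "cmod (z - w) * (norm (R z) * K) \<le> cmod (z - w) * (2 * norm (R w) * K)"
        using K by (intro mult_left_mono mult_right_mono) auto
      then show ?thesis using d[of z] by linarith
    qed
    have "((\<lambda>z. R z - R w) \<longlongrightarrow> 0) (at w)"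
    proof (rule Lim_null_comparison)
      have "((\<lambda>z. cmod (z - w) * K) \<longlongrightarrow> cmod (w - w) * K) (at w)" by (intro tendsto_intros)
      then have "\<forall>\<^sub>F z in at w. cmod (z - w) * K < 1/2" by (rule order_tendstoD) simp
      then show "\<forall>\<^sub>F z in at w. norm (R z - R w) \<le> cmod (z - w) * (2 * norm (R w) * K)"
        by eventually_elim (rule bound, simp)
      have "((\<lambda>z. cmod (z - w) * (2 * norm (R w) * K)) \<longlongrightarrow> cmod (w - w) * (2 * norm (R w) * K)) (at w)"
        by (intro tendsto_intros)
      then show "((\<lambda>z. cmod (z - w) * (2 * norm (R w) * K)) \<longlongrightarrow> 0) (at w)" by simp
    qed
    then show ?thesis unfolding isCont_def by (rule LIM_zero_cancel)
  qed
  then have "continuous_on (cball 0 s) (\<lambda>z. norm (R z))"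
    by (intro continuous_intros continuous_at_imp_continuous_on) auto
  then have "compact ((\<lambda>z. norm (R z)) ` cball 0 s)" by (intro compact_continuous_image) auto
  then obtain B where B: "\<And>z. cmod z \<le> s \<Longrightarrow> norm (R z) \<le> B"
    using bounded_imp_bdd_above[OF compact_imp_bounded] unfolding bdd_above_def by fastforce
  have "norm (x ^ n) \<le> 2 * B / s ^ n" for n
  proof (rule norm_le_if_functionals_le)
    fix l :: "'a \<Rightarrow>\<^sub>L real" assume l: "norm l \<le> 1"
    define h where "h = (\<lambda>z. complexify l (R z))"
    interpret L: bounded_linear "complexify l" by (rule bounded_linear_complexify)
    have "(h has_field_derivative complexify l (R w * x * R w)) (at w)" for w
    proof -
      have "((\<lambda>z. complexify l (R z * x * R w)) \<longlongrightarrow> complexify l (R w * x * R w)) (at w)"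
        using cont[of w] unfolding isCont_def by (intro L.tendsto tendsto_intros)
      moreover have "\<forall>\<^sub>F z in at w. complexify l (R z * x * R w) = (h z - h w) / (z - w)"
        unfolding eventually_at_filter h_def
        by (rule always_eventually)
          (auto simp: complexify_diff[symmetric] res complexify_scaleC)
      ultimately show ?thesis
        unfolding has_field_derivative_iff by (rule Lim_transform_eventually)
    qed
    then have hol: "h holomorphic_on UNIV" by (auto simp: holomorphic_on_def field_differentiable_def
        intro: has_field_derivative_at_within)
    \<comment> \<open>Near 0 the resolvent is a geometric series, which identifies the Taylor
      coefficients. They are then estimated on the circle of radius s, which is possible because
      \<open>h\<close> is entire.\<close>
    define r where "r = 1 / (norm x + 1)"
    have r: "r > 0" by (simp add: r_def add_nonneg_pos)
    have "(\<lambda>n. complexify l (x ^ n) * (z - 0) ^ n) sums h z" if z: "z \<in> ball 0 r" for z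
    proof -
      have "cmod z * (norm x + 1) < 1" using z by (simp add: r_def pos_less_divide_eq add_nonneg_pos)
      then have "norm (z *\<^sub>C x) < 1" by (simp add: norm_scaleC algebra_simps) (smt (verit) norm_ge_zero)
      then have sm: "summable (\<lambda>n. norm (z *\<^sub>C x) ^ n)" by (simp add: summable_geometric_iff)
      have "summable (\<lambda>n. (z *\<^sub>C x) ^ n)"
        by (rule summable_comparison_test'[OF sm, of 0]) (simp add: norm_power_ineq)
      then obtain S where S: "(\<lambda>n. (z *\<^sub>C x) ^ n) sums S" by (auto simp: summable_def)
      have "(\<lambda>n. (z *\<^sub>C x) ^ Suc n) sums (z *\<^sub>C x * S)" using sums_mult[OF S, of "z *\<^sub>C x"] by simp
      moreover have "(\<lambda>n. (z *\<^sub>C x) ^ Suc n) sums (S - 1)" using S by (subst sums_Suc_iff) simp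
      ultimately have "S - 1 = z *\<^sub>C x * S" by (rule sums_unique2[symmetric])
      then have "(1 - z *\<^sub>C x) * S = 1" by (simp add: left_diff_distrib algebra_simps)
      then have "S = R z" using R[of z] by (metis mult.assoc mult.left_neutral mult.right_neutral)
      moreover have "(z *\<^sub>C x) ^ n = z ^ n *\<^sub>C x ^ n" for n
        by (induction n) (auto simp: scaleC_simps mult_scaleC_left mult_scaleC_right scaleC_scaleC mult.commute)
      ultimately show ?thesis using L.sums[OF S]
        by (simp add: complexify_scaleC h_def mult.commute)
    qed
    from sums_imp_higher_deriv(2)[OF r this]
    have "complexify l (x ^ n) = (deriv ^^ n) h 0 / fact n" by simp
    moreover have "cmod ((deriv ^^ n) h 0 / fact n) * s ^ n \<le> 2 * B"
    proof (rule taylor_coeff_bound[where R = "s + 1"])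
      show "h holomorphic_on ball 0 (s + 1)" using hol by (rule holomorphic_on_subset) auto
      fix z :: complex assume "dist 0 z = s"
      then have "norm (R z) \<le> B" by (intro B) simp
      then have "norm l * norm (R z) \<le> 1 * B" using l by (intro mult_mono) auto
      then show "cmod (h z) \<le> 2 * B" using cmod_complexify_le[of l "R z"] by (simp add: h_def)
    qed (use s in auto)
    moreover have "\<bar>l (x ^ n)\<bar> \<le> cmod (complexify l (x ^ n))"
      using abs_Re_le_cmod[of "complexify l (x ^ n)"] by (simp add: complexify_def)
    ultimately show "\<bar>blinfun_apply l (x ^ n)\<bar> \<le> 2 * B / s ^ n"
      using s by (simp add: pos_le_divide_eq) (smt (verit) mult_right_mono zero_le_power)
  qed
  then show ?thesis using s by (intro exI[of _ "2 * B"]) (simp add: pos_le_divide_eq)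
qed

section \<open>Banach space valued power series\<close>

text \<open>\<open>M\<close> bounds a weighted l1 norm of the coefficients, and this norm is
  submultiplicative. The quantitative form, unlike convergence alone, allows products, powers and
  infinite families to be handled on one radius.\<close>

definition pseries :: "(real \<Rightarrow> 'a::banach) \<Rightarrow> real \<Rightarrow> real \<Rightarrow> real \<Rightarrow> bool"
  where "pseries f x0 \<rho> M \<longleftrightarrow> \<rho> > 0 \<and> (\<exists>a. summable (\<lambda>n. norm (a n) * \<rho> ^ n) \<and> (\<Sum>n. norm (a n) * \<rho> ^ n) \<le> M \<and>
    (\<forall>x. \<bar>x - x0\<bar> < \<rho> \<longrightarrow> (\<lambda>n. (x - x0) ^ n *\<^sub>R a n) sums f x))"

lemma pseriesI:
  assumes "\<rho> > 0" "\<And>N. (\<Sum>n<N. norm (a n) * \<rho> ^ n) \<le> M"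
    "\<And>x. \<bar>x - x0\<bar> < \<rho> \<Longrightarrow> (\<lambda>n. (x - x0) ^ n *\<^sub>R a n) sums f x"
  shows "pseries f x0 \<rho> M"
proof -
  have "summable (\<lambda>n. norm (a n) * \<rho> ^ n)"
    by (rule summableI_nonneg_bounded[where x = M]) (use assms in auto)
  moreover from this have "(\<Sum>n. norm (a n) * \<rho> ^ n) \<le> M"
    by (rule suminf_le_const) (rule assms)
  ultimately show ?thesis using assms unfolding pseries_def by blast
qed

lemma pseriesE:
  assumes "pseries f x0 \<rho> M"
  obtains a where "\<rho> > 0" "summable (\<lambda>n. norm (a n) * \<rho> ^ n)" "\<And>N. (\<Sum>n<N. norm (a n) * \<rho> ^ n) \<le> M"
    "\<And>x. \<bar>x - x0\<bar> < \<rho> \<Longrightarrow> (\<lambda>n. (x - x0) ^ n *\<^sub>R a n) sums f x"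
    "\<And>x. \<bar>x - x0\<bar> < \<rho> \<Longrightarrow> summable (\<lambda>n. norm ((x - x0) ^ n *\<^sub>R a n))"
proof -
  from assms obtain a where a: "\<rho> > 0" "summable (\<lambda>n. norm (a n) * \<rho> ^ n)" "(\<Sum>n. norm (a n) * \<rho> ^ n) \<le> M"
    "\<And>x. \<bar>x - x0\<bar> < \<rho> \<Longrightarrow> (\<lambda>n. (x - x0) ^ n *\<^sub>R a n) sums f x" unfolding pseries_def by blast
  show ?thesis
  proof (rule that[OF a(1,2) _ a(4)])
    show "(\<Sum>n<N. norm (a n) * \<rho> ^ n) \<le> M" for N
      using sum_le_suminf[OF a(2), of "{..<N}"] a(1,3) by fastforce
    show "summable (\<lambda>n. norm ((x - x0) ^ n *\<^sub>R a n))" if "\<bar>x - x0\<bar> < \<rho>" for x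
    proof (rule summable_comparison_test'[OF a(2), of 0])
      fix n
      have "\<bar>x - x0\<bar> ^ n \<le> \<rho> ^ n" using that by (intro power_mono) auto
      then show "norm (norm ((x - x0) ^ n *\<^sub>R a n)) \<le> norm (a n) * \<rho> ^ n"
        using mult_right_mono[OF _ norm_ge_zero[of "a n"]] by (simp add: power_abs mult.commute[of "norm (a n)"])
    qed
  qed auto
qed

lemma pseries_mono: "pseries f x0 \<rho> M \<Longrightarrow> M \<le> N \<Longrightarrow> pseries f x0 \<rho> N"
  unfolding pseries_def by (meson order_trans)

lemma pseries_radius_mono:
  assumes f: "pseries f x0 \<rho> M" and r: "0 < r" "r \<le> \<rho>"
  shows "pseries f x0 r M"
proof -
  obtain c where c: "\<And>N. (\<Sum>n<N. norm (c n) * \<rho> ^ n) \<le> M"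
    "\<And>x. \<bar>x - x0\<bar> < \<rho> \<Longrightarrow> (\<lambda>n. (x - x0) ^ n *\<^sub>R c n) sums f x" using f by (rule pseriesE) blast
  show ?thesis
  proof (rule pseriesI[where a = c, OF r(1)])
    show "(\<Sum>n<N. norm (c n) * r ^ n) \<le> M" for N
      using r by (intro order_trans[OF sum_mono c(1)[of N]] mult_left_mono power_mono) auto
  qed (use c(2) r in auto)
qed

lemma pseries_cong:
  assumes "pseries f x0 \<rho> M" "\<And>x. \<bar>x - x0\<bar> < \<rho> \<Longrightarrow> f x = g x"
  shows "pseries g x0 \<rho> M"
  using assms unfolding pseries_def by metis

lemma pseries_const: "\<rho> > 0 \<Longrightarrow> pseries (\<lambda>_. c) x0 \<rho> (norm c)"
proof (rule pseriesI[where a = "\<lambda>n. if n = 0 then c else 0"])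
  show "(\<lambda>n. (x - x0) ^ n *\<^sub>R (if n = 0 then c else 0)) sums c" for x
    using sums_single[of 0 "\<lambda>n. (x - x0) ^ n *\<^sub>R c"] by (simp add: if_distrib cong: if_cong)
  show "(\<Sum>n<N. norm (if n = 0 then c else 0) * \<rho> ^ n) \<le> norm c" for N
  proof -
    have "(\<Sum>n<N. norm (if n = 0 then c else 0) * \<rho> ^ n) = (\<Sum>n<N. if n = 0 then norm c else 0)"
      by (intro sum.cong) auto
    also have "\<dots> \<le> norm c" by simp
    finally show ?thesis .
  qed
qed

lemma pseries_add:
  assumes "pseries f x0 \<rho> M" "pseries g x0 \<rho> N"
  shows "pseries (\<lambda>x. f x + g x) x0 \<rho> (M + N)"
proof -
  obtain a where a: "\<rho> > 0" "\<And>N. (\<Sum>n<N. norm (a n) * \<rho> ^ n) \<le> M"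
    "\<And>x. \<bar>x - x0\<bar> < \<rho> \<Longrightarrow> (\<lambda>n. (x - x0) ^ n *\<^sub>R a n) sums f x" using assms(1) by (rule pseriesE) blast
  obtain b where b: "\<And>K. (\<Sum>n<K. norm (b n) * \<rho> ^ n) \<le> N"
    "\<And>x. \<bar>x - x0\<bar> < \<rho> \<Longrightarrow> (\<lambda>n. (x - x0) ^ n *\<^sub>R b n) sums g x" using assms(2) by (rule pseriesE) blast
  show ?thesis
  proof (rule pseriesI[where a = "\<lambda>n. a n + b n", OF a(1)])
    show "(\<Sum>n<K. norm (a n + b n) * \<rho> ^ n) \<le> M + N" for K
    proof -
      have "(\<Sum>n<K. norm (a n + b n) * \<rho> ^ n) \<le> (\<Sum>n<K. norm (a n) * \<rho> ^ n + norm (b n) * \<rho> ^ n)"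
        using a(1) by (intro sum_mono) (simp add: distrib_right[symmetric] mult_right_mono norm_triangle_ineq)
      also have "\<dots> \<le> M + N" using a(2)[of K] b(1)[of K] by (simp add: sum.distrib)
      finally show ?thesis .
    qed
    show "(\<lambda>n. (x - x0) ^ n *\<^sub>R (a n + b n)) sums (f x + g x)" if "\<bar>x - x0\<bar> < \<rho>" for x
      using sums_add[OF a(3)[OF that] b(2)[OF that]] by (simp add: scaleR_add_right)
  qed
qed

lemma pseries_linear:
  assumes "pseries f x0 \<rho> M" "bounded_linear h" "\<And>v. norm (h v) \<le> K * norm v" "K \<ge> 0"
  shows "pseries (\<lambda>x. h (f x)) x0 \<rho> (K * M)"
proof -
  interpret bounded_linear h by fact
  obtain a where a: "\<rho> > 0" "\<And>N. (\<Sum>n<N. norm (a n) * \<rho> ^ n) \<le> M"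
    "\<And>x. \<bar>x - x0\<bar> < \<rho> \<Longrightarrow> (\<lambda>n. (x - x0) ^ n *\<^sub>R a n) sums f x" using assms(1) by (rule pseriesE) blast
  show ?thesis
  proof (rule pseriesI[where a = "\<lambda>n. h (a n)", OF a(1)])
    show "(\<Sum>n<N. norm (h (a n)) * \<rho> ^ n) \<le> K * M" for N
    proof -
      have "(\<Sum>n<N. norm (h (a n)) * \<rho> ^ n) \<le> (\<Sum>n<N. (K * norm (a n)) * \<rho> ^ n)"
        using a(1) by (intro sum_mono mult_right_mono assms) auto
      also have "\<dots> = K * (\<Sum>n<N. norm (a n) * \<rho> ^ n)" by (simp add: sum_distrib_left mult.assoc)
      finally show ?thesis using mult_left_mono[OF a(2)[of N] assms(4)] by linarith
    qed
    show "(\<lambda>n. (x - x0) ^ n *\<^sub>R h (a n)) sums h (f x)" if "\<bar>x - x0\<bar> < \<rho>" for x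
      using sums[OF a(3)[OF that]] by (simp add: scaleR)
  qed
qed

lemma pseries_mult:
  fixes f g :: "real \<Rightarrow> 'a::{real_normed_algebra,banach}"
  assumes "pseries f x0 \<rho> M" "pseries g x0 \<rho> N"
  shows "pseries (\<lambda>x. f x * g x) x0 \<rho> (M * N)"
proof -
  obtain a where a: "\<rho> > 0" "summable (\<lambda>n. norm (a n) * \<rho> ^ n)" "\<And>N. (\<Sum>n<N. norm (a n) * \<rho> ^ n) \<le> M"
    "\<And>x. \<bar>x - x0\<bar> < \<rho> \<Longrightarrow> (\<lambda>n. (x - x0) ^ n *\<^sub>R a n) sums f x"
    "\<And>x. \<bar>x - x0\<bar> < \<rho> \<Longrightarrow> summable (\<lambda>n. norm ((x - x0) ^ n *\<^sub>R a n))" using assms(1) by (rule pseriesE) blast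
  obtain b where b: "summable (\<lambda>n. norm (b n) * \<rho> ^ n)" "\<And>K. (\<Sum>n<K. norm (b n) * \<rho> ^ n) \<le> N"
    "\<And>x. \<bar>x - x0\<bar> < \<rho> \<Longrightarrow> (\<lambda>n. (x - x0) ^ n *\<^sub>R b n) sums g x"
    "\<And>x. \<bar>x - x0\<bar> < \<rho> \<Longrightarrow> summable (\<lambda>n. norm ((x - x0) ^ n *\<^sub>R b n))" using assms(2) by (rule pseriesE) blast
  define c where "c = (\<lambda>k. \<Sum>i\<le>k. a i * b (k - i))"
  show ?thesis
  proof (rule pseriesI[where a = c, OF a(1)])
    fix K
    let ?a = "\<lambda>n. norm (a n) * \<rho> ^ n" and ?b = "\<lambda>n. norm (b n) * \<rho> ^ n"
    have le: "norm (c k) * \<rho> ^ k \<le> (\<Sum>i\<le>k. ?a i * ?b (k - i))" for k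
    proof -
      have "norm (c k) * \<rho> ^ k \<le> (\<Sum>i\<le>k. norm (a i) * norm (b (k - i))) * \<rho> ^ k"
        unfolding c_def using a(1)
        by (intro mult_right_mono order_trans[OF norm_sum] sum_mono norm_mult_ineq) auto
      also have "\<dots> = (\<Sum>i\<le>k. ?a i * ?b (k - i))"
        unfolding sum_distrib_right
      proof (rule sum.cong)
        fix i assume "i \<in> {..k}"
        then have "\<rho> ^ k = \<rho> ^ i * \<rho> ^ (k - i)" by (simp add: power_add[symmetric])
        then show "norm (a i) * norm (b (k - i)) * \<rho> ^ k = ?a i * ?b (k - i)" by simp
      qed simp
      finally show ?thesis .
    qed
    have sa: "summable (\<lambda>n. norm (?a n))" "summable (\<lambda>n. norm (?b n))" using a(1,2) b(1) by auto
    have "(\<Sum>k<K. norm (c k) * \<rho> ^ k) \<le> (\<Sum>k<K. \<Sum>i\<le>k. ?a i * ?b (k - i))"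
      by (intro sum_mono le)
    also have "\<dots> \<le> (\<Sum>k. \<Sum>i\<le>k. ?a i * ?b (k - i))"
      using a(1) by (intro sum_le_suminf summable_Cauchy_product sa) (auto intro!: sum_nonneg)
    also have "\<dots> = (\<Sum>n. ?a n) * (\<Sum>n. ?b n)"
      by (rule Cauchy_product[symmetric]) (rule sa)+
    also have "\<dots> \<le> M * N"
      using a(1) a(3)[of 0] b(2)[of 0]
      by (intro mult_mono suminf_le_const suminf_nonneg a b) auto
    finally show "(\<Sum>k<K. norm (c k) * \<rho> ^ k) \<le> M * N" .
  next
    fix x assume x: "\<bar>x - x0\<bar> < \<rho>"
    have "(\<lambda>k. \<Sum>i\<le>k. (x - x0) ^ i *\<^sub>R a i * (x - x0) ^ (k - i) *\<^sub>R b (k - i)) sums (f x * g x)"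
      using Cauchy_product_sums[OF a(5)[OF x] b(4)[OF x]] a(4)[OF x] b(3)[OF x] by (simp add: sums_iff)
    moreover have "(\<Sum>i\<le>k. (x - x0) ^ i *\<^sub>R a i * (x - x0) ^ (k - i) *\<^sub>R b (k - i)) = (x - x0) ^ k *\<^sub>R c k" for k
      unfolding c_def scaleR_sum_right by (intro sum.cong) (auto simp: power_add[symmetric])
    ultimately show "(\<lambda>k. (x - x0) ^ k *\<^sub>R c k) sums (f x * g x)" by simp
  qed
qed

lemma pseries_power:
  fixes f :: "real \<Rightarrow> 'a::{real_normed_algebra_1,banach}"
  assumes "pseries f x0 \<rho> M"
  shows "pseries (\<lambda>x. f x ^ n) x0 \<rho> (M ^ n)"
proof (induction n)
  case 0
  have "\<rho> > 0" using assms by (rule pseriesE)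
  then show ?case using pseries_const[of \<rho> "1::'a" x0] by simp
next
  case (Suc n)
  then show ?case using pseries_mult[OF assms Suc] by simp
qed

text \<open>All terms but the constant one gain a factor r / \<rho>, as (r / \<rho>)^n \<le> r /
  \<rho> for n > 0. A small radius thus brings the majorant down to almost the norm of the value at
  the centre.\<close>

lemma pseries_shrink:
  assumes f: "pseries f x0 \<rho> M" and e: "\<epsilon> > 0"
  shows "\<exists>\<delta>>0. \<forall>r. 0 < r \<longrightarrow> r \<le> \<delta> \<longrightarrow> pseries f x0 r (norm (f x0) + \<epsilon>)"
proof -
  obtain a where a: "\<rho> > 0" "\<And>N. (\<Sum>n<N. norm (a n) * \<rho> ^ n) \<le> M"
    "\<And>x. \<bar>x - x0\<bar> < \<rho> \<Longrightarrow> (\<lambda>n. (x - x0) ^ n *\<^sub>R a n) sums f x" using f by (rule pseriesE) blast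
  have "(\<lambda>n. (x0 - x0) ^ n *\<^sub>R a n) sums f x0" using a(3)[of x0] a(1) by simp
  moreover have "(\<lambda>n. (x0 - x0) ^ n *\<^sub>R a n) sums a 0"
    by (rule sums_cong[THEN iffD1, OF _ sums_single[of 0 a]]) (auto simp: power_0_left)
  ultimately have a0: "a 0 = f x0" by (rule sums_unique2[symmetric])
  have M: "M \<ge> 0" using a(2)[of 0] by simp
  define \<delta> where "\<delta> = min \<rho> (\<epsilon> * \<rho> / (M + 1))"
  have "\<delta> > 0" using a(1) e M by (simp add: \<delta>_def)
  moreover have "pseries f x0 r (norm (f x0) + \<epsilon>)" if r: "0 < r" "r \<le> \<delta>" for r
  proof (rule pseriesI[where a = a, OF r(1)])
    show "(\<lambda>n. (x - x0) ^ n *\<^sub>R a n) sums f x" if "\<bar>x - x0\<bar> < r" for x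
      using that r a(3)[of x] by (simp add: \<delta>_def)
    fix N
    have q: "r / \<rho> \<ge> 0" "r / \<rho> \<le> 1" using r a(1) by (auto simp: \<delta>_def)
    have le: "norm (a n) * r ^ n \<le> (if n = 0 then norm (f x0) else 0) + (r / \<rho>) * (norm (a n) * \<rho> ^ n)" for n
    proof (cases n)
      case 0 then show ?thesis using a0 q mult_nonneg_nonneg[OF q(1) norm_ge_zero[of "f x0"]] by simp
    next
      case (Suc m)
      have "norm (a n) * r ^ n = (r / \<rho>) ^ n * (norm (a n) * \<rho> ^ n)"
        using a(1) by (simp add: power_divide)
      also have "\<dots> \<le> (r / \<rho>) ^ 1 * (norm (a n) * \<rho> ^ n)"
        using Suc q a(1) by (intro mult_right_mono power_decreasing) auto
      finally show ?thesis using Suc by simp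
    qed
    have "(\<Sum>n<N. norm (a n) * r ^ n) \<le> (\<Sum>n<N. (if n = 0 then norm (f x0) else 0)) + (r / \<rho>) * (\<Sum>n<N. norm (a n) * \<rho> ^ n)"
      unfolding sum_distrib_left sum.distrib[symmetric] by (intro sum_mono le)
    also have "(\<Sum>n<N. (if n = 0 then norm (f x0) else 0)) \<le> norm (f x0)" by simp
    also have "(r / \<rho>) * (\<Sum>n<N. norm (a n) * \<rho> ^ n) \<le> (r / \<rho>) * (M + 1)"
      using a(2)[of N] q by (intro mult_left_mono) auto
    also have "(r / \<rho>) * (M + 1) \<le> \<epsilon>"
      using r a(1) M by (simp add: \<delta>_def field_simps)
    finally show "(\<Sum>n<N. norm (a n) * r ^ n) \<le> norm (f x0) + \<epsilon>" by simp
  qed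
  ultimately show ?thesis by blast
qed

section \<open>Sums over infinite families of power series\<close>

lemma has_sum_swap_pair:
  "((\<lambda>(i, n). f i n) has_sum S) (A \<times> B) \<Longrightarrow> ((\<lambda>(n, i). f i n) has_sum S) (B \<times> A)"
  using has_sum_swap[where f = "\<lambda>(i, n). f i n" and S = S and A = A and B = B] by (simp add: case_prod_unfold)

text \<open>The bound over finite rectangles makes the double family of coefficients absolutely
  summable, and Fubini allows summation over \<open>I\<close> coefficient by coefficient.
  \<open>I\<close> may be any set, the sums being unconditional.\<close>

lemma pseries_infsum:
  fixes a :: "'i \<Rightarrow> nat \<Rightarrow> 'a::banach"
  assumes \<rho>: "\<rho> > 0"
    and f: "\<And>i x. i \<in> I \<Longrightarrow> \<bar>x - x0\<bar> < \<rho> \<Longrightarrow> (\<lambda>n. (x - x0) ^ n *\<^sub>R a i n) sums f i x"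
    and bound: "\<And>F N. finite F \<Longrightarrow> F \<subseteq> I \<Longrightarrow> (\<Sum>i\<in>F. \<Sum>n<N. norm (a i n) * \<rho> ^ n) \<le> M"
  shows "pseries (\<lambda>x. \<Sum>\<^sub>\<infinity>i\<in>I. f i x) x0 \<rho> M"
    and "\<bar>x - x0\<bar> < \<rho> \<Longrightarrow> (\<lambda>i. f i x) summable_on I"
proof -
  define g where "g = (\<lambda>(i, n). norm (a i n) * \<rho> ^ n)"
  have gnn: "g p \<ge> 0" for p using \<rho> by (auto simp: g_def split: prod.split)
  have gb: "sum g X \<le> M" if X: "finite X" "X \<subseteq> I \<times> UNIV" for X
  proof -
    obtain N where N: "snd ` X \<subseteq> {..<N}" using X finite_nat_iff_bounded by (metis finite_imageI)
    have "sum g X \<le> sum g (fst ` X \<times> {..<N})"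
      using X N by (intro sum_mono2) (auto simp: gnn, force)
    also have "\<dots> = (\<Sum>i\<in>fst ` X. \<Sum>n<N. norm (a i n) * \<rho> ^ n)"
      by (simp add: g_def sum.cartesian_product)
    also have "\<dots> \<le> M" using X by (intro bound) auto
    finally show ?thesis .
  qed
  have gs: "g summable_on I \<times> UNIV"
    by (rule nonneg_bdd_above_summable_on) (use gnn gb in \<open>auto intro!: bdd_aboveI2[where M = M]\<close>)
  have gM: "infsum g (I \<times> UNIV) \<le> M"
    by (rule infsum_le_finite_sums[OF gs]) (use gb in auto)
  define b where "b = (\<lambda>n. \<Sum>\<^sub>\<infinity>i\<in>I. a i n)"
  \<comment> \<open>The end point t = \<rho> is included: it yields in \<open>as\<close> the
    summability over i of each single coefficient.\<close>
  have hs: "(\<lambda>p. norm (case p of (i, n) \<Rightarrow> t ^ n *\<^sub>R a i n)) summable_on I \<times> UNIV" if t: "\<bar>t\<bar> \<le> \<rho>" for t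
  proof (rule Infinite_Sum.abs_summable_on_comparison_test)
    show "(\<lambda>p. norm (g p)) summable_on I \<times> UNIV" using gs gnn by simp
    show "norm (case p of (i, n) \<Rightarrow> t ^ n *\<^sub>R a i n) \<le> norm (g p)" for p
      using t \<rho> by (auto simp: g_def abs_mult mult.commute power_abs split: prod.split intro!: mult_right_mono power_mono)
  qed
  have as: "(\<lambda>i. norm (a i n)) summable_on I" for n
  proof -
    have "(\<lambda>i. norm (\<rho> ^ n *\<^sub>R a i n)) summable_on I"
    proof -
      have "((\<lambda>p. norm (case p of (i, n) \<Rightarrow> \<rho> ^ n *\<^sub>R a i n)) summable_on (\<lambda>i. (i, n)) ` I)"
        by (rule summable_on_subset_banach[OF hs]) (use \<rho> in auto)
      then show ?thesis by (subst (asm) summable_on_reindex) (auto simp: inj_on_def o_def)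
    qed
    then have "(\<lambda>i. (1 / \<rho> ^ n) * norm (\<rho> ^ n *\<^sub>R a i n)) summable_on I"
      by (rule summable_on_cmult_right)
    then show ?thesis using \<rho> by simp
  qed
  have fsum: "((\<lambda>n. (x - x0) ^ n *\<^sub>R a i n) has_sum f i x) UNIV" if "i \<in> I" "\<bar>x - x0\<bar> < \<rho>" for i x
  proof -
    have g: "summable (\<lambda>n. norm (a i n) * \<rho> ^ n)"
      by (rule summableI_nonneg_bounded[where x = M]) (use bound[of "{i}"] that \<rho> in auto)
    have "summable (\<lambda>n. norm ((x - x0) ^ n *\<^sub>R a i n))"
    proof (rule summable_comparison_test'[OF g, of 0])
      fix n
      have "\<bar>x - x0\<bar> ^ n \<le> \<rho> ^ n" using that by (intro power_mono) auto
      then show "norm (norm ((x - x0) ^ n *\<^sub>R a i n)) \<le> norm (a i n) * \<rho> ^ n"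
        using mult_right_mono[OF _ norm_ge_zero[of "a i n"]] by (simp add: power_abs mult.commute[of "norm (a i n)"])
    qed
    then show ?thesis by (rule norm_summable_imp_has_sum) (rule f[OF that])
  qed
  have tot: "((\<lambda>(i, n). (x - x0) ^ n *\<^sub>R a i n) summable_on I \<times> UNIV)" if "\<bar>x - x0\<bar> < \<rho>" for x
    by (rule abs_summable_summable[OF hs]) (use that in auto)
  show summ: "(\<lambda>i. f i x) summable_on I" if x: "\<bar>x - x0\<bar> < \<rho>" for x
    by (rule has_sum_imp_summable, rule has_sum_SigmaD[OF has_sum_infsum[OF tot[OF x]]])
      (use fsum[OF _ x] in auto)
  show "pseries (\<lambda>x. \<Sum>\<^sub>\<infinity>i\<in>I. f i x) x0 \<rho> M"
  proof (rule pseriesI[where a = b, OF \<rho>])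
    fix x assume x: "\<bar>x - x0\<bar> < \<rho>"
    have eq: "infsum (\<lambda>(i, n). (x - x0) ^ n *\<^sub>R a i n) (I \<times> UNIV) = (\<Sum>\<^sub>\<infinity>i\<in>I. f i x)"
      by (rule infsumI[symmetric], rule has_sum_SigmaD[OF has_sum_infsum[OF tot[OF x]]])
        (use fsum[OF _ x] in auto)
    have 1: "((\<lambda>(n, i). (x - x0) ^ n *\<^sub>R a i n) has_sum (\<Sum>\<^sub>\<infinity>i\<in>I. f i x)) (UNIV \<times> I)"
      using has_sum_infsum[OF tot[OF x]] unfolding eq by (rule has_sum_swap_pair)
    have 2: "((\<lambda>i. (x - x0) ^ n *\<^sub>R a i n) has_sum (x - x0) ^ n *\<^sub>R b n) I" for n
      unfolding b_def by (rule has_sum_scaleR, rule has_sum_infsum, rule abs_summable_summable, rule as)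
    have "((\<lambda>n. (x - x0) ^ n *\<^sub>R b n) has_sum (\<Sum>\<^sub>\<infinity>i\<in>I. f i x)) UNIV"
      by (rule has_sum_SigmaD[OF 1]) (simp only: split, rule 2)
    then show "(\<lambda>n. (x - x0) ^ n *\<^sub>R b n) sums (\<Sum>\<^sub>\<infinity>i\<in>I. f i x)" by (rule has_sum_imp_sums)
  next
    fix N
    have 3: "((\<lambda>(n, i). g (i, n)) has_sum infsum g (I \<times> UNIV)) (UNIV \<times> I)"
      using has_sum_infsum[OF gs] by - (rule has_sum_swap_pair, simp)
    have *: "((\<lambda>i. g (i, n)) has_sum (\<Sum>\<^sub>\<infinity>i\<in>I. norm (a i n)) * \<rho> ^ n) I" for n
      unfolding g_def split by (rule has_sum_cmult_left, rule has_sum_infsum, rule as)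
    have S: "((\<lambda>n. (\<Sum>\<^sub>\<infinity>i\<in>I. norm (a i n)) * \<rho> ^ n) has_sum infsum g (I \<times> UNIV)) UNIV"
      by (rule has_sum_SigmaD[OF 3]) (simp only: split, rule *)
    have "(\<Sum>n<N. norm (b n) * \<rho> ^ n) \<le> (\<Sum>n<N. (\<Sum>\<^sub>\<infinity>i\<in>I. norm (a i n)) * \<rho> ^ n)"
      unfolding b_def using \<rho> by (intro sum_mono mult_right_mono norm_infsum_bound as) auto
    also have "\<dots> \<le> infsum g (I \<times> UNIV)"
      using finite_sum_le_has_sum[OF S, of "{..<N}"] \<rho> by (auto simp: infsum_nonneg)
    also have "\<dots> \<le> M" by (rule gM)
    finally show "(\<Sum>n<N. norm (b n) * \<rho> ^ n) \<le> M" .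
  qed
qed

lemma pseries_suminf:
  assumes "\<And>k. pseries (f k) x0 \<rho> (m k)" "summable m"
  shows "pseries (\<lambda>x. \<Sum>\<^sub>\<infinity>k. f k x) x0 \<rho> (suminf m)"
    and "\<bar>x - x0\<bar> < \<rho> \<Longrightarrow> (\<lambda>k. f k x) summable_on (UNIV :: nat set)"
proof -
  have "\<exists>a. (\<forall>N. (\<Sum>n<N. norm (a n) * \<rho> ^ n) \<le> m k) \<and>
    (\<forall>x. \<bar>x - x0\<bar> < \<rho> \<longrightarrow> (\<lambda>n. (x - x0) ^ n *\<^sub>R a n) sums f k x)" for k
    using assms(1)[of k] by (rule pseriesE) blast
  then obtain a where a: "\<And>k N. (\<Sum>n<N. norm (a k n) * \<rho> ^ n) \<le> m k"
    "\<And>k x. \<bar>x - x0\<bar> < \<rho> \<Longrightarrow> (\<lambda>n. (x - x0) ^ n *\<^sub>R a k n) sums f k x" by metis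
  have \<rho>: "\<rho> > 0" using assms(1) by (rule pseriesE)
  have m: "m k \<ge> 0" for k using a(1)[where k = k and N = 0] by simp
  have b: "(\<Sum>i\<in>F. \<Sum>n<N. norm (a i n) * \<rho> ^ n) \<le> suminf m" if "finite F" for F N
    using order_trans[OF sum_mono[OF a(1)] sum_le_suminf[OF assms(2) that m]] .
  show "pseries (\<lambda>x. \<Sum>\<^sub>\<infinity>k. f k x) x0 \<rho> (suminf m)"
    by (rule pseries_infsum(1)[OF \<rho> a(2) b])
  show "\<bar>x - x0\<bar> < \<rho> \<Longrightarrow> (\<lambda>k. f k x) summable_on (UNIV :: nat set)"
    by (rule pseries_infsum(2)[OF \<rho> a(2) b])
qed

text \<open>Convergence at the single point x0 + s, which lies in \<open>G\<close> by openness,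
  bounds norm (a n) * s^n; on half that radius the series is dominated by a geometric one.\<close>

lemma real_analytic_on_iff_pser:
  assumes "open G"
  shows "real_analytic_on f G \<longleftrightarrow> (\<forall>x0\<in>G. \<exists>\<rho> M. pseries f x0 \<rho> M)"
proof
  assume f: "real_analytic_on f G"
  show "\<forall>x0\<in>G. \<exists>\<rho> M. pseries f x0 \<rho> M"
  proof
    fix x0 assume x0: "x0 \<in> G"
    then obtain a r where r: "r > 0" and a: "\<And>x. x \<in> G \<Longrightarrow> \<bar>x - x0\<bar> < r \<Longrightarrow> (\<lambda>n. (x - x0) ^ n *\<^sub>R a n) sums f x"
      using f unfolding real_analytic_on_def by blast
    obtain d where d: "d > 0" "\<And>x. \<bar>x - x0\<bar> < d \<Longrightarrow> x \<in> G"
      using assms x0 unfolding open_dist dist_real_def by blast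
    define s where "s = min r d / 2"
    have s: "s > 0" "s < r" "s < d" using r d by (auto simp: s_def)
    have "(\<lambda>n. s ^ n *\<^sub>R a n) sums f (x0 + s)" using a[of "x0 + s"] d(2)[of "x0 + s"] s by auto
    then have "bounded (range (\<lambda>n. s ^ n *\<^sub>R a n))"
      using summable_imp_bounded sums_summable by blast
    then obtain K where K: "norm (s ^ n *\<^sub>R a n) \<le> K" for n unfolding bounded_iff by auto
    have Kb: "norm (a n) * (s / 2) ^ n \<le> K * (1 / 2) ^ n" for n
    proof -
      have "(norm (a n) * s ^ n) * (1 / 2) ^ n \<le> K * (1 / 2) ^ n"
        using K[of n] s(1) by (intro mult_right_mono) (auto simp: mult.commute)
      then show ?thesis by (simp add: power_divide)
    qed
    have "pseries f x0 (s / 2) (K * 2)"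
    proof (rule pseriesI[where a = a])
      show "s / 2 > 0" using s by simp
      show "(\<lambda>n. (x - x0) ^ n *\<^sub>R a n) sums f x" if "\<bar>x - x0\<bar> < s / 2" for x
        using that s by (intro a d) auto
      fix N
      have "(\<Sum>n<N. norm (a n) * (s / 2) ^ n) \<le> (\<Sum>n<N. K * (1 / 2) ^ n)" by (intro sum_mono Kb)
      also have "\<dots> = K * (\<Sum>n<N. (1 / 2) ^ n)" by (simp add: sum_distrib_left)
      also have "(\<Sum>n<N. (1 / 2) ^ n) \<le> (\<Sum>n. (1 / 2 :: real) ^ n)" by (rule sum_le_suminf) auto
      also have "(\<Sum>n. (1 / 2 :: real) ^ n) = 2" by (subst suminf_geometric) auto
      finally show "(\<Sum>n<N. norm (a n) * (s / 2) ^ n) \<le> K * 2"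
        using order_trans[OF norm_ge_zero K[of 0]] by (simp add: mult_left_mono)
    qed
    then show "\<exists>\<rho> M. pseries f x0 \<rho> M" by blast
  qed
next
  assume "\<forall>x0\<in>G. \<exists>\<rho> M. pseries f x0 \<rho> M"
  then show "real_analytic_on f G" unfolding real_analytic_on_def pseries_def by blast
qed

text \<open>Cauchy's inequality is applied to finite sums \<open>\<Sum> \<theta>\<^sub>i \<cdot> norm v\<^sub>i \<cdot> \<phi>\<^sub>i\<close> with unimodular \<open>\<theta>\<^sub>i\<close>, which
  bounds \<open>\<Sum> \<bar>c\<^sub>i\<bar> norm v\<^sub>i\<close> for the Taylor coefficients \<open>c\<^sub>i\<close> of the \<open>\<phi>\<^sub>i\<close>.\<close>
lemma pseries_nuclear:
  fixes \<phi> :: "'i \<Rightarrow> complex \<Rightarrow> complex" and v :: "'i \<Rightarrow> 'a::banach"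
  assumes \<rho>: "\<rho> > 0"
    and hol: "\<And>i. i \<in> I \<Longrightarrow> \<phi> i holomorphic_on ball (of_real x0) \<rho>"
    and bound: "\<And>F z. finite F \<Longrightarrow> F \<subseteq> I \<Longrightarrow> z \<in> ball (of_real x0) \<rho> \<Longrightarrow> (\<Sum>i\<in>F. cmod (\<phi> i z) * norm (v i)) \<le> M"
  shows "\<exists>\<delta> K. pseries (\<lambda>x. \<Sum>\<^sub>\<infinity>i\<in>I. Re (\<phi> i (of_real x)) *\<^sub>R v i) x0 \<delta> K"
proof -
  define c where "c = (\<lambda>i n. (deriv ^^ n) (\<phi> i) (of_real x0) / fact n)"
  \<comment> \<open>First halving: the circle for Cauchy's inequality stays inside the disc. The
    second one, in \<open>\<delta>\<close>, turns the coefficient bound M / s^n into a geometric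
    series with sum 2 M.\<close>
  define s where "s = \<rho> / 2"
  have s: "s > 0" "s < \<rho>" using \<rho> by (auto simp: s_def)
  have cb: "(\<Sum>i\<in>F. cmod (c i n) * norm (v i)) * s ^ n \<le> M" if F: "finite F" "F \<subseteq> I" for F n
  proof -
    define \<theta> where "\<theta> = (\<lambda>i. if c i n = 0 then 0 else of_real (cmod (c i n)) / c i n)"
    have \<theta>: "\<theta> i * c i n = of_real (cmod (c i n))" "cmod (\<theta> i) \<le> 1" for i
      by (auto simp: \<theta>_def norm_divide)
    define H where "H = (\<lambda>z. \<Sum>i\<in>F. (\<theta> i * of_real (norm (v i))) * \<phi> i z)"
    have holH: "H holomorphic_on ball (of_real x0) \<rho>"
      unfolding H_def using hol F by (intro holomorphic_intros) auto
    have "(\<lambda>m. (\<Sum>i\<in>F. (\<theta> i * of_real (norm (v i))) * c i m) * (z - of_real x0) ^ m) sums H z"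
      if z: "z \<in> ball (of_real x0) \<rho>" for z
    proof -
      have "(\<lambda>m. \<Sum>i\<in>F. (\<theta> i * of_real (norm (v i))) * (c i m * (z - of_real x0) ^ m)) sums H z"
        unfolding H_def c_def using F
        by (intro sums_sum sums_mult holomorphic_power_series[OF hol z]) auto
      then show ?thesis by (simp add: sum_distrib_right mult.assoc)
    qed
    from sums_imp_higher_deriv(2)[OF \<rho> this]
    have "(deriv ^^ n) H (of_real x0) / fact n = (\<Sum>i\<in>F. of_real (norm (v i)) * (\<theta> i * c i n))"
      by (simp add: mult_ac)
    also have "\<dots> = of_real (\<Sum>i\<in>F. cmod (c i n) * norm (v i))" by (simp add: \<theta> mult.commute)
    finally have eq: "cmod ((deriv ^^ n) H (of_real x0) / fact n) = (\<Sum>i\<in>F. cmod (c i n) * norm (v i))"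
      by (simp add: sum_nonneg del: of_real_sum)
    have "cmod ((deriv ^^ n) H (of_real x0) / fact n) * s ^ n \<le> M"
    proof (rule taylor_coeff_bound[OF holH s])
      fix z :: complex assume z: "dist (of_real x0) z = s"
      have "cmod (H z) \<le> (\<Sum>i\<in>F. cmod (\<phi> i z) * norm (v i))"
        unfolding H_def
      proof (rule order_trans[OF norm_sum sum_mono])
        fix i
        have "cmod (\<theta> i) * (norm (v i) * cmod (\<phi> i z)) \<le> 1 * (norm (v i) * cmod (\<phi> i z))"
          by (intro mult_right_mono \<theta>) auto
        then show "cmod (\<theta> i * of_real (norm (v i)) * \<phi> i z) \<le> cmod (\<phi> i z) * norm (v i)"
          by (simp add: norm_mult mult_ac)
      qed
      also have "\<dots> \<le> M" using F z s by (intro bound) auto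
      finally show "cmod (H z) \<le> M" .
    qed
    then show ?thesis unfolding eq .
  qed
  define \<delta> where "\<delta> = s / 2"
  have \<delta>: "\<delta> > 0" "\<delta> < \<rho>" using s by (auto simp: \<delta>_def)
  have M: "M \<ge> 0" using cb[of "{}" 0] by simp
  \<comment> \<open>Since x - x0 is real, real parts can be taken term by term, and the coefficients
    Re (c i n) are scalars of the real Banach space.\<close>
  have "pseries (\<lambda>x. \<Sum>\<^sub>\<infinity>i\<in>I. Re (\<phi> i (of_real x)) *\<^sub>R v i) x0 \<delta> (M * 2)"
  proof (rule pseries_infsum(1)[where a = "\<lambda>i n. Re (c i n) *\<^sub>R v i", OF \<delta>(1)])
    fix i x assume i: "i \<in> I" and x: "\<bar>x - x0\<bar> < \<delta>"
    have d: "dist (complex_of_real x0) (of_real x) = \<bar>x - x0\<bar>"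
      by (metis abs_minus_commute dist_norm norm_of_real of_real_diff)
    have "(\<lambda>n. c i n * (of_real x - of_real x0) ^ n) sums \<phi> i (of_real x)"
      unfolding c_def by (rule holomorphic_power_series[OF hol[OF i]]) (use x \<delta> d in auto)
    then have "(\<lambda>n. Re (c i n * (of_real x - of_real x0) ^ n)) sums Re (\<phi> i (of_real x))"
      by (rule sums_Re)
    moreover have "Re (c i n * (of_real x - of_real x0) ^ n) = (x - x0) ^ n * Re (c i n)" for n
      by (simp flip: of_real_diff of_real_power)
    ultimately have "(\<lambda>n. (x - x0) ^ n * Re (c i n)) sums Re (\<phi> i (of_real x))" by (simp only: mult.commute)
    then show "(\<lambda>n. (x - x0) ^ n *\<^sub>R (Re (c i n) *\<^sub>R v i)) sums (Re (\<phi> i (of_real x)) *\<^sub>R v i)"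
      using sums_scaleR_left by fastforce
  next
    fix F N assume F: "finite F" "F \<subseteq> I"
    have "(\<Sum>i\<in>F. \<Sum>n<N. norm (Re (c i n) *\<^sub>R v i) * \<delta> ^ n) = (\<Sum>n<N. (\<Sum>i\<in>F. \<bar>Re (c i n)\<bar> * norm (v i)) * s ^ n * (1 / 2) ^ n)"
      by (subst sum.swap) (simp add: sum_distrib_right sum_divide_distrib \<delta>_def power_divide)
    also have "\<dots> \<le> (\<Sum>n<N. M * (1 / 2) ^ n)"
    proof (rule sum_mono)
      fix n
      have "(\<Sum>i\<in>F. \<bar>Re (c i n)\<bar> * norm (v i)) * s ^ n \<le> (\<Sum>i\<in>F. cmod (c i n) * norm (v i)) * s ^ n"
        using s by (intro mult_right_mono sum_mono abs_Re_le_cmod) auto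
      also have "\<dots> \<le> M" by (rule cb[OF F])
      finally show "(\<Sum>i\<in>F. \<bar>Re (c i n)\<bar> * norm (v i)) * s ^ n * (1 / 2) ^ n \<le> M * (1 / 2) ^ n"
        by (intro mult_right_mono) auto
    qed
    also have "\<dots> = M * (\<Sum>n<N. (1 / 2) ^ n)" by (simp add: sum_distrib_left)
    also have "(\<Sum>n<N. (1 / 2) ^ n) \<le> (\<Sum>n. (1 / 2 :: real) ^ n)" by (rule sum_le_suminf) auto
    also have "(\<Sum>n. (1 / 2 :: real) ^ n) = 2" by (subst suminf_geometric) auto
    finally show "(\<Sum>i\<in>F. \<Sum>n<N. norm (Re (c i n) *\<^sub>R v i) * \<delta> ^ n) \<le> M * 2" using M by (simp add: mult_left_mono)
  qed
  then show ?thesis by blast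
qed

section \<open>Idempotents near almost idempotent elements\<close>

text \<open>Taylor coefficients of (1 - y)^(-1/2), that is (2k choose k) / 4^k.\<close>

definition invsqrt_coeff :: "nat \<Rightarrow> real"
  where "invsqrt_coeff k = (- 1) ^ k * ((- 1 / 2 :: real) gchoose k)"

text \<open>Consecutive coefficients have the ratio (k + 1/2) / (k + 1) < 1. By the upper bound the
  series converges wherever the powers of y are absolutely summable.\<close>

lemma invsqrt_coeff_bounds: "0 \<le> invsqrt_coeff k" "invsqrt_coeff k \<le> 1"
proof -
  have rec: "invsqrt_coeff (Suc k) = invsqrt_coeff k * ((real k + 1 / 2) / (real k + 1))" for k
    unfolding invsqrt_coeff_def gbinomial_Suc_rec by (simp add: field_simps)
  have "0 \<le> invsqrt_coeff k \<and> invsqrt_coeff k \<le> 1"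
  proof (induction k)
    case 0 show ?case by (simp add: invsqrt_coeff_def)
  next
    case (Suc k)
    have "(real k + 1 / 2) / (real k + 1) \<le> 1" by simp
    with Suc show ?case unfolding rec by (intro conjI mult_nonneg_nonneg mult_le_one) auto
  qed
  then show "0 \<le> invsqrt_coeff k" "invsqrt_coeff k \<le> 1" by auto
qed

text \<open>Vandermonde's identity with both upper arguments -1/2: the square of the series has the
  coefficients of 1 / (1 - y).\<close>

lemma invsqrt_coeff_convolution: "(\<Sum>i\<le>k. invsqrt_coeff i * invsqrt_coeff (k - i)) = 1"
proof -
  have "(\<Sum>i\<le>k. invsqrt_coeff i * invsqrt_coeff (k - i)) =
    (\<Sum>i\<le>k. (- 1) ^ k * (((- 1 / 2 :: real) gchoose i) * ((- 1 / 2 :: real) gchoose (k - i))))"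
    by (intro sum.cong) (auto simp: invsqrt_coeff_def power_add[symmetric] mult_ac)
  also have "\<dots> = (- 1) ^ k * ((- 1) gchoose k)"
    using gbinomial_Vandermonde[where a = "- 1 / 2 :: real" and b = "- 1 / 2" and n = k]
    by (simp add: sum_distrib_left[symmetric] atLeast0AtMost)
  also have "((- 1) gchoose k :: real) = (- 1) ^ k"
  proof -
    have "(real k gchoose k) = 1" by (metis binomial_gbinomial binomial_n_n of_nat_1)
    then show ?thesis using gbinomial_minus[of "1::real" k] by simp
  qed
  finally show ?thesis by (simp add: power_mult_distrib[symmetric])
qed

definition invsqrt_series :: "'a::{real_normed_algebra_1,banach} \<Rightarrow> 'a"
  where "invsqrt_series y = (\<Sum>\<^sub>\<infinity>k. invsqrt_coeff k *\<^sub>R y ^ k)"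

context
  fixes y :: "'a::{real_normed_algebra_1,banach}"
  assumes summ: "summable (\<lambda>k. norm (y ^ k))"
begin

lemma invsqrt_norm_summable: "summable (\<lambda>k. norm (invsqrt_coeff k *\<^sub>R y ^ k))"
proof (rule summable_comparison_test'[OF summ, of 0])
  fix k show "norm (norm (invsqrt_coeff k *\<^sub>R y ^ k)) \<le> norm (y ^ k)"
    using mult_right_mono[OF invsqrt_coeff_bounds(2)[of k] norm_ge_zero[of "y ^ k"]]
      invsqrt_coeff_bounds(1)[of k] by simp
qed

lemma invsqrt_has_sum: "((\<lambda>k. invsqrt_coeff k *\<^sub>R y ^ k) has_sum invsqrt_series y) UNIV"
  unfolding invsqrt_series_def
  by (intro has_sum_infsum norm_summable_imp_summable_on invsqrt_norm_summable)

lemma invsqrt_series_square: "invsqrt_series y * invsqrt_series y * (1 - y) = 1"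
proof -
  note s = has_sum_imp_sums[OF invsqrt_has_sum]
  have "(\<Sum>i\<le>k. invsqrt_coeff i *\<^sub>R y ^ i * invsqrt_coeff (k - i) *\<^sub>R y ^ (k - i)) = y ^ k" for k
  proof -
    have "(\<Sum>i\<le>k. invsqrt_coeff i *\<^sub>R y ^ i * invsqrt_coeff (k - i) *\<^sub>R y ^ (k - i)) =
      (\<Sum>i\<le>k. (invsqrt_coeff i * invsqrt_coeff (k - i)) *\<^sub>R y ^ k)"
      by (intro sum.cong) (auto simp: power_add[symmetric])
    then show ?thesis by (simp add: scaleR_sum_left[symmetric] invsqrt_coeff_convolution)
  qed
  then have sq: "(\<lambda>k. y ^ k) sums (invsqrt_series y * invsqrt_series y)"
    using Cauchy_product_sums[OF invsqrt_norm_summable invsqrt_norm_summable] s by (simp add: sums_iff)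
  let ?S = "invsqrt_series y * invsqrt_series y"
  have "(\<lambda>k. y ^ Suc k) sums (?S * y)" using sums_mult2[OF sq, of y] by (simp add: power_Suc2 del: power_Suc)
  moreover have "(\<lambda>k. y ^ Suc k) sums (?S - 1)" using sq by (subst sums_Suc_iff) simp
  ultimately have "?S * y = ?S - 1" by (rule sums_unique2)
  then show ?thesis by (simp add: right_diff_distrib)
qed

lemma invsqrt_series_linear:
  assumes "bounded_linear h" "\<And>k. h (y ^ k) = g k"
  shows "((\<lambda>k. invsqrt_coeff k *\<^sub>R g k) has_sum h (invsqrt_series y)) UNIV"
  using has_sum_bounded_linear[OF assms(1) invsqrt_has_sum]
  by (simp add: assms(2) linear_simps(5)[OF assms(1)])

text \<open>Identities for the series need only be checked on powers of \<open>y\<close>.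
  Commutation (left against right multiplication) and invariance under an involution are obtained in
  this way.\<close>

lemma invsqrt_series_linear_eq:
  assumes "bounded_linear h" "bounded_linear g" "\<And>k. h (y ^ k) = g (y ^ k)"
  shows "h (invsqrt_series y) = g (invsqrt_series y)"
  using invsqrt_series_linear[OF assms(1) refl] invsqrt_series_linear[OF assms(2) refl]
  unfolding assms(3) by (rule has_sum_unique)

text \<open>Only the constant term of the series survives. This serves both homomorphisms that kill
  \<open>y\<close> and multiplication by elements that annihilate it.\<close>

lemma invsqrt_series_linear_vanish:
  assumes "bounded_linear h" "\<And>k. h (y ^ Suc k) = 0"
  shows "h (invsqrt_series y) = h 1"
proof -
  have "((\<lambda>k. invsqrt_coeff k *\<^sub>R (if k = 0 then h 1 else 0)) has_sum h (invsqrt_series y)) UNIV"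
    by (rule invsqrt_series_linear[OF assms(1)]) (use assms(2) gr0_conv_Suc in auto)
  from has_sum_imp_sums[OF this]
  have "(\<lambda>k. if k = 0 then h 1 else 0) sums h (invsqrt_series y)"
    by (rule sums_cong[THEN iffD1, rotated]) (auto simp: invsqrt_coeff_def)
  then show ?thesis using sums_single[of 0 "\<lambda>_. h 1"] by (rule sums_unique2)
qed

end

text \<open>\<open>(1 - y)/4 = (f - 1/2)\<^sup>2\<close> for
  \<open>y = 4 (f - f\<^sup>2)\<close>, so \<open>(f - 1/2) (1 - y)\<^sup>-\<^sup>1\<^sup>/\<^sup>2\<close> squares to \<open>1/4\<close>.\<close>
definition idempotent_defect :: "'a::{real_normed_algebra_1,banach} \<Rightarrow> 'a"
  where "idempotent_defect f = 4 *\<^sub>R (f - f * f)"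

definition idempotent_near :: "'a::{real_normed_algebra_1,banach} \<Rightarrow> 'a"
  where "idempotent_near f = (1 / 2) *\<^sub>R 1 + (f - (1 / 2) *\<^sub>R 1) * invsqrt_series (idempotent_defect f)"

context
  fixes f :: "'a::{real_normed_algebra_1,banach}"
  assumes summ: "summable (\<lambda>k. norm (idempotent_defect f ^ k))"
begin

lemma idempotent_near_square: "idempotent_near f * idempotent_near f = idempotent_near f"
proof -
  define y where "y = idempotent_defect f"
  define s where "s = invsqrt_series y"
  define e where "e = f - (1 / 2) *\<^sub>R (1::'a)"
  have comm: "f * y = y * f" by (simp add: y_def idempotent_defect_def algebra_simps)
  have "f * y ^ k = y ^ k * f" for k
    by (induction k) (simp_all add: mult.assoc[symmetric] comm, simp add: mult.assoc comm)
  then have fs: "f * s = s * f"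
    using invsqrt_series_linear_eq[OF summ, of "\<lambda>z. f * z" "\<lambda>z. z * f"]
    by (simp add: s_def y_def bounded_linear_mult_left bounded_linear_mult_right)
  then have es: "e * s = s * e" by (simp add: e_def algebra_simps)
  have ee: "e * e = (1 / 4) *\<^sub>R (1 - y)"
    by (simp add: e_def y_def idempotent_defect_def algebra_simps) (simp add: scaleR_add_left[symmetric])
  have "(e * s) * (e * s) = s * s * (e * e)" using es by (metis mult.assoc)
  also have "\<dots> = (1 / 4) *\<^sub>R 1"
    unfolding ee using invsqrt_series_square[OF summ] by (simp add: s_def y_def)
  finally have "(e * s) * (e * s) = (1 / 4) *\<^sub>R 1" .
  then show ?thesis unfolding idempotent_near_def y_def[symmetric] s_def[symmetric] e_def[symmetric]
    by (simp add: algebra_simps) (simp add: scaleR_add_left[symmetric])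
qed

text \<open>\<open>h\<close> kills the defect of f, so the series is mapped to 1 and the formula
  collapses to 1/2 + (h f - 1/2).\<close>

lemma idempotent_near_hom:
  assumes h: "bounded_linear h" "\<And>u v. h (u * v) = h u * h v" "h 1 = 1" "h f * h f = h f"
  shows "h (idempotent_near f) = (h f :: 'b::real_normed_algebra_1)"
proof -
  interpret bounded_linear h by fact
  have "h (idempotent_defect f) = 0" by (simp add: idempotent_defect_def h diff scaleR)
  then have "h (idempotent_defect f ^ Suc k) = 0" for k by (simp add: h)
  then have "h (invsqrt_series (idempotent_defect f)) = h 1"
    by (rule invsqrt_series_linear_vanish[OF summ h(1)])
  then show ?thesis by (simp add: idempotent_near_def h add diff scaleR)
qed

text \<open>The reversal of products by \<open>h\<close> is undone because f commutes with its own
  defect, hence with the series, whose real coefficients are fixed.\<close>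

lemma idempotent_near_star:
  assumes h: "bounded_linear h" "\<And>u v. h (u * v) = h v * h u" "h 1 = 1" "h f = f"
  shows "h (idempotent_near f) = idempotent_near f"
proof -
  interpret bounded_linear h by fact
  define y where "y = idempotent_defect f"
  have hy: "h y = y" by (simp add: y_def idempotent_defect_def h diff scaleR)
  have "h (y ^ k) = y ^ k" for k
    by (induction k) (auto simp: h hy power_commutes)
  then have hs: "h (invsqrt_series y) = invsqrt_series y"
    using invsqrt_series_linear_eq[OF summ h(1) bounded_linear_ident] by (simp add: y_def)
  have comm: "f * y = y * f" by (simp add: y_def idempotent_defect_def algebra_simps)
  have "f * y ^ k = y ^ k * f" for k
    by (induction k) (simp_all add: mult.assoc[symmetric] comm, simp add: mult.assoc comm)
  then have "f * invsqrt_series y = invsqrt_series y * f"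
    using invsqrt_series_linear_eq[OF summ, of "\<lambda>z. f * z" "\<lambda>z. z * f"]
    by (simp add: y_def bounded_linear_mult_left bounded_linear_mult_right)
  then show ?thesis unfolding idempotent_near_def y_def[symmetric]
    by (simp add: h add diff scaleR hs algebra_simps)
qed

text \<open>If z f = 0, then z also annihilates the defect, so the series acts on z as 1, and z
  times the idempotent is z / 2 - z / 2. The other side is symmetric.\<close>

lemma idempotent_near_annihilate:
  shows "z * f = 0 \<Longrightarrow> z * idempotent_near f = 0" and "f * z = 0 \<Longrightarrow> idempotent_near f * z = 0"
proof -
  assume z: "z * f = 0"
  then have "z * (idempotent_defect f * u) = 0" for u
    by (simp add: idempotent_defect_def right_diff_distrib left_diff_distrib mult.assoc[symmetric])
  then have "z * idempotent_defect f ^ Suc k = 0" for k by simp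
  then have "z * invsqrt_series (idempotent_defect f) = z * 1"
    by (intro invsqrt_series_linear_vanish[OF summ] bounded_linear_mult_right) auto
  then show "z * idempotent_near f = 0"
    by (simp add: idempotent_near_def distrib_left left_diff_distrib right_diff_distrib mult.assoc[symmetric] z)
next
  assume z: "f * z = 0"
  then have "u * idempotent_defect f * z = 0" for u
    by (simp add: idempotent_defect_def right_diff_distrib left_diff_distrib mult.assoc)
  then have "idempotent_defect f ^ Suc k * z = 0" for k by (simp add: power_Suc2 del: power_Suc)
  then have "invsqrt_series (idempotent_defect f) * z = 1 * z"
    by (intro invsqrt_series_linear_vanish[OF summ, where h = "\<lambda>u. u * z"] bounded_linear_mult_left) auto
  then show "idempotent_near f * z = 0"
    by (simp add: idempotent_near_def distrib_right left_diff_distrib mult.assoc z)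
qed

end

text \<open>A bound at the single point x0 spreads to a neighbourhood. The factor 8 leaves room
  twice: B < 2^N gives norm (y x0 ^ N) < (1/4)^N, and on a small radius the majorant of y^N is still
  at most (1/2)^N. In k = N q + j the leftover power j < N costs only the constant (2 K)^N.\<close>

lemma pseries_quasinilpotent_powers:
  fixes y :: "real \<Rightarrow> 'a::{real_normed_algebra_1,banach}"
  assumes y: "pseries y x0 \<rho> M" and qn: "\<And>n. norm (y x0 ^ n) * 8 ^ n \<le> B"
  shows "\<exists>\<delta> C. \<delta> > 0 \<and> (\<forall>k. pseries (\<lambda>x. y x ^ k) x0 \<delta> (C * (1 / 2) ^ k))"
proof -
  obtain N where N: "B < 2 ^ N" using real_arch_pow[of 2 B] by auto
  have B: "B \<ge> 1" using qn[of 0] by simp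
  have N0: "N > 0" using N B by (cases N) auto
  have "norm (y x0 ^ N) * 8 ^ N < 2 ^ N" using qn[of N] N by simp
  moreover have "(8::real) ^ N = 2 ^ N * 4 ^ N" by (simp add: power_mult_distrib[symmetric])
  ultimately have small: "norm (y x0 ^ N) < (1 / 4) ^ N" by (simp add: field_simps)
  have "(1 / 4 :: real) ^ N < (1 / 2) ^ N" using N0 by (intro power_strict_mono) auto
  define e where "e = (1 / 2 :: real) ^ N - norm (y x0 ^ N)"
  have e: "e > 0" using small \<open>(1 / 4 :: real) ^ N < (1 / 2) ^ N\<close> by (simp add: e_def)
  obtain d1 where d1: "d1 > 0" "\<And>r. 0 < r \<Longrightarrow> r \<le> d1 \<Longrightarrow> pseries (\<lambda>x. y x ^ N) x0 r ((1 / 2) ^ N)"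
    using pseries_shrink[OF pseries_power[OF y, of N] e] by (auto simp: e_def)
  obtain d2 where d2: "d2 > 0" "\<And>r. 0 < r \<Longrightarrow> r \<le> d2 \<Longrightarrow> pseries y x0 r (norm (y x0) + 1)"
    using pseries_shrink[OF y, of 1] by auto
  define r where "r = min d1 d2"
  define K where "K = norm (y x0) + 1"
  have r: "r > 0" "pseries (\<lambda>x. y x ^ N) x0 r ((1 / 2) ^ N)" "pseries y x0 r K"
    using d1 d2 by (auto simp: r_def K_def)
  have "pseries (\<lambda>x. y x ^ k) x0 r ((2 * K) ^ N * (1 / 2) ^ k)" for k
  proof -
    let ?q = "k div N" and ?j = "k mod N"
    have k: "k = N * ?q + ?j" by simp
    have "pseries (\<lambda>x. (y x ^ N) ^ ?q * y x ^ ?j) x0 r (((1 / 2) ^ N) ^ ?q * K ^ ?j)"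
      by (intro pseries_mult pseries_power r)
    then have *: "pseries (\<lambda>x. y x ^ k) x0 r (((1 / 2) ^ N) ^ ?q * K ^ ?j)"
      by (subst k) (simp only: power_add power_mult)
    have "((1 / 2) ^ N) ^ ?q * K ^ ?j = (2 * K) ^ ?j * ((1 / 2) ^ (N * ?q) * (1 / 2) ^ ?j)"
      by (simp add: power_mult power_mult_distrib power_divide)
    also have "\<dots> = (2 * K) ^ ?j * (1 / 2) ^ k" by (metis k power_add)
    also have "\<dots> \<le> (2 * K) ^ N * (1 / 2) ^ k"
      using N0 by (intro mult_right_mono power_increasing) (auto simp: K_def less_imp_le)
    finally show ?thesis using * pseries_mono by blast
  qed
  with r(1) show ?thesis by blast
qed

text \<open>Around each point the powers of the defect have geometrically decreasing majorants on
  one radius. With coefficients in [0, 1] the binomial series is then a convergent sum of power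
  series.\<close>

lemma analytic_idempotent_near:
  fixes f :: "real \<Rightarrow> 'a::{real_normed_algebra_1,banach}"
  assumes G: "open G" and f: "real_analytic_on f G"
    and qn: "\<And>l s. l \<in> G \<Longrightarrow> s > 0 \<Longrightarrow> \<exists>B. \<forall>n. norm ((f l * f l - f l) ^ n) * s ^ n \<le> B"
  shows "real_analytic_on (\<lambda>l. idempotent_near (f l)) G"
    and "l \<in> G \<Longrightarrow> summable (\<lambda>k. norm (idempotent_defect (f l) ^ k))"
proof -
  have pow: "norm (idempotent_defect (f l) ^ n) = norm ((f l * f l - f l) ^ n) * 4 ^ n" for l n
  proof -
    have "idempotent_defect (f l) ^ n = (- 4) ^ n *\<^sub>R (f l * f l - f l) ^ n"
      unfolding scaleR_power[symmetric] by (simp add: idempotent_defect_def algebra_simps)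
    then show ?thesis by (simp add: power_abs)
  qed
  \<comment> \<open>32 = 4 * 8: the defect is -4 (f f - f), and 8 is the factor wanted for its own
    powers.\<close>
  have qn8: "\<exists>B. \<forall>n. norm (idempotent_defect (f l) ^ n) * 8 ^ n \<le> B" if "l \<in> G" for l
    using qn[OF that, of 32] unfolding pow by (simp add: mult.assoc power_mult_distrib[symmetric])
  show "summable (\<lambda>k. norm (idempotent_defect (f l) ^ k))" if l: "l \<in> G" for l
  proof -
    obtain B where B: "\<And>n. norm (idempotent_defect (f l) ^ n) * 8 ^ n \<le> B" using qn8[OF l] by blast
    show ?thesis
    proof (rule summable_comparison_test'[of "\<lambda>n. B * (1 / 8) ^ n" 0])
      show "summable (\<lambda>n. B * (1 / 8) ^ n)" by (intro summable_mult summable_geometric) simp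
      show "norm (norm (idempotent_defect (f l) ^ n)) \<le> B * (1 / 8) ^ n" for n
        using B[of n] by (simp add: power_divide field_simps)
    qed
  qed
  show "real_analytic_on (\<lambda>l. idempotent_near (f l)) G"
    unfolding real_analytic_on_iff_pser[OF G]
  proof
    fix x0 assume x0: "x0 \<in> G"
    obtain \<rho> M where fp: "pseries f x0 \<rho> M" using f x0 unfolding real_analytic_on_iff_pser[OF G] by blast
    have \<rho>: "\<rho> > 0" using fp by (rule pseriesE)
    have "pseries (\<lambda>x. 4 *\<^sub>R (f x + (- 1) *\<^sub>R (f x * f x))) x0 \<rho> (4 * (M + 1 * (M * M)))"
      by (intro pseries_linear[where h = "\<lambda>v. 4 *\<^sub>R v"] pseries_linear[where h = "\<lambda>v. (- 1) *\<^sub>R v"] pseries_add pseries_mult fp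
          bounded_linear_scaleR_right) auto
    then have y: "pseries (\<lambda>x. idempotent_defect (f x)) x0 \<rho> (4 * (M + 1 * (M * M)))"
      by (simp add: idempotent_defect_def)
    obtain B where B: "\<And>n. norm (idempotent_defect (f x0) ^ n) * 8 ^ n \<le> B" using qn8[OF x0] by blast
    obtain \<delta> C where \<delta>: "\<delta> > 0" and C: "\<And>k. pseries (\<lambda>x. idempotent_defect (f x) ^ k) x0 \<delta> (C * (1 / 2) ^ k)"
      using pseries_quasinilpotent_powers[OF y B] by blast
    have "pseries (\<lambda>x. invsqrt_coeff k *\<^sub>R idempotent_defect (f x) ^ k) x0 \<delta> (1 * (C * (1 / 2) ^ k))" for k
      by (rule pseries_linear[OF C bounded_linear_scaleR_right])
        (use invsqrt_coeff_bounds[of k] in \<open>auto intro: mult_left_le_one_le\<close>)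
    then have s: "pseries (\<lambda>x. invsqrt_series (idempotent_defect (f x))) x0 \<delta> (suminf (\<lambda>k. 1 * (C * (1 / 2) ^ k)))"
      unfolding invsqrt_series_def
      by (rule pseries_suminf(1)) (auto intro!: summable_mult summable_geometric)
    obtain r where r: "r > 0" "r \<le> \<delta>" "r \<le> \<rho>" using \<delta> \<rho> by (metis min.cobounded1 min.cobounded2 min_less_iff_conj)
    obtain K1 where K1: "pseries (\<lambda>x. invsqrt_series (idempotent_defect (f x))) x0 r K1"
      using pseries_radius_mono[OF s r(1,2)] by blast
    obtain K2 where K2: "pseries f x0 r K2" using pseries_radius_mono[OF fp r(1,3)] by blast
    have "pseries (\<lambda>x. (1 / 2) *\<^sub>R 1 + (f x + (- 1 / 2) *\<^sub>R 1) * invsqrt_series (idempotent_defect (f x))) x0 r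
      (norm ((1 / 2) *\<^sub>R (1::'a)) + (K2 + norm ((- 1 / 2) *\<^sub>R (1::'a))) * K1)"
      by (intro pseries_add pseries_mult K1 K2 pseries_const r)
    then show "\<exists>\<rho> M. pseries (\<lambda>l. idempotent_near (f l)) x0 \<rho> M"
      unfolding idempotent_near_def by (intro exI) (simp add: algebra_simps)
  qed
qed

section \<open>Open mappings and nonlinear Neumann series\<close>

text \<open>Open mapping theorem in quantitative form. By Baire the closure of the image of some
  ball has an interior point, and differences of preimages reach every small y up to an arbitrarily
  small error. Repeating this on the residuals gives a geometric series.\<close>

lemma surj_bounded_linear_lift_bound:
  fixes T :: "'x::banach \<Rightarrow>\<^sub>L 'y::banach"
  assumes "surj (blinfun_apply T)"
  shows "\<exists>C\<ge>0. \<forall>y. \<exists>x. T x = y \<and> norm x \<le> C * norm y"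
proof -
  define F where "F = (\<lambda>n::nat. closure (T ` ball 0 (real n)))"
  have cover: "(\<Union>n. F n) = UNIV"
  proof -
    have "y \<in> (\<Union>n. F n)" for y
    proof -
      obtain x where x: "T x = y" using assms by (metis surjD)
      obtain n :: nat where "norm x < n" using reals_Archimedean2 by blast
      then have "T x \<in> F n" using closure_subset[of "T ` ball 0 (real n)"] by (auto simp: F_def)
      then show ?thesis using x by auto
    qed
    then show ?thesis by blast
  qed
  have "\<exists>n. interior (F n) \<noteq> {}"
  proof (rule ccontr)
    assume "\<not> ?thesis"
    then have "Met_TC.mtopology interior_of \<Union>(range F) = {}"
      by (intro Met_TC.metric_Baire_category_alt) (auto simp: F_def complete_UNIV)
    then show False using cover by simp
  qed
  then obtain n b where "b \<in> interior (F n)" by blast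
  then obtain e where e: "e > 0" "ball b e \<subseteq> F n" by (meson mem_interior)
  have approx: "\<exists>x. norm x < 2 * n \<and> norm (y - T x) < \<delta>" if y: "norm y < e" and \<delta>: "\<delta> > 0" for y \<delta>
  proof -
    have "b + y \<in> F n" "b \<in> F n" using e y by (auto simp: dist_norm)
    then have "\<exists>u\<in>T ` ball 0 (real n). dist u (b + y) < \<delta> / 2" "\<exists>u\<in>T ` ball 0 (real n). dist u b < \<delta> / 2"
      unfolding F_def closure_approachable using half_gt_zero[OF \<delta>] by blast+
    then obtain u v where uv: "norm u < n" "norm (T u - (b + y)) < \<delta> / 2" "norm v < n" "norm (T v - b) < \<delta> / 2"
      by (auto simp: dist_norm)
    have "norm (y - T (u - v)) \<le> norm (T u - (b + y)) + norm (T v - b)"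
      using norm_triangle_ineq4[of "T v - b" "T u - (b + y)"] by (simp add: blinfun.diff_right algebra_simps)
    moreover have "norm (u - v) < 2 * n" using norm_triangle_ineq4[of u v] uv by simp
    ultimately show ?thesis using uv by (intro exI[of _ "u - v"]) simp
  qed
  define K where "K = 4 * real n / e"
  have K: "K \<ge> 0" using e by (simp add: K_def)
  have "\<exists>x. norm x \<le> K * norm y \<and> norm (y - T x) \<le> norm y / 2" for y
  proof (cases "y = 0")
    case True then show ?thesis by (intro exI[of _ 0]) (simp add: blinfun.zero_right)
  next
    case False
    define c where "c = e / (2 * norm y)"
    have c: "c > 0" using False e by (simp add: c_def)
    have "norm (c *\<^sub>R y) = e / 2" using False e by (simp add: c_def)
    then obtain x where x: "norm x < 2 * n" "norm (c *\<^sub>R y - T x) < e / 4"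
      using approx[of "c *\<^sub>R y" "e / 4"] e by auto
    have eqs: "norm y / 2 = (e / 4) / c" "K * norm y = (2 * n) / c" using False e by (auto simp: c_def K_def)
    have "y - T ((1 / c) *\<^sub>R x) = (1 / c) *\<^sub>R (c *\<^sub>R y - T x)"
      using c by (simp add: blinfun.scaleR_right algebra_simps)
    then have "norm (y - T ((1 / c) *\<^sub>R x)) \<le> (e / 4) / c"
      using x(2) c by (simp only: norm_scaleR) (simp add: divide_simps)
    moreover have "norm ((1 / c) *\<^sub>R x) \<le> (2 * n) / c" using x(1) c by (simp add: divide_right_mono less_imp_le)
    ultimately show ?thesis using eqs by (intro exI[of _ "(1 / c) *\<^sub>R x"]) simp
  qed
  then obtain g where g: "\<And>y. norm (g y) \<le> K * norm y" "\<And>y. norm (y - T (g y)) \<le> norm y / 2" by metis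
  have "\<exists>x. T x = y \<and> norm x \<le> (2 * K) * norm y" for y
  proof -
    define Y where "Y = (\<lambda>k. ((\<lambda>y. y - T (g y)) ^^ k) y)"
    have Y: "norm (Y k) \<le> norm y * (1 / 2) ^ k" for k
    proof (induction k)
      case (Suc k)
      then show ?case using g(2)[of "Y k"] by (simp add: Y_def)
    qed (simp add: Y_def)
    have gY: "norm (g (Y k)) \<le> K * norm y * (1 / 2) ^ k" for k
      using order_trans[OF g(1) mult_left_mono[OF Y K]] by (simp add: mult.assoc)
    have geo: "summable (\<lambda>k. K * norm y * (1 / 2) ^ k)" by (intro summable_mult summable_geometric) simp
    have sn: "summable (\<lambda>k. norm (g (Y k)))"
      by (rule summable_comparison_test'[OF geo, of 0]) (use gY in simp)
    have "norm (\<Sum>k. g (Y k)) \<le> (\<Sum>k. K * norm y * (1 / 2) ^ k)"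
      using summable_norm[OF sn] suminf_le[OF gY sn geo] by linarith
    also have "\<dots> = K * norm y * (\<Sum>k. (1 / 2) ^ k)" by (rule suminf_mult) simp
    also have "(\<Sum>k. (1 / 2 :: real) ^ k) = 2" by (subst suminf_geometric) auto
    finally have nb: "norm (\<Sum>k. g (Y k)) \<le> (2 * K) * norm y" by (simp add: mult_ac)
    have "(\<lambda>k. T (g (Y k))) sums T (\<Sum>k. g (Y k))"
      by (rule bounded_linear.sums[OF blinfun.bounded_linear_right summable_sums[OF summable_norm_cancel[OF sn]]])
    moreover have "T (g (Y k)) = Y k - Y (Suc k)" for k by (simp add: Y_def)
    moreover have "Y \<longlonglongrightarrow> 0"
    proof (rule Lim_null_comparison)
      show "\<forall>\<^sub>F k in sequentially. norm (Y k) \<le> norm y * (1 / 2) ^ k" using Y by simp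
      show "(\<lambda>k. norm y * (1 / 2) ^ k) \<longlonglongrightarrow> 0"
        by (intro tendsto_mult_right_zero LIMSEQ_power_zero) simp
    qed
    then have "(\<lambda>k. Y k - Y (Suc k)) sums (Y 0 - 0)" by (rule telescope_sums')
    ultimately have "T (\<Sum>k. g (Y k)) = Y 0" using sums_unique2 by fastforce
    then show ?thesis using nb by (auto simp: Y_def)
  qed
  then show ?thesis using K by (intro exI[of _ "2 * K"]) auto
qed

section \<open>Summation over words\<close>

lemma sum_prod_list_le_2:
  fixes g :: "'m \<Rightarrow> real"
  assumes g: "\<And>m. m \<in> M \<Longrightarrow> g m \<ge> 0" and half: "\<And>A. finite A \<Longrightarrow> A \<subseteq> M \<Longrightarrow> sum g A \<le> 1 / 2"
    and X: "finite X" "X \<subseteq> lists M"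
  shows "(\<Sum>w\<in>X. prod_list (map g w)) \<le> 2"
proof -
  define A where "A = (\<Union>w\<in>X. set w)"
  have A: "finite A" "A \<subseteq> M" using X by (auto simp: A_def)
  define W where "W = (\<lambda>l. {w. set w \<subseteq> A \<and> length w = l})"
  have nn: "prod_list (map g w) \<ge> 0" if "set w \<subseteq> M" for w
    using that g by (induction w) auto
  have finW: "finite (W l)" for l unfolding W_def by (rule finite_lists_length_eq[OF A(1)])
  \<comment> \<open>Splitting off the first letter makes the sum over words of length l a product;
    the bounds for the lengths add up to a geometric series with sum 2.\<close>
  have sumW: "(\<Sum>w\<in>W l. prod_list (map g w)) \<le> (1 / 2) ^ l" for l
  proof (induction l)
    case 0
    have "W 0 = {[]}" by (auto simp: W_def)
    then show ?case by simp
  next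
    case (Suc l)
    have "W (Suc l) = (\<lambda>(m, w). m # w) ` (A \<times> W l)"
      by (auto simp: W_def length_Suc_conv image_iff)
    then have "(\<Sum>w\<in>W (Suc l). prod_list (map g w)) = (\<Sum>(m, w)\<in>A \<times> W l. g m * prod_list (map g w))"
      by (simp add: sum.reindex inj_on_def case_prod_unfold)
    also have "\<dots> = sum g A * (\<Sum>w\<in>W l. prod_list (map g w))"
      by (simp add: sum_product sum.cartesian_product)
    also have "\<dots> \<le> (1 / 2) * (1 / 2) ^ l"
      using A by (intro mult_mono half Suc sum_nonneg nn) (auto simp: W_def)
    finally show ?case by simp
  qed
  obtain L where L: "length ` X \<subseteq> {..<L}" using X finite_nat_iff_bounded by (metis finite_imageI)
  have "(\<Sum>w\<in>X. prod_list (map g w)) \<le> (\<Sum>w\<in>(\<Union>l<L. W l). prod_list (map g w))"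
    using L finW A(2) by (intro sum_mono2 nn) (auto simp: W_def A_def)
  also have "\<dots> = (\<Sum>l<L. \<Sum>w\<in>W l. prod_list (map g w))"
    by (rule sum.UNION_disjoint) (auto simp: finW, auto simp: W_def)
  also have "\<dots> \<le> (\<Sum>l<L. (1 / 2) ^ l)" by (intro sum_mono sumW)
  also have "\<dots> \<le> (\<Sum>l. (1 / 2 :: real) ^ l)" by (rule sum_le_suminf) auto
  also have "\<dots> = 2" by (subst suminf_geometric) auto
  finally show ?thesis .
qed

text \<open>The scalar factors of the letters are kept outside, in a \<open>prod_list\<close>. Each
  word then yields a fixed vector independent of the parameter, and the maps \<open>E m\<close>,
  which involve arbitrary choices of lifts, need be neither linear nor homogeneous.\<close>

fun word_apply :: "('m \<Rightarrow> 'y \<Rightarrow> 'y) \<Rightarrow> 'm list \<Rightarrow> 'y \<Rightarrow> 'y" where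
  "word_apply E [] y = y"
| "word_apply E (m # w) y = E m (word_apply E w y)"

lemma norm_word_apply:
  fixes E :: "'m \<Rightarrow> 'y::real_normed_vector \<Rightarrow> 'y"
  assumes "\<And>m y. m \<in> M \<Longrightarrow> norm (E m y) \<le> e m * norm y" "\<And>m. m \<in> M \<Longrightarrow> e m \<ge> 0" "w \<in> lists M"
  shows "norm (word_apply E w y) \<le> prod_list (map e w) * norm y"
  using assms(3)
proof (induction w)
  case (Cons m w)
  have "norm (word_apply E (m # w) y) \<le> e m * norm (word_apply E w y)" using Cons assms by auto
  also have "\<dots> \<le> e m * (prod_list (map e w) * norm y)" using Cons assms by (intro mult_left_mono) auto
  finally show ?case by (simp add: mult.assoc)
qed simp

text \<open>\<open>X\<close> is enlarged to the product of its projections, where the sum factors: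
  at most \<open>D\<close> from the vectors and at most 2 from the words. The weights are
  nonnegative reals so that the bound covers moduli at complex points as well as absolute values at
  real ones.\<close>

lemma neumann_word_bound:
  fixes E :: "'m \<Rightarrow> 'y::real_normed_vector \<Rightarrow> 'y"
  assumes E: "\<And>m y. m \<in> M \<Longrightarrow> norm (E m y) \<le> e m * norm y" "\<And>m. m \<in> M \<Longrightarrow> e m \<ge> 0"
    and p: "\<And>m. m \<in> M \<Longrightarrow> p m \<ge> 0" "\<And>A. finite A \<Longrightarrow> A \<subseteq> M \<Longrightarrow> (\<Sum>m\<in>A. p m * e m) \<le> 1 / 2"
    and a: "\<And>j. a j \<ge> 0" "\<And>A :: 'j set. finite A \<Longrightarrow> (\<Sum>j\<in>A. a j * norm (y j)) \<le> D"
    and X: "finite X" "X \<subseteq> UNIV \<times> lists M"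
  shows "(\<Sum>(j, w)\<in>X. (a j * prod_list (map p w)) * norm (word_apply E w (y j))) \<le> D * 2"
proof -
  have D: "D \<ge> 0" using a(2)[of "{}"] by simp
  define g where "g = (\<lambda>m. p m * e m)"
  have pg: "prod_list (map p w) * prod_list (map e w) = prod_list (map g w)" for w
    by (induction w) (auto simp: g_def mult_ac)
  have pnn: "prod_list (map p w) \<ge> 0" "prod_list (map g w) \<ge> 0" if "w \<in> lists M" for w
    using that p(1) E(2) by (induction w) (auto simp: g_def)
  have "(\<Sum>(j, w)\<in>X. (a j * prod_list (map p w)) * norm (word_apply E w (y j)))
    \<le> (\<Sum>(j, w)\<in>X. (a j * norm (y j)) * prod_list (map g w))"
  proof (rule sum_mono)
    fix x assume "x \<in> X"
    moreover obtain j w where "x = (j, w)" by (cases x)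
    ultimately have x: "x = (j, w)" "w \<in> lists M" using X by blast+
    have "(a j * prod_list (map p w)) * norm (word_apply E w (y j))
      \<le> (a j * prod_list (map p w)) * (prod_list (map e w) * norm (y j))"
      using x a(1) by (intro mult_left_mono norm_word_apply[where M = M] E mult_nonneg_nonneg pnn) auto
    also have "\<dots> = (a j * norm (y j)) * prod_list (map g w)" by (simp add: pg[symmetric] mult_ac)
    finally show "(case x of (j, w) \<Rightarrow> (a j * prod_list (map p w)) * norm (word_apply E w (y j)))
      \<le> (case x of (j, w) \<Rightarrow> (a j * norm (y j)) * prod_list (map g w))" by (simp add: x)
  qed
  also have "\<dots> \<le> (\<Sum>(j, w)\<in>fst ` X \<times> snd ` X. (a j * norm (y j)) * prod_list (map g w))"
  proof (rule sum_mono2)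
    fix b assume "b \<in> fst ` X \<times> snd ` X - X"
    then have "snd b \<in> snd ` X" by (simp only: mem_Times_iff Diff_iff)
    then have "snd b \<in> lists M" using X by fastforce
    then show "0 \<le> (case b of (j, w) \<Rightarrow> (a j * norm (y j)) * prod_list (map g w))"
      by (simp add: case_prod_unfold a(1) pnn)
  qed (use X in \<open>auto simp: rev_image_eqI\<close>)
  also have "\<dots> = (\<Sum>j\<in>fst ` X. a j * norm (y j)) * (\<Sum>w\<in>snd ` X. prod_list (map g w))"
    by (simp add: sum_product sum.cartesian_product)
  also have "\<dots> \<le> D * 2"
  proof (rule mult_mono)
    show "(\<Sum>w\<in>snd ` X. prod_list (map g w)) \<le> 2"
      by (rule sum_prod_list_le_2[where M = M]) (use p E X in \<open>auto simp: g_def\<close>)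
    show "0 \<le> (\<Sum>w\<in>snd ` X. prod_list (map g w))" using X by (intro sum_nonneg pnn) auto
  qed (use a X D in auto)
  finally show ?thesis .
qed

text \<open>The same factorization, with a third factor \<open>B\<close> from the outer maps
  \<open>F i\<close>.\<close>

lemma neumann_bound:
  fixes E :: "'m \<Rightarrow> 'y::real_normed_vector \<Rightarrow> 'y" and F :: "'i \<Rightarrow> 'y \<Rightarrow> 'x::real_normed_vector"
  assumes E: "\<And>m y. m \<in> M \<Longrightarrow> norm (E m y) \<le> e m * norm y" "\<And>m. m \<in> M \<Longrightarrow> e m \<ge> 0"
    and p: "\<And>m. m \<in> M \<Longrightarrow> p m \<ge> 0" "\<And>A. finite A \<Longrightarrow> A \<subseteq> M \<Longrightarrow> (\<Sum>m\<in>A. p m * e m) \<le> 1 / 2"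
    and F: "\<And>i y. i \<in> I \<Longrightarrow> norm (F i y) \<le> C i * norm y" "\<And>i. i \<in> I \<Longrightarrow> C i \<ge> 0"
    and r: "\<And>i. i \<in> I \<Longrightarrow> r i \<ge> 0" "\<And>A. finite A \<Longrightarrow> A \<subseteq> I \<Longrightarrow> (\<Sum>i\<in>A. r i * C i) \<le> B"
    and a: "\<And>j. a j \<ge> 0" "\<And>A :: 'j set. finite A \<Longrightarrow> (\<Sum>j\<in>A. a j * norm (y j)) \<le> D"
    and X: "finite X" "X \<subseteq> (UNIV \<times> lists M) \<times> I"
  shows "(\<Sum>((j, w), i)\<in>X. (a j * prod_list (map p w) * r i) * norm (F i (word_apply E w (y j)))) \<le> D * 2 * B"
proof -
  have pnn: "prod_list (map p w) \<ge> 0" if "w \<in> lists M" for w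
    using that p(1) by (induction w) auto
  define h where "h = (\<lambda>(j, w). (a j * prod_list (map p w)) * norm (word_apply E w (y j)))"
  have hnn: "h x \<ge> 0" if "x \<in> UNIV \<times> lists M" for x
  proof -
    have "snd x \<in> lists M" using that by (simp only: mem_Times_iff)
    then show ?thesis by (simp add: h_def case_prod_unfold a(1) pnn)
  qed
  have "(\<Sum>((j, w), i)\<in>X. (a j * prod_list (map p w) * r i) * norm (F i (word_apply E w (y j))))
    \<le> (\<Sum>(x, i)\<in>X. h x * (r i * C i))"
  proof (rule sum_mono)
    fix x assume "x \<in> X"
    moreover obtain j w i where "x = ((j, w), i)" by (metis surj_pair)
    ultimately have x: "x = ((j, w), i)" "w \<in> lists M" "i \<in> I" using X by blast+
    have "(a j * prod_list (map p w) * r i) * norm (F i (word_apply E w (y j)))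
      \<le> (a j * prod_list (map p w) * r i) * (C i * norm (word_apply E w (y j)))"
      using x a(1) by (intro mult_left_mono F mult_nonneg_nonneg pnn r) auto
    then show "(\<lambda>((j, w), i). (a j * prod_list (map p w) * r i) * norm (F i (word_apply E w (y j)))) x
      \<le> (\<lambda>(x, i). h x * (r i * C i)) x" by (simp add: x h_def mult_ac)
  qed
  also have "\<dots> \<le> (\<Sum>(x, i)\<in>fst ` X \<times> snd ` X. h x * (r i * C i))"
  proof (rule sum_mono2)
    fix b assume "b \<in> fst ` X \<times> snd ` X - X"
    then have "fst b \<in> fst ` X" "snd b \<in> snd ` X" by (simp_all only: mem_Times_iff Diff_iff)
    then have "fst b \<in> UNIV \<times> lists M" "snd b \<in> I" using X by fastforce+
    then show "0 \<le> (case b of (x, i) \<Rightarrow> h x * (r i * C i))"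
      unfolding case_prod_unfold by (intro mult_nonneg_nonneg hnn r(1) F(2))
  qed (use X in \<open>auto simp: rev_image_eqI\<close>)
  also have "\<dots> = (\<Sum>x\<in>fst ` X. h x) * (\<Sum>i\<in>snd ` X. r i * C i)"
    by (simp add: sum_product sum.cartesian_product)
  also have "\<dots> \<le> (D * 2) * B"
  proof (rule mult_mono)
    show "(\<Sum>x\<in>fst ` X. h x) \<le> D * 2" unfolding h_def
      by (rule neumann_word_bound[where M = M and e = e]) (use E p a X in auto)
    show "(\<Sum>i\<in>snd ` X. r i * C i) \<le> B" using X by (intro r) auto
    show "0 \<le> (\<Sum>i\<in>snd ` X. r i * C i)" using X r(1) F(2) by (intro sum_nonneg) auto
    show "0 \<le> D * 2" using a(2)[of "{}"] by simp
  qed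
  finally show ?thesis .
qed

lemma abs_summable_if_finite_sums_bounded:
  fixes f :: "'i \<Rightarrow> 'a::banach"
  assumes "\<And>X. finite X \<Longrightarrow> X \<subseteq> A \<Longrightarrow> (\<Sum>x\<in>X. norm (f x)) \<le> B"
  shows "(\<lambda>x. norm (f x)) summable_on A" and "f summable_on A"
proof -
  show "(\<lambda>x. norm (f x)) summable_on A"
    by (rule nonneg_bdd_above_summable_on) (use assms in \<open>auto intro!: bdd_aboveI2[where M = B]\<close>)
  then show "f summable_on A" by (rule abs_summable_summable)
qed

text \<open>An approximate right inverse \<open>X\<close> of \<open>T\<close> with error operators \<open>p\<^sub>m E\<^sub>m\<close> of total norm at most
  \<open>1/2\<close> is corrected by a Neumann series. As the \<open>E\<^sub>m\<close> are not linear, it is expanded into words.\<close>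
lemma neumann_lift:
  fixes E :: "'m \<Rightarrow> 'y::banach \<Rightarrow> 'y" and F :: "'i \<Rightarrow> 'y \<Rightarrow> 'x::banach" and T :: "'x \<Rightarrow>\<^sub>L 'y"
  assumes E: "\<And>m y. m \<in> M \<Longrightarrow> norm (E m y) \<le> e m * norm y" "\<And>m. m \<in> M \<Longrightarrow> e m \<ge> 0"
    and p: "\<And>A. finite A \<Longrightarrow> A \<subseteq> M \<Longrightarrow> (\<Sum>m\<in>A. \<bar>p m\<bar> * e m) \<le> 1 / 2"
    and F: "\<And>i y. i \<in> I \<Longrightarrow> norm (F i y) \<le> C i * norm y" "\<And>i. i \<in> I \<Longrightarrow> C i \<ge> 0"
    and r: "\<And>A. finite A \<Longrightarrow> A \<subseteq> I \<Longrightarrow> (\<Sum>i\<in>A. \<bar>r i\<bar> * C i) \<le> B"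
    and a: "\<And>A :: 'j set. finite A \<Longrightarrow> (\<Sum>j\<in>A. \<bar>a j\<bar> * norm (y j)) \<le> D"
    and T: "\<And>v. ((\<lambda>m. p m *\<^sub>R E m v) has_sum (v - T (\<Sum>\<^sub>\<infinity>i\<in>I. r i *\<^sub>R F i v))) M"
  shows "T (\<Sum>\<^sub>\<infinity>((j, w), i)\<in>(UNIV \<times> lists M) \<times> I. (a j * prod_list (map p w) * r i) *\<^sub>R F i (word_apply E w (y j)))
    = (\<Sum>\<^sub>\<infinity>j. a j *\<^sub>R y j)"
proof -
  define W where "W = (UNIV :: 'j set) \<times> lists M"
  define c where "c = (\<lambda>(j, w). a j * prod_list (map p w))"
  define v where "v = (\<lambda>(j, w). word_apply E w (y j))"
  define X where "X = (\<lambda>u. \<Sum>\<^sub>\<infinity>i\<in>I. r i *\<^sub>R F i u)"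
  have abs_pl: "\<bar>prod_list (map p w)\<bar> = prod_list (map (\<lambda>m. \<bar>p m\<bar>) w)" for w
    by (induction w) (auto simp: abs_mult)
  have sum_g: "(\<lambda>x. norm (c x *\<^sub>R v x)) summable_on W" "(\<lambda>x. c x *\<^sub>R v x) summable_on W"
  proof -
    have "(\<Sum>x\<in>A. norm (c x *\<^sub>R v x)) \<le> D * 2" if "finite A" "A \<subseteq> W" for A
      using neumann_word_bound[of M E e "\<lambda>m. \<bar>p m\<bar>" "\<lambda>j. \<bar>a j\<bar>" y D A] that E p a
      by (simp add: c_def v_def W_def case_prod_unfold abs_mult abs_pl)
    note * = abs_summable_if_finite_sums_bounded[OF this]
    from *(1) show "(\<lambda>x. norm (c x *\<^sub>R v x)) summable_on W" .
    from *(2) show "(\<lambda>x. c x *\<^sub>R v x) summable_on W" .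
  qed
  have sum_x: "(\<lambda>(x, i). (c x * r i) *\<^sub>R F i (v x)) summable_on W \<times> I"
  proof (rule abs_summable_if_finite_sums_bounded(2))
    fix A assume "finite A" "A \<subseteq> W \<times> I"
    then show "(\<Sum>x\<in>A. norm (case x of (x, i) \<Rightarrow> (c x * r i) *\<^sub>R F i (v x))) \<le> D * 2 * B"
      using neumann_bound[of M E e "\<lambda>m. \<bar>p m\<bar>" I F C "\<lambda>i. \<bar>r i\<bar>" B "\<lambda>j. \<bar>a j\<bar>" y D A] E p F r a
      by (simp add: c_def v_def W_def case_prod_unfold abs_mult abs_pl)
  qed
  have sum_i: "(\<lambda>i. r i *\<^sub>R F i u) summable_on I" for u
  proof (rule abs_summable_if_finite_sums_bounded(2))
    fix A assume A: "finite A" "A \<subseteq> I"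
    have "(\<Sum>i\<in>A. norm (r i *\<^sub>R F i u)) \<le> (\<Sum>i\<in>A. (\<bar>r i\<bar> * C i) * norm u)"
      using A F by (intro sum_mono) (auto simp: mult.assoc intro!: mult_left_mono)
    also have "\<dots> \<le> B * norm u" unfolding sum_distrib_right[symmetric] using r[OF A] by (rule mult_right_mono) simp
    finally show "(\<Sum>i\<in>A. norm (r i *\<^sub>R F i u)) \<le> B * norm u" .
  qed
  \<comment> \<open>Summation over i first: each word contributes the approximate lift
    \<open>X\<close> of its vector.\<close>
  have xX: "((\<lambda>x. c x *\<^sub>R X (v x)) has_sum (\<Sum>\<^sub>\<infinity>(x, i)\<in>W \<times> I. (c x * r i) *\<^sub>R F i (v x))) W"
  proof (rule has_sum_SigmaD[OF has_sum_infsum[OF sum_x]])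
    fix x
    show "((\<lambda>i. case (x, i) of (x, i) \<Rightarrow> (c x * r i) *\<^sub>R F i (v x)) has_sum c x *\<^sub>R X (v x)) I"
      unfolding X_def split scaleR_scaleR[symmetric]
      by (rule has_sum_scaleR, rule has_sum_infsum, rule sum_i)
  qed
  then have TX: "((\<lambda>x. c x *\<^sub>R T (X (v x))) has_sum T (\<Sum>\<^sub>\<infinity>(x, i)\<in>W \<times> I. (c x * r i) *\<^sub>R F i (v x))) W"
    using has_sum_bounded_linear[OF blinfun.bounded_linear_right xX] by (simp add: blinfun.scaleR_right)
  define N where "N = {x \<in> W. snd x \<noteq> []}"
  define Z where "Z = {x \<in> W. snd x = []}"
  have WNZ: "W = N \<union> Z" "N \<inter> Z = {}" by (auto simp: N_def Z_def)
  have NW: "N \<subseteq> W" "Z \<subseteq> W" by (auto simp: N_def Z_def)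
  have sumN: "(\<lambda>x. c x *\<^sub>R v x) summable_on N" "(\<lambda>x. c x *\<^sub>R v x) summable_on Z"
    by (rule summable_on_subset_banach[OF sum_g(2)], rule NW)+
  \<comment> \<open>Prepending a letter identifies pairs of a word and a letter with nonempty words.
    By the hypothesis on \<open>T\<close>, the sum over nonempty words is therefore the sum of c x
    (v x - T (X (v x))), and subtracting it leaves exactly the empty words.\<close>
  have bij: "bij_betw (\<lambda>((j, w), m). (j, m # w)) (W \<times> M) N"
    by (rule bij_betwI[where g = "\<lambda>(j, w). ((j, tl w), hd w)"])
      (auto simp: N_def W_def neq_Nil_conv)
  have "((\<lambda>((j, w), m). c (j, m # w) *\<^sub>R v (j, m # w)) has_sum (\<Sum>\<^sub>\<infinity>x\<in>N. c x *\<^sub>R v x)) (W \<times> M)"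
    using has_sum_infsum[OF sumN(1)] has_sum_reindex_bij_betw[OF bij, where f = "\<lambda>x. c x *\<^sub>R v x"]
    by (simp add: case_prod_unfold)
  then have "((\<lambda>(x, m). c x *\<^sub>R (p m *\<^sub>R E m (v x))) has_sum (\<Sum>\<^sub>\<infinity>x\<in>N. c x *\<^sub>R v x)) (W \<times> M)"
    by (simp add: c_def v_def case_prod_unfold mult_ac)
  then have "((\<lambda>x. c x *\<^sub>R (v x - T (X (v x)))) has_sum (\<Sum>\<^sub>\<infinity>x\<in>N. c x *\<^sub>R v x)) W"
    by (rule has_sum_SigmaD) (simp only: split, rule has_sum_scaleR, unfold X_def, rule T)
  then have "((\<lambda>x. - (c x *\<^sub>R (v x - T (X (v x))))) has_sum - (\<Sum>\<^sub>\<infinity>x\<in>N. c x *\<^sub>R v x)) W"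
    by (simp add: has_sum_uminus)
  from has_sum_add[OF has_sum_infsum[OF sum_g(2)] this]
  have "((\<lambda>x. c x *\<^sub>R T (X (v x))) has_sum ((\<Sum>\<^sub>\<infinity>x\<in>W. c x *\<^sub>R v x) - (\<Sum>\<^sub>\<infinity>x\<in>N. c x *\<^sub>R v x))) W"
    by (simp add: scaleR_diff_right)
  then have "T (\<Sum>\<^sub>\<infinity>(x, i)\<in>W \<times> I. (c x * r i) *\<^sub>R F i (v x)) = (\<Sum>\<^sub>\<infinity>x\<in>W. c x *\<^sub>R v x) - (\<Sum>\<^sub>\<infinity>x\<in>N. c x *\<^sub>R v x)"
    using TX has_sum_unique by blast
  also have "\<dots> = (\<Sum>\<^sub>\<infinity>x\<in>Z. c x *\<^sub>R v x)"
    using infsum_Un_disjoint[OF sumN WNZ(2)] WNZ(1) by simp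
  also have "Z = (\<lambda>j. (j, [])) ` UNIV" by (auto simp: Z_def W_def)
  also have "(\<Sum>\<^sub>\<infinity>x\<in>(\<lambda>j. (j, [])) ` UNIV. c x *\<^sub>R v x) = (\<Sum>\<^sub>\<infinity>j. a j *\<^sub>R y j)"
    by (subst infsum_reindex) (auto simp: inj_on_def o_def c_def v_def)
  finally show ?thesis by (simp add: W_def c_def v_def case_prod_unfold)
qed

section \<open>Localized weights on the unit disc\<close>

text \<open>Bernstein polynomials of a continuous partition of unity again sum up to \<open>1\<close>.\<close>
lemma polynomial_partition:
  fixes g :: "real \<Rightarrow> real \<Rightarrow> real"
  assumes \<rho>: "\<rho> > 0" and \<epsilon>: "\<epsilon> > 0"
    and cont: "\<And>c. c \<in> {-\<rho>..\<rho>} \<Longrightarrow> continuous_on {-\<rho>..\<rho>} (g c)"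
    and nonneg: "\<And>c t. c \<in> {-\<rho>..\<rho>} \<Longrightarrow> t \<in> {-\<rho>..\<rho>} \<Longrightarrow> g c t \<ge> 0"
    and zero: "\<And>c. c \<in> {-\<rho>..\<rho>} \<Longrightarrow> g c c = 0"
  shows "\<exists>S b. finite S \<and> S \<subseteq> {-\<rho>..\<rho>} \<and> (\<forall>c. b c holomorphic_on UNIV) \<and>
    (\<forall>c t. b c (complex_of_real t) \<in> \<real>) \<and> (\<forall>z. (\<Sum>c\<in>S. b c z) = 1) \<and>
    (\<forall>t\<in>{-\<rho>..\<rho>}. (\<Sum>c\<in>S. cmod (b c (complex_of_real t)) * g c t) \<le> \<epsilon>)"
proof -
  let ?K = "{-\<rho>..\<rho>}"
  have "\<exists>\<delta>>0. \<forall>t\<in>?K. \<bar>t - c\<bar> < \<delta> \<longrightarrow> g c t < \<epsilon> / 2" if c: "c \<in> ?K" for c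
  proof -
    obtain \<delta> where "\<delta> > 0" "\<And>t. t \<in> ?K \<Longrightarrow> dist t c < \<delta> \<Longrightarrow> dist (g c t) (g c c) < \<epsilon> / 2"
      using cont[OF c] c half_gt_zero[OF \<epsilon>] unfolding continuous_on_iff by meson
    then have "\<delta> > 0" "\<And>t. t \<in> ?K \<Longrightarrow> \<bar>t - c\<bar> < \<delta> \<Longrightarrow> \<bar>g c t\<bar> < \<epsilon> / 2"
      using zero[OF c] by (simp_all add: dist_real_def)
    then show ?thesis using order_le_less_trans[OF abs_ge_self] by blast
  qed
  then obtain \<delta> where \<delta>: "\<And>c. c \<in> ?K \<Longrightarrow> \<delta> c > 0"
    "\<And>c t. c \<in> ?K \<Longrightarrow> t \<in> ?K \<Longrightarrow> \<bar>t - c\<bar> < \<delta> c \<Longrightarrow> g c t < \<epsilon> / 2" by metis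
  obtain S where S: "S \<subseteq> ?K" "finite S" "?K \<subseteq> (\<Union>c\<in>S. ball c (\<delta> c))"
  proof (rule compactE_image[OF compact_Icc, of ?K "\<lambda>c. ball c (\<delta> c)"])
    show "?K \<subseteq> (\<Union>c\<in>?K. ball c (\<delta> c))" using \<delta>(1) by force
  qed (use that in auto)
  \<comment> \<open>\<open>d c\<close> vanishes where g c t \<ge> \<epsilon> / 2, so the normalized
    weights only see points where g is small, which gives \<open>\<xi>g\<close>.\<close>
  define d where "d = (\<lambda>c t. max 0 (\<epsilon> / 2 - g c t))"
  define D where "D = (\<lambda>t. \<Sum>c\<in>S. d c t)"
  define \<xi> where "\<xi> = (\<lambda>c t. d c t / D t)"
  have d0: "d c t \<ge> 0" for c t by (simp add: d_def)
  have D: "D t > 0" if t: "t \<in> ?K" for t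
  proof -
    obtain c where c: "c \<in> S" "\<bar>t - c\<bar> < \<delta> c" using S(3) t by (auto simp: dist_real_def abs_minus_commute)
    then have "d c t > 0" using \<delta>(2)[of c t] S(1) t by (auto simp: d_def)
    then show ?thesis unfolding D_def using S(2) c(1) d0 by (intro sum_pos2) auto
  qed
  have contd: "continuous_on ?K (d c)" if "c \<in> S" for c
    unfolding d_def using that S(1) by (intro continuous_intros cont) auto
  have cont\<xi>: "continuous_on ?K (\<xi> c)" if "c \<in> S" for c
    unfolding \<xi>_def D_def using D by (intro continuous_intros contd that) (force simp: D_def)+
  have \<xi>0: "\<xi> c t \<ge> 0" if "t \<in> ?K" for c t using d0 D[OF that] by (simp add: \<xi>_def)
  have sum\<xi>: "(\<Sum>c\<in>S. \<xi> c t) = 1" if "t \<in> ?K" for t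
    using D[OF that] by (simp add: \<xi>_def sum_divide_distrib[symmetric] D_def)
  have \<xi>g: "\<xi> c t * g c t \<le> \<xi> c t * (\<epsilon> / 2)" if "t \<in> ?K" for c t
  proof (cases "g c t \<le> \<epsilon> / 2")
    case True then show ?thesis using \<xi>0[OF that] by (rule mult_left_mono)
  next
    case False then show ?thesis by (simp add: \<xi>_def d_def)
  qed
  have "\<exists>G\<ge>0. \<forall>t\<in>?K. g c t \<le> G" if "c \<in> S" for c
  proof -
    have "bounded (g c ` ?K)"
      using that S(1) by (intro compact_imp_bounded compact_continuous_image cont) auto
    then obtain G where G: "\<forall>t\<in>?K. \<bar>g c t\<bar> \<le> G" by (auto simp: bounded_iff)
    have "g c t \<le> max G 0" if "t \<in> ?K" for t
      using bspec[OF G that] by linarith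
    then show ?thesis by (intro exI[of _ "max G 0"]) auto
  qed
  then obtain Gb where Gb: "\<And>c. c \<in> S \<Longrightarrow> Gb c \<ge> 0" "\<And>c t. c \<in> S \<Longrightarrow> t \<in> ?K \<Longrightarrow> g c t \<le> Gb c" by metis
  define H where "H = (\<Sum>c\<in>S. Gb c) + 1"
  have H: "H > 0" using sum_nonneg[of S Gb] Gb(1) by (simp add: H_def add_nonneg_pos)
  \<comment> \<open>The Bernstein approximation costs at most \<eta> for each c, in total at most
    \<eta> * H = \<epsilon> / 2. The summand 1 in \<open>H\<close> only keeps the denominator
    positive.\<close>
  define \<eta> where "\<eta> = \<epsilon> / (2 * H)"
  have \<eta>: "\<eta> > 0" using \<epsilon> H by (simp add: \<eta>_def)
  define f where "f = (\<lambda>c x. \<xi> c (\<rho> * (2 * x - 1)))"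
  have inK: "\<rho> * (2 * x - 1) \<in> ?K" if "x \<in> {0..1}" for x
    using that \<rho> mult_left_mono[of "2 * x - 1" 1 \<rho>] mult_left_mono[of "- 1" "2 * x - 1" \<rho>] by auto
  have contf: "continuous_on {0..1} (f c)" if "c \<in> S" for c
    unfolding f_def by (rule continuous_on_compose2[OF cont\<xi>[OF that]])
      (use inK in \<open>auto intro!: continuous_intros\<close>)
  have "\<exists>N. \<forall>n x. N \<le> n \<and> x \<in> {0..1} \<longrightarrow> \<bar>f c x - (\<Sum>k\<le>n. f c (k / n) * Bernstein n k x)\<bar> < \<eta>" if "c \<in> S" for c
    by (rule Bernstein_Weierstrass[OF contf[OF that] \<eta>])
  then obtain Nc where Nc: "\<And>c n x. c \<in> S \<Longrightarrow> Nc c \<le> n \<Longrightarrow> x \<in> {0..1} \<Longrightarrow>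
    \<bar>f c x - (\<Sum>k\<le>n. f c (real k / real n) * Bernstein n k x)\<bar> < \<eta>" by metis
  \<comment> \<open>One degree for all c, so that summing over c inside the Bernstein sum gives
    exactly 1, not only approximately.\<close>
  define N where "N = (\<Sum>c\<in>S. Nc c)"
  have N: "Nc c \<le> N" if "c \<in> S" for c unfolding N_def using S(2) that by (simp add: member_le_sum)
  define w where "w = (\<lambda>z. (z / complex_of_real \<rho> + 1) / 2)"
  define b where "b = (\<lambda>c z. \<Sum>k\<le>N. complex_of_real (f c (real k / real N)) *
    (of_nat (N choose k) * w z ^ k * (1 - w z) ^ (N - k)))"
  have hol: "b c holomorphic_on UNIV" for c
    unfolding b_def w_def by (intro holomorphic_intros) (use \<rho> in auto)
  have breal: "b c (complex_of_real t) = of_real (\<Sum>k\<le>N. f c (real k / real N) * Bernstein N k ((t / \<rho> + 1) / 2))" for c t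
    unfolding b_def w_def Bernstein_def by simp
  \<comment> \<open>For N = 0 the node is 0 / 0 = 0, which still lies in the interval.\<close>
  have kN: "real k / real N \<in> {0..1}" if "k \<le> N" for k using that by (auto simp: divide_le_eq)
  have sumf: "(\<Sum>c\<in>S. f c x) = 1" if "x \<in> {0..1}" for x
    unfolding f_def by (rule sum\<xi>[OF inK[OF that]])
  have sum1: "(\<Sum>c\<in>S. b c z) = 1" for z
  proof -
    have "(\<Sum>c\<in>S. b c z) = (\<Sum>k\<le>N. of_real (\<Sum>c\<in>S. f c (real k / real N)) * (of_nat (N choose k) * w z ^ k * (1 - w z) ^ (N - k)))"
      unfolding b_def by (subst sum.swap) (simp add: sum_distrib_right)
    also have "\<dots> = (\<Sum>k\<le>N. of_nat (N choose k) * w z ^ k * (1 - w z) ^ (N - k))"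
      using sumf kN by (intro sum.cong refl) auto
    also have "\<dots> = (w z + (1 - w z)) ^ N" by (subst binomial_ring) simp
    finally show ?thesis by simp
  qed
  have "(\<Sum>c\<in>S. cmod (b c (complex_of_real t)) * g c t) \<le> \<epsilon>" if t: "t \<in> ?K" for t
  proof -
    define x where "x = (t / \<rho> + 1) / 2"
    have x: "x \<in> {0..1}" "\<rho> * (2 * x - 1) = t" using t \<rho> by (auto simp: x_def field_simps)
    have bb: "cmod (b c (complex_of_real t)) \<le> \<xi> c t + \<eta>" if "c \<in> S" for c
    proof -
      have "\<bar>f c x - (\<Sum>k\<le>N. f c (real k / real N) * Bernstein N k x)\<bar> < \<eta>"
        by (rule Nc[OF that N[OF that] x(1)])
      moreover have "f c x = \<xi> c t" by (simp add: f_def x(2))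
      moreover have "\<xi> c t \<ge> 0" by (rule \<xi>0[OF t])
      ultimately show ?thesis unfolding breal norm_of_real x_def[symmetric] by linarith
    qed
    have "(\<Sum>c\<in>S. cmod (b c (complex_of_real t)) * g c t) \<le> (\<Sum>c\<in>S. \<xi> c t * (\<epsilon> / 2) + \<eta> * Gb c)"
    proof (rule sum_mono)
      fix c assume c: "c \<in> S"
      have g0: "g c t \<ge> 0" using nonneg[of c t] c S(1) t by auto
      have "cmod (b c (complex_of_real t)) * g c t \<le> (\<xi> c t + \<eta>) * g c t"
        by (rule mult_right_mono[OF bb[OF c] g0])
      also have "\<dots> \<le> \<xi> c t * (\<epsilon> / 2) + \<eta> * Gb c"
        unfolding distrib_right using \<eta> by (intro add_mono \<xi>g[OF t] mult_left_mono Gb(2)[OF c t]) auto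
      finally show "cmod (b c (complex_of_real t)) * g c t \<le> \<xi> c t * (\<epsilon> / 2) + \<eta> * Gb c" .
    qed
    also have "\<dots> = \<epsilon> / 2 + \<eta> * (\<Sum>c\<in>S. Gb c)"
      by (simp add: sum.distrib sum_distrib_right[symmetric] sum_distrib_left[symmetric] sum\<xi>[OF t] sum_divide_distrib[symmetric])
    also have "\<eta> * (\<Sum>c\<in>S. Gb c) \<le> \<eta> * H" using \<eta> by (intro mult_left_mono) (auto simp: H_def)
    also have "\<eta> * H = \<epsilon> / 2" using H by (simp add: \<eta>_def)
    finally show ?thesis by simp
  qed
  then show ?thesis using S hol sum1 breal by (intro exI[of _ S] exI[of _ b]) auto
qed

lemma norm_one_minus_exp_le:
  fixes w :: complex
  assumes "cmod w \<le> 1"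
  shows "cmod (1 - exp (- w)) \<le> 3 * cmod w"
proof -
  have "cmod (exp (- w) - 1) \<le> exp (cmod w) * cmod w"
  proof -
    have "exp \<bar>Re w\<bar> * cmod w \<le> exp (cmod w) * cmod w"
      by (intro mult_right_mono) (auto simp: abs_Re_le_cmod)
    then show ?thesis using Taylor_exp[of "- w" 0] by simp
  qed
  also have "\<dots> \<le> 3 * cmod w"
  proof (rule mult_right_mono)
    have "exp (cmod w) \<le> exp 1" using assms by simp
    then show "exp (cmod w) \<le> 3" using exp_le by linarith
  qed simp
  finally show ?thesis by (simp add: norm_minus_commute)
qed

text \<open>The spaces are real, so the family has values only at real t. At complex z it is
  represented by scalar majorants built from the norms of its coefficients.\<close>

locale disc_family =
  fixes T :: "nat \<Rightarrow> 'x::banach \<Rightarrow>\<^sub>L 'y::banach" and TT :: "real \<Rightarrow> 'x \<Rightarrow>\<^sub>L 'y"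
  assumes summ: "\<And>s. 0 \<le> s \<Longrightarrow> s < 1 \<Longrightarrow> summable (\<lambda>n. norm (T n) * s ^ n)"
    and TT: "\<And>t. \<bar>t\<bar> < 1 \<Longrightarrow> (\<lambda>n. t ^ n *\<^sub>R T n) sums TT t"
begin

definition majorant :: "real \<Rightarrow> real"
  where "majorant s = (\<Sum>n. norm (T n) * s ^ n)"

text \<open>For real z this dominates norm (TT z - TT c). It still makes sense at complex z, and it
  bounds the terms of the difference separately, as the letters of the Neumann series
  require.\<close>

definition variation :: "complex \<Rightarrow> real \<Rightarrow> real"
  where "variation z c = (\<Sum>n. norm (T n) * cmod (z ^ n - of_real c ^ n))"

lemma majorant_nonneg: "0 \<le> s \<Longrightarrow> s < 1 \<Longrightarrow> majorant s \<ge> 0"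
  unfolding majorant_def by (intro suminf_nonneg summ) auto

lemma variation_term_le:
  "norm (T n) * cmod (z ^ n - of_real c ^ n) \<le> norm (T n) * cmod z ^ n + norm (T n) * \<bar>c\<bar> ^ n"
  unfolding distrib_left[symmetric]
  by (intro mult_left_mono order_trans[OF norm_triangle_ineq4]) (auto simp: norm_power)

lemma variation_summable:
  assumes "cmod z < 1" "\<bar>c\<bar> < 1"
  shows "summable (\<lambda>n. norm (T n) * cmod (z ^ n - of_real c ^ n))"
  by (rule summable_comparison_test'[OF summable_add[OF summ[of "cmod z"] summ[of "\<bar>c\<bar>"]], of 0])
    (use assms variation_term_le in auto)

lemma variation_bounds:
  assumes "cmod z < 1" "\<bar>c\<bar> < 1"
  shows "variation z c \<ge> 0" "variation z c \<le> majorant (cmod z) + majorant \<bar>c\<bar>"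
    "(\<Sum>j<J. norm (T j) * cmod (z ^ j - of_real c ^ j)) \<le> variation z c"
proof -
  note s = variation_summable[OF assms]
  show "variation z c \<ge> 0" unfolding variation_def by (intro suminf_nonneg s) auto
  show "(\<Sum>j<J. norm (T j) * cmod (z ^ j - of_real c ^ j)) \<le> variation z c"
    unfolding variation_def by (intro sum_le_suminf s) auto
  have "variation z c \<le> (\<Sum>n. norm (T n) * cmod z ^ n + norm (T n) * \<bar>c\<bar> ^ n)"
    unfolding variation_def by (intro suminf_le s summable_add summ variation_term_le) (use assms in auto)
  also have "\<dots> = majorant (cmod z) + majorant \<bar>c\<bar>"
    unfolding majorant_def by (intro suminf_add[symmetric] summ) (use assms in auto)
  finally show "variation z c \<le> majorant (cmod z) + majorant \<bar>c\<bar>" .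
qed

lemma variation_self: "variation (of_real c) c = 0"
  by (simp add: variation_def)

lemma continuous_variation:
  assumes c: "\<bar>c\<bar> < 1"
  shows "continuous_on (ball 0 1) (\<lambda>z. variation z c)"
proof -
  have cb: "continuous_on (cball 0 s) (\<lambda>z. variation z c)" if s: "0 \<le> s" "s < 1" for s
  proof (rule uniform_limit_theorem)
    show "uniform_limit (cball 0 s) (\<lambda>N z. \<Sum>n<N. norm (T n) * cmod (z ^ n - of_real c ^ n)) (\<lambda>z. variation z c) sequentially"
      unfolding variation_def
    proof (rule Weierstrass_m_test)
      fix n and z :: complex assume "z \<in> cball 0 s"
      then have "norm (T n) * cmod z ^ n \<le> norm (T n) * s ^ n" by (intro mult_left_mono power_mono) auto
      then show "norm (norm (T n) * cmod (z ^ n - of_real c ^ n)) \<le> norm (T n) * s ^ n + norm (T n) * \<bar>c\<bar> ^ n"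
        using variation_term_le[of n z c] by simp
    next
      show "summable (\<lambda>n. norm (T n) * s ^ n + norm (T n) * \<bar>c\<bar> ^ n)"
        using s c by (intro summable_add summ) auto
    qed
    show "\<forall>\<^sub>F N in sequentially. continuous_on (cball 0 s) (\<lambda>z. \<Sum>n<N. norm (T n) * cmod (z ^ n - of_real c ^ n))"
      by (intro always_eventually allI continuous_intros)
  qed simp
  then have "isCont (\<lambda>z. variation z c) z" if z: "cmod z < 1" for z
  proof -
    obtain s where s: "cmod z < s" "s < 1" using dense[OF z] by blast
    have "continuous_on (ball 0 s) (\<lambda>z. variation z c)"
      by (rule continuous_on_subset[OF cb]) (use s order_le_less_trans[OF norm_ge_zero s(1)] in auto)
    then show ?thesis using s by (simp add: continuous_on_eq_continuous_at)
  qed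
  then show ?thesis by (intro continuous_at_imp_continuous_on) auto
qed

text \<open>A holomorphic function measuring the growth of the family. The map (1 + z^2) / 2 sends
  the disc into itself, and |x| \<le> (1 + x^2) / 2 makes the series dominate
  \<open>majorant\<close> on the real axis. The summand 1 in each coefficient forces blow-up at both
  ends of the interval, and nonnegative coefficients give |growthC z| \<le> growth |z|.\<close>

definition growthC :: "complex \<Rightarrow> complex"
  where "growthC z = 1 + (\<Sum>n. of_real (norm (T n) + 1) * ((1 + z\<^sup>2) / 2) ^ n)"

definition growth :: "real \<Rightarrow> real"
  where "growth x = 1 + (\<Sum>n. (norm (T n) + 1) * ((1 + x\<^sup>2) / 2) ^ n)"

lemma growth_summable: "0 \<le> v \<Longrightarrow> v < 1 \<Longrightarrow> summable (\<lambda>n. (norm (T n) + 1) * v ^ n)"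
  unfolding distrib_right by (intro summable_add summ) (auto intro: summable_geometric)

lemma half_square:
  fixes x :: real
  assumes "\<bar>x\<bar> < 1"
  shows "0 \<le> (1 + x\<^sup>2) / 2" "(1 + x\<^sup>2) / 2 < 1" "\<bar>x\<bar> \<le> (1 + x\<^sup>2) / 2"
proof -
  show "0 \<le> (1 + x\<^sup>2) / 2" by simp
  have "x\<^sup>2 < 1" using assms by (simp add: abs_square_less_1)
  then show "(1 + x\<^sup>2) / 2 < 1" by simp
  have "0 \<le> (\<bar>x\<bar> - 1)\<^sup>2" by simp
  then show "\<bar>x\<bar> \<le> (1 + x\<^sup>2) / 2" by (simp add: power2_eq_square algebra_simps)
qed

lemma growthC_of_real:
  assumes "\<bar>x\<bar> < 1"
  shows "growthC (of_real x) = of_real (growth x)"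
proof -
  have "(\<Sum>n. complex_of_real ((norm (T n) + 1) * ((1 + x\<^sup>2) / 2) ^ n)) = of_real (\<Sum>n. (norm (T n) + 1) * ((1 + x\<^sup>2) / 2) ^ n)"
    by (rule suminf_of_real[symmetric]) (rule growth_summable[OF half_square(1,2)[OF assms]])
  then show ?thesis by (simp add: growthC_def growth_def)
qed

lemma growth_mono:
  assumes "\<bar>x\<bar> \<le> s" "s < 1"
  shows "growth x \<le> growth s"
proof -
  have v: "(1 + x\<^sup>2) / 2 \<le> (1 + s\<^sup>2) / 2" using power_mono[OF assms(1), of 2] by simp
  have "\<bar>x\<bar> < 1" "\<bar>s\<bar> < 1" using assms by auto
  note h = half_square[OF this(1)] half_square[OF this(2)]
  show ?thesis unfolding growth_def
    using v h by (intro add_left_mono suminf_le mult_left_mono power_mono growth_summable) auto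
qed

lemma growth_lower:
  assumes "\<bar>x\<bar> < 1"
  shows "1 + majorant \<bar>x\<bar> \<le> growth x" "1 / (1 - (1 + x\<^sup>2) / 2) \<le> growth x" "1 \<le> growth x"
proof -
  let ?v = "(1 + x\<^sup>2) / 2"
  note h = half_square[OF assms]
  show "1 + majorant \<bar>x\<bar> \<le> growth x"
    unfolding growth_def majorant_def
    using h assms by (intro add_left_mono suminf_le mult_mono power_mono growth_summable summ) auto
  then show "1 \<le> growth x" using majorant_nonneg[of "\<bar>x\<bar>"] assms by simp
  have "1 / (1 - ?v) = (\<Sum>n. ?v ^ n)" using h by (subst suminf_geometric) auto
  also have "\<dots> \<le> (\<Sum>n. (norm (T n) + 1) * ?v ^ n)"
    using h by (intro suminf_le growth_summable summable_geometric) (auto simp: algebra_simps)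
  finally show "1 / (1 - ?v) \<le> growth x" by (simp add: growth_def)
qed

lemma cmod_growthC_le:
  assumes "cmod z < 1"
  shows "cmod (growthC z) \<le> growth (cmod z)"
proof -
  have h: "0 \<le> (1 + (cmod z)\<^sup>2) / 2" "(1 + (cmod z)\<^sup>2) / 2 < 1" using half_square[of "cmod z"] assms by auto
  have "cmod ((1 + z\<^sup>2) / 2) \<le> (1 + (cmod z)\<^sup>2) / 2"
    using norm_triangle_ineq[of 1 "z\<^sup>2"] by (simp add: norm_divide norm_power)
  then have le: "cmod (of_real (norm (T n) + 1) * ((1 + z\<^sup>2) / 2) ^ n) \<le> (norm (T n) + 1) * ((1 + (cmod z)\<^sup>2) / 2) ^ n" for n
    unfolding norm_mult norm_power norm_of_real by (intro mult_mono power_mono) auto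
  have s: "summable (\<lambda>n. cmod (of_real (norm (T n) + 1) * ((1 + z\<^sup>2) / 2) ^ n))"
    by (rule summable_comparison_test'[OF growth_summable[OF h], of 0]) (use le in simp)
  have "cmod (growthC z) \<le> 1 + cmod (\<Sum>n. of_real (norm (T n) + 1) * ((1 + z\<^sup>2) / 2) ^ n)"
    unfolding growthC_def by (rule order_trans[OF norm_triangle_ineq]) simp
  also have "cmod (\<Sum>n. of_real (norm (T n) + 1) * ((1 + z\<^sup>2) / 2) ^ n) \<le> (\<Sum>n. cmod (of_real (norm (T n) + 1) * ((1 + z\<^sup>2) / 2) ^ n))"
    by (rule summable_norm[OF s])
  also have "\<dots> \<le> (\<Sum>n. (norm (T n) + 1) * ((1 + (cmod z)\<^sup>2) / 2) ^ n)"
    by (rule suminf_le[OF le s growth_summable[OF h]])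
  finally show ?thesis by (simp add: growth_def)
qed

lemma holomorphic_growthC: "growthC holomorphic_on ball 0 1"
proof -
  have "(\<lambda>w. \<Sum>n. complex_of_real (norm (T n) + 1) * w ^ n) holomorphic_on ball 0 1"
  proof (rule power_series_holomorphic)
    fix w :: complex assume "w \<in> ball 0 1"
    then have "summable (\<lambda>n. (norm (T n) + 1) * cmod w ^ n)" by (intro growth_summable) auto
    moreover have "norm (complex_of_real (norm (T n) + 1) * w ^ n) = (norm (T n) + 1) * cmod w ^ n" for n
      unfolding norm_mult norm_power norm_of_real by simp
    ultimately have "summable (\<lambda>n. norm (complex_of_real (norm (T n) + 1) * w ^ n))" by (simp only:)
    then have "summable (\<lambda>n. complex_of_real (norm (T n) + 1) * w ^ n)" by (rule summable_norm_cancel)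
    from summable_sums[OF this] show "(\<lambda>n. complex_of_real (norm (T n) + 1) * (w - 0) ^ n) sums (\<Sum>n. complex_of_real (norm (T n) + 1) * w ^ n)"
      by (simp only: diff_zero)
  qed
  moreover have "(\<lambda>z :: complex. (1 + z\<^sup>2) / 2) holomorphic_on ball 0 1" by (intro holomorphic_intros) auto
  moreover have "(\<lambda>z. (1 + z\<^sup>2) / 2) ` ball 0 1 \<subseteq> ball (0::complex) 1"
  proof safe
    fix z :: complex assume "z \<in> ball 0 1"
    then have "(1 + (cmod z)\<^sup>2) / 2 < 1" using half_square[of "cmod z"] by auto
    moreover have "cmod ((1 + z\<^sup>2) / 2) \<le> (1 + (cmod z)\<^sup>2) / 2"
      using norm_triangle_ineq[of 1 "z\<^sup>2"] by (simp add: norm_divide norm_power)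
    ultimately show "(1 + z\<^sup>2) / 2 \<in> ball 0 1" by simp
  qed
  ultimately have "(\<lambda>w. \<Sum>n. complex_of_real (norm (T n) + 1) * w ^ n) \<circ> (\<lambda>z. (1 + z\<^sup>2) / 2) holomorphic_on ball 0 1"
    by (intro holomorphic_on_compose_gen)
  then show ?thesis unfolding growthC_def[abs_def] o_def by (intro holomorphic_intros)
qed

end

lemma sum_geometric_tail_le: "(\<Sum>n\<in>{n0..<N}. (1 / 2 :: real) ^ n) \<le> 2 * (1 / 2) ^ n0"
proof (cases "n0 \<le> N")
  case True
  have "(\<Sum>n\<in>{n0..<N}. (1 / 2 :: real) ^ n) = 2 * ((1 / 2) ^ n0 - (1 / 2) ^ N)"
    using True by (induction N rule: dec_induct) (auto simp: algebra_simps)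
  then show ?thesis by simp
qed auto

section \<open>Weights adapted to the lifting constants\<close>

context disc_family
begin

text \<open>\<open>C c\<close> bounds the lifts at c, and the pair (n, c) carries the weight
  \<open>\<omega> n\<close> times \<open>b n c\<close>. The first local bound is for the total norm
  of the error operators, with the 1/2 that the Neumann series needs, the second for that of the
  approximate right inverse. Both hold on complex discs, where Cauchy's inequalities can use
  them.\<close>

definition weight_system ::
  "(real \<Rightarrow> real) \<Rightarrow> (nat \<Rightarrow> real set) \<Rightarrow> (nat \<Rightarrow> real \<Rightarrow> complex \<Rightarrow> complex) \<Rightarrow> (nat \<Rightarrow> complex \<Rightarrow> complex) \<Rightarrow> bool"
  where "weight_system C S b \<omega> \<longleftrightarrow>
    (\<forall>n. finite (S n) \<and> S n \<subseteq> {-1<..<1}) \<and> (\<forall>n c. b n c holomorphic_on UNIV) \<and>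
    (\<forall>n c t. b n c (complex_of_real t) \<in> \<real>) \<and> (\<forall>n z. (\<Sum>c\<in>S n. b n c z) = 1) \<and>
    (\<forall>n. \<omega> n holomorphic_on ball 0 1) \<and> (\<forall>n t. \<bar>t\<bar> < 1 \<longrightarrow> \<omega> n (complex_of_real t) \<in> \<real>) \<and>
    (\<forall>t. \<bar>t\<bar> < 1 \<longrightarrow> (\<lambda>n. \<omega> n (complex_of_real t)) sums 1) \<and>
    (\<forall>t. \<bar>t\<bar> < 1 \<longrightarrow> (\<exists>\<rho>>0. \<exists>B. ball (complex_of_real t) \<rho> \<subseteq> ball 0 1 \<and>
      (\<forall>z\<in>ball (complex_of_real t) \<rho>. \<forall>N.
        (\<Sum>n<N. cmod (\<omega> n z) * (\<Sum>c\<in>S n. cmod (b n c z) * (C c * variation z c))) \<le> 1 / 2 \<and>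
        (\<Sum>n<N. cmod (\<omega> n z) * (\<Sum>c\<in>S n. cmod (b n c z) * C c)) \<le> B)))"

text \<open>The steps \<open>1 - exp (- (u / k)\<^sup>m)\<close>, \<open>u\<close> being the growth function, are small where \<open>u \<le> k / 2\<close> and
  close to \<open>1\<close> where \<open>u \<ge> 2 k\<close>. Their differences \<open>\<omega>\<close> localize near the level sets of \<open>u\<close>.\<close>
lemma localized_weights:
  assumes C: "\<And>c. \<bar>c\<bar> < 1 \<Longrightarrow> C c \<ge> 1"
  shows "\<exists>S b \<omega>. weight_system C S b \<omega>"
proof -
  \<comment> \<open>Chosen so that [-r n, r n] contains all t with growth t \<le> 2 (n + 2), by the
    lower bound 2 / (1 - t^2) for the growth function.\<close>
  define r where "r = (\<lambda>n::nat. sqrt (1 - 1 / (real n + 2)))"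
  have r: "r n > 0" "r n < 1" for n by (auto simp: r_def)
  have rK: "\<bar>t\<bar> \<le> r n" if t: "\<bar>t\<bar> < 1" "growth t \<le> 2 * (real n + 2)" for n t
  proof -
    have "1 - (1 + t\<^sup>2) / 2 > 0" using half_square(2)[OF t(1)] by simp
    moreover have "1 / (1 - (1 + t\<^sup>2) / 2) \<le> 2 * (real n + 2)" using growth_lower(2)[OF t(1)] t(2) by linarith
    ultimately have "1 \<le> 2 * (real n + 2) * (1 - (1 + t\<^sup>2) / 2)" by (simp only: pos_divide_le_eq)
    then have "1 / (real n + 2) \<le> 2 * (1 - (1 + t\<^sup>2) / 2)" by (intro pos_divide_le_eq[THEN iffD2]) (simp, simp only: mult_ac)
    moreover have "2 * (1 - (1 + t\<^sup>2) / 2) = 1 - t\<^sup>2" by (simp add: field_simps)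
    ultimately have "t\<^sup>2 \<le> 1 - 1 / (real n + 2)" by linarith
    then show ?thesis unfolding r_def by (simp add: real_le_rsqrt)
  qed
  \<comment> \<open>The 32 is a budget: on the real axis each n costs at most two such terms, so all
    n together cost at most 1/8.\<close>
  define adapted where "adapted = (\<lambda>n S b. finite S \<and> S \<subseteq> {-r n..r n} \<and> (\<forall>c. b c holomorphic_on UNIV) \<and>
    (\<forall>c t. b c (complex_of_real t) \<in> \<real>) \<and> (\<forall>z. (\<Sum>c\<in>S. b c z) = 1) \<and>
    (\<forall>t\<in>{-r n..r n}. (\<Sum>c\<in>S. cmod (b c (complex_of_real t)) * (C c * variation (of_real t) c)) \<le> (1 / 2) ^ n / 32))"
  have "\<exists>S b. adapted n S b" for n
    unfolding adapted_def
  proof (rule polynomial_partition[where g = "\<lambda>c t. C c * variation (of_real t) c"])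
    fix c assume c: "c \<in> {-r n..r n}"
    then have c1: "\<bar>c\<bar> < 1" using r(2)[of n] by auto
    have "continuous_on {-r n..r n} (\<lambda>t. variation (complex_of_real t) c)"
      by (rule continuous_on_compose2[OF continuous_variation[OF c1]])
        (use r(2)[of n] in \<open>auto intro!: continuous_intros\<close>)
    then show "continuous_on {-r n..r n} (\<lambda>t. C c * variation (complex_of_real t) c)" by (intro continuous_intros)
    show "C c * variation (complex_of_real c) c = 0" by (simp add: variation_self)
    fix t assume "t \<in> {-r n..r n}"
    then have "\<bar>t\<bar> < 1" using r(2)[of n] by auto
    then show "0 \<le> C c * variation (complex_of_real t) c" using C[OF c1] c1 by (intro mult_nonneg_nonneg variation_bounds) auto
  qed (use r in auto)
  then obtain S b where "\<And>n. adapted n (S n) (b n)" by metis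
  then have Sr: "\<And>n. finite (S n)" "\<And>n. S n \<subseteq> {-r n..r n}" and b: "\<And>n c. b n c holomorphic_on UNIV"
    "\<And>n c t. b n c (complex_of_real t) \<in> \<real>" "\<And>n z. (\<Sum>c\<in>S n. b n c z) = 1"
    and small: "\<And>n t. t \<in> {-r n..r n} \<Longrightarrow> (\<Sum>c\<in>S n. cmod (b n c (complex_of_real t)) * (C c * variation (of_real t) c)) \<le> (1 / 2) ^ n / 32"
    unfolding adapted_def by blast+
  have S1: "\<bar>c\<bar> < 1" if "c \<in> S n" for n c
  proof -
    have "c \<in> {-r n..r n}" using that Sr(2) by blast
    then show ?thesis using r(2)[of n] by (simp add: abs_less_iff)
  qed
  define P where "P = (\<lambda>n z. \<Sum>c\<in>S n. cmod (b n c z) * (C c * variation z c))"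
  define Q where "Q = (\<lambda>n z. \<Sum>c\<in>S n. cmod (b n c z) * C c)"
  have C0: "C c \<ge> 0" if "c \<in> S n" for n c using C[OF S1[OF that]] by simp
  have P0: "P n z \<ge> 0" if "cmod z < 1" for n z
    unfolding P_def using that S1 C0 by (intro sum_nonneg mult_nonneg_nonneg variation_bounds) auto
  have Q0: "Q n z \<ge> 0" for n z unfolding Q_def using C0 by (intro sum_nonneg mult_nonneg_nonneg) auto
  have contb: "continuous_on UNIV (b n c)" for n c by (rule holomorphic_on_imp_continuous_on[OF b(1)])
  have contQ: "continuous_on UNIV (Q n)" for n unfolding Q_def by (intro continuous_intros contb)
  have contP: "continuous_on (ball 0 1) (P n)" for n unfolding P_def
    by (intro continuous_intros continuous_variation S1 continuous_on_subset[OF contb]) auto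
  have "\<exists>q\<ge>0. \<forall>z. cmod z \<le> 1 \<longrightarrow> Q n z \<le> q" for n
  proof -
    have "bounded (Q n ` cball 0 1)"
      by (intro compact_imp_bounded compact_continuous_image continuous_on_subset[OF contQ]) auto
    then obtain q where q: "\<forall>z\<in>cball 0 1. \<bar>Q n z\<bar> \<le> q" by (auto simp: bounded_iff)
    have "Q n z \<le> max q 0" if "cmod z \<le> 1" for z using bspec[OF q, of z] that by auto
    then show ?thesis by (intro exI[of _ "max q 0"]) auto
  qed
  then obtain qb where qb: "\<And>n. qb n \<ge> 0" "\<And>n z. cmod z \<le> 1 \<Longrightarrow> Q n z \<le> qb n" by metis
  \<comment> \<open>The polynomials are bounded on the closed disc, and \<open>variation\<close>
    splits into a majorant at |z| and one at a point of S n. So \<open>Mb n\<close> bounds Q n and,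
    with a factor growth |z|, also P n.\<close>
  define Mb where "Mb = (\<lambda>n. qb n * (1 + (\<Sum>c\<in>S n. majorant \<bar>c\<bar>)))"
  have maj: "(\<Sum>c\<in>S n. majorant \<bar>c\<bar>) \<ge> 0" for n by (intro sum_nonneg majorant_nonneg) (auto dest: S1)
  have Mb0: "Mb n \<ge> 0" for n using qb(1) maj by (simp add: Mb_def)
  have QM: "Q n z \<le> Mb n" if "cmod z < 1" for n z
  proof -
    have "Q n z \<le> qb n * 1" using qb(2)[of z n] that by simp
    also have "\<dots> \<le> Mb n" unfolding Mb_def using qb(1) maj by (intro mult_left_mono) auto
    finally show ?thesis .
  qed
  have PM: "P n z \<le> Mb n * growth (cmod z)" if z: "cmod z < 1" for n z
  proof -
    let ?A = "majorant (cmod z)" and ?s = "\<Sum>c\<in>S n. majorant \<bar>c\<bar>"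
    have A: "?A \<ge> 0" using z by (intro majorant_nonneg) auto
    have "P n z \<le> (\<Sum>c\<in>S n. cmod (b n c z) * C c * (?A + ?s))"
      unfolding P_def
    proof (rule sum_mono)
      fix c assume c: "c \<in> S n"
      have "majorant \<bar>c\<bar> \<le> ?s"
        using c Sr(1) by (intro member_le_sum majorant_nonneg) (auto dest: S1)
      then have "variation z c \<le> ?A + ?s" using variation_bounds(2)[OF z S1[OF c]] by linarith
      then show "cmod (b n c z) * (C c * variation z c) \<le> cmod (b n c z) * C c * (?A + ?s)"
        unfolding mult.assoc using C0[OF c] by (intro mult_left_mono) auto
    qed
    also have "\<dots> = Q n z * (?A + ?s)" by (simp add: Q_def sum_distrib_right)
    also have "\<dots> \<le> qb n * (?A + ?s)" using qb(2)[of z n] z A maj[of n] by (intro mult_right_mono) auto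
    also have "\<dots> \<le> qb n * ((1 + ?s) * (1 + ?A))"
      using A maj[of n] qb(1) by (intro mult_left_mono) (auto simp: algebra_simps)
    also have "\<dots> = Mb n * (1 + ?A)" by (simp add: Mb_def)
    also have "\<dots> \<le> Mb n * growth (cmod z)"
      using growth_lower(1)[of "cmod z"] z Mb0 by (intro mult_left_mono) auto
    finally show ?thesis .
  qed
  \<comment> \<open>The exponent is fixed only after \<open>Mb\<close>, which it has to beat. The
    step k occurs in both \<omega> (k - 1) and \<omega> k, whence both constants; for k = 0 the
    factor \<open>real k\<close> makes the condition void.\<close>
  have "\<exists>m. (Mb (k - 1) + Mb k) * real k * 32 * 2 ^ k \<le> 2 ^ m" for k
    using real_arch_pow[of 2 "(Mb (k - 1) + Mb k) * real k * 32 * 2 ^ k"] by (auto intro: less_imp_le)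
  then obtain m where m: "\<And>k. (Mb (k - 1) + Mb k) * real k * 32 * 2 ^ k \<le> 2 ^ m k" by metis
  have key: "Mb n * real k * (1 / 2) ^ m k \<le> (1 / 2) ^ n / 32" if "k = n \<or> k = Suc n" for n k
  proof -
    have "Mb n * real k * 32 * 2 ^ n \<le> (Mb (k - 1) + Mb k) * real k * 32 * 2 ^ k"
      using that Mb0 by (intro mult_mono mult_nonneg_nonneg add_nonneg_nonneg power_increasing) auto
    then have "Mb n * real k * 32 * 2 ^ n \<le> 2 ^ m k" using m[of k] by linarith
    then show ?thesis by (simp add: power_divide field_simps)
  qed
  \<comment> \<open>The value 1 at k = 0 starts the telescoping sum. The exponent m k is raised by
    one to leave a spare factor.\<close>
  define St where "St = (\<lambda>k z. if k = 0 then 1 else 1 - exp (- ((growthC z / of_nat k) ^ Suc (m k))))"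
  define \<omega> where "\<omega> = (\<lambda>n z. St n z - St (Suc n) z)"
  define \<sigma> where "\<sigma> = (\<lambda>k t. if k = 0 then 1 else 1 - exp (- ((growth t / real k) ^ Suc (m k))))"
  have St\<sigma>: "St k (of_real t) = of_real (\<sigma> k t)" if "\<bar>t\<bar> < 1" for k t
    using that by (simp add: St_def \<sigma>_def growthC_of_real exp_of_real[symmetric])
  have \<sigma>01: "0 \<le> \<sigma> k t" "\<sigma> k t \<le> 1" if "\<bar>t\<bar> < 1" for k t
    using growth_lower(3)[OF that] by (auto simp: \<sigma>_def)
  have \<omega>r: "\<omega> n (of_real t) = of_real (\<sigma> n t - \<sigma> (Suc n) t)" if "\<bar>t\<bar> < 1" for n t
    using that by (simp add: \<omega>_def St\<sigma>)
  have hol\<omega>: "\<omega> n holomorphic_on ball 0 1" for n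
  proof -
    have "St k holomorphic_on ball 0 1" for k
      unfolding St_def by (cases "k = 0") (auto intro!: holomorphic_intros holomorphic_growthC)
    then show ?thesis unfolding \<omega>_def by (intro holomorphic_intros)
  qed
  have St_small: "cmod (St k z) \<le> 2 * (1 / 2) ^ m k"
    if z: "cmod z \<le> s" "s < 1" and k: "real k \<ge> 2 * growth s" "k > 0" for k z s
  proof -
    have "cmod (growthC z) \<le> growth s"
      using cmod_growthC_le[of z] growth_mono[of "cmod z" s] z by auto
    then have "cmod (growthC z / of_nat k) \<le> 1 / 2"
      using k by (simp add: norm_divide divide_le_eq)
    then have "cmod ((growthC z / of_nat k) ^ Suc (m k)) \<le> (1 / 2) ^ Suc (m k)"
      unfolding norm_power by (intro power_mono) auto
    moreover have "(1 / 2 :: real) ^ Suc (m k) \<le> 1" by (rule power_le_one) auto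
    ultimately have "cmod (1 - exp (- ((growthC z / of_nat k) ^ Suc (m k)))) \<le> 3 * (1 / 2) ^ Suc (m k)"
      using norm_one_minus_exp_le[of "(growthC z / of_nat k) ^ Suc (m k)"] by linarith
    moreover have "3 * (1 / 2) ^ Suc (m k) \<le> (2 :: real) * (1 / 2) ^ m k" by simp
    moreover have "St k z = 1 - exp (- ((growthC z / of_nat k) ^ Suc (m k)))" using k(2) by (simp add: St_def)
    ultimately show ?thesis by (simp only: order_trans)
  qed
  have sums1: "(\<lambda>n. \<omega> n (complex_of_real t)) sums 1" if t: "\<bar>t\<bar> < 1" for t
  proof -
    have "(\<lambda>k. \<sigma> k t) \<longlonglongrightarrow> 0"
    proof (rule Lim_null_comparison)
      have "norm (\<sigma> k t) \<le> growth t / real k" if k: "real k \<ge> growth t" "k > 0" for k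
      proof -
        have q: "0 \<le> growth t / real k" "growth t / real k \<le> 1" using growth_lower(3)[OF t] k by (auto simp: divide_le_eq)
        have "\<sigma> k t \<le> (growth t / real k) ^ Suc (m k)"
          using k(2) exp_ge_add_one_self[of "- ((growth t / real k) ^ Suc (m k))"] unfolding \<sigma>_def by simp
        also have "\<dots> \<le> (growth t / real k) ^ 1" using q by (intro power_decreasing) auto
        finally show ?thesis using \<sigma>01[OF t, of k] by simp
      qed
      moreover have "\<forall>\<^sub>F k in sequentially. real k \<ge> growth t \<and> k > 0"
        using filterlim_real_sequentially unfolding filterlim_at_top
        by (intro eventually_conj eventually_gt_at_top) auto
      ultimately show "\<forall>\<^sub>F k in sequentially. norm (\<sigma> k t) \<le> growth t / real k"
        by (auto elim: eventually_mono)
      show "(\<lambda>k. growth t / real k) \<longlonglongrightarrow> 0" by (rule lim_const_over_n)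
    qed
    then have "(\<lambda>n. \<sigma> n t - \<sigma> (Suc n) t) sums (\<sigma> 0 t - 0)" by (rule telescope_sums')
    then have "(\<lambda>n. \<sigma> n t - \<sigma> (Suc n) t) sums 1" by (simp add: \<sigma>_def)
    then have "(\<lambda>n. complex_of_real (\<sigma> n t - \<sigma> (Suc n) t)) sums of_real 1" by (rule sums_of_real)
    then show ?thesis by (simp add: \<omega>r[OF t] del: of_real_diff)
  qed
  \<comment> \<open>A power bound suffices: exp (-X) \<le> 1 / X for X = (growth t / k)^(m k + 1).
    The spare factor k / growth t cancels the growth in the bound for P n.\<close>
  have far: "(1 - \<sigma> k t) * (Mb n * growth t) \<le> (1 / 2) ^ n / 32"
    if t: "\<bar>t\<bar> < 1" and k: "k = n \<or> k = Suc n" and g: "growth t \<ge> 2 * real k" for k n t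
  proof (cases "k = 0")
    case True then show ?thesis by (simp add: \<sigma>_def)
  next
    case False
    have g1: "growth t \<ge> 1" by (rule growth_lower(3)[OF t])
    let ?x = "growth t / real k"
    have x: "?x \<ge> 2" using False g by (simp add: le_divide_eq)
    have "1 - \<sigma> k t = exp (- (?x ^ Suc (m k)))" using False by (simp add: \<sigma>_def)
    also have "\<dots> \<le> 1 / ?x ^ Suc (m k)"
    proof -
      have xp: "?x ^ Suc (m k) > 0" using x by (intro zero_less_power) linarith
      have "?x ^ Suc (m k) \<le> exp (?x ^ Suc (m k))" using exp_ge_add_one_self[of "?x ^ Suc (m k)"] by linarith
      then show ?thesis using xp by (simp only: exp_minus inverse_eq_divide) (intro divide_left_mono mult_pos_pos exp_gt_zero; simp)
    qed
    also have "\<dots> = (1 / ?x) * (1 / ?x) ^ m k" by (simp add: power_divide)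
    also have "\<dots> \<le> (1 / ?x) * (1 / 2) ^ m k"
    proof -
      have "1 / ?x \<le> 1 / 2" by (rule frac_le) (use x in auto)
      moreover have "0 \<le> 1 / ?x" using g1 by simp
      ultimately show ?thesis by (intro mult_left_mono power_mono)
    qed
    finally have "(1 - \<sigma> k t) * (Mb n * growth t) \<le> ((1 / ?x) * (1 / 2) ^ m k) * (Mb n * growth t)"
      using Mb0 g1 by (intro mult_right_mono) auto
    also have "\<dots> = Mb n * real k * (1 / 2) ^ m k" using g1 by (simp add: field_simps)
    also have "\<dots> \<le> (1 / 2) ^ n / 32" by (rule key[OF k])
    finally show ?thesis .
  qed
  \<comment> \<open>Where growth t \<le> 2 (n + 2), t lies in [-r n, r n] and the partition is fine
    enough. Elsewhere growth t exceeds twice both indices n and n + 1, so both steps are close to 1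
    and their difference is small.\<close>
  have real_term: "cmod (\<omega> n (of_real t)) * P n (of_real t) \<le> (1 / 2) ^ n / 16" if t: "\<bar>t\<bar> < 1" for n t
  proof (cases "growth t \<le> 2 * (real n + 2)")
    case True
    then have "t \<in> {-r n..r n}" using rK[OF t, of n] by (auto simp: abs_le_iff)
    then have "P n (of_real t) \<le> (1 / 2) ^ n / 32" unfolding P_def by (rule small)
    moreover have "cmod (\<omega> n (of_real t)) \<le> 1"
      unfolding \<omega>r[OF t] norm_of_real using \<sigma>01[OF t, of n] \<sigma>01[OF t, of "Suc n"] by linarith
    ultimately have "cmod (\<omega> n (of_real t)) * P n (of_real t) \<le> 1 * ((1 / 2) ^ n / 32)"
      using P0[of "of_real t" n] t by (intro mult_mono) auto
    also have "\<dots> \<le> (1 / 2) ^ n / 16" by (simp add: divide_le_eq)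
    finally show ?thesis .
  next
    case False
    have PM': "P n (of_real t) \<le> Mb n * growth t"
    proof -
      have "growth \<bar>t\<bar> = growth t" by (simp add: growth_def)
      then show ?thesis using PM[of "of_real t" n] t by simp
    qed
    have "cmod (\<omega> n (of_real t)) \<le> (1 - \<sigma> n t) + (1 - \<sigma> (Suc n) t)"
      unfolding \<omega>r[OF t] norm_of_real using \<sigma>01[OF t, of n] \<sigma>01[OF t, of "Suc n"] by linarith
    then have "cmod (\<omega> n (of_real t)) * P n (of_real t) \<le> ((1 - \<sigma> n t) + (1 - \<sigma> (Suc n) t)) * (Mb n * growth t)"
    proof (rule mult_mono[OF _ PM'])
      show "0 \<le> (1 - \<sigma> n t) + (1 - \<sigma> (Suc n) t)"
        using \<sigma>01(2)[OF t, of n] \<sigma>01(2)[OF t, of "Suc n"] by linarith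
      show "0 \<le> P n (of_real t)" by (rule P0) (use t in simp)
    qed
    also have "\<dots> \<le> (1 / 2) ^ n / 32 + (1 / 2) ^ n / 32"
      unfolding distrib_right
    proof (rule add_mono)
      show "(1 - \<sigma> n t) * (Mb n * growth t) \<le> (1 / 2) ^ n / 32"
        by (rule far[OF t]) (use False in simp_all)
      show "(1 - \<sigma> (Suc n) t) * (Mb n * growth t) \<le> (1 / 2) ^ n / 32"
        by (rule far[OF t]) (use False in simp_all)
    qed
    also have "\<dots> = (1 / 2) ^ n / 16" by simp
    finally show ?thesis .
  qed
  have main: "\<exists>\<rho>>0. \<exists>B. ball (complex_of_real t) \<rho> \<subseteq> ball 0 1 \<and>
      (\<forall>z\<in>ball (complex_of_real t) \<rho>. \<forall>N. (\<Sum>n<N. cmod (\<omega> n z) * P n z) \<le> 1 / 2 \<and> (\<Sum>n<N. cmod (\<omega> n z) * Q n z) \<le> B)"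
    if t: "\<bar>t\<bar> < 1" for t
  proof -
    obtain s where s: "\<bar>t\<bar> < s" "s < 1" using dense[OF t] by blast
    \<comment> \<open>From n0 on, both steps are small throughout the complex disc of radius s, not
      only on the real axis. Moreover growth s \<le> 2^n0, which lets the geometric tail absorb the
      growth factor.\<close>
    obtain n0 where n0: "real n0 \<ge> 2 * growth s" using real_arch_simple by blast
    have g1: "growth s \<ge> 1" using s by (intro growth_lower) auto
    have n00: "n0 > 0" using n0 g1 by (cases n0) auto
    have pow: "growth s * (1 / 2) ^ n0 \<le> 1"
    proof -
      have "growth s \<le> 2 ^ n0" using n0 g1 of_nat_less_two_power[of n0, where 'a = real] by linarith
      then show ?thesis by (simp add: power_divide)
    qed
    have tail: "cmod (\<omega> n z) * Mb n \<le> (1 / 2) ^ n / 8" if z: "cmod z \<le> s" and n: "n \<ge> n0" for n z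
    proof -
      have nn: "real n \<ge> 2 * growth s" "real (Suc n) \<ge> 2 * growth s" "n > 0" using n0 n n00 by auto
      have "cmod (\<omega> n z) \<le> cmod (St n z) + cmod (St (Suc n) z)" unfolding \<omega>_def by (rule norm_triangle_ineq4)
      also have "\<dots> \<le> 2 * (1 / 2) ^ m n + 2 * (1 / 2) ^ m (Suc n)"
        by (intro add_mono St_small[OF z s(2)] nn) auto
      finally have "cmod (\<omega> n z) * Mb n \<le> 2 * (Mb n * (1 / 2) ^ m n) + 2 * (Mb n * (1 / 2) ^ m (Suc n))"
        using mult_right_mono[OF _ Mb0[of n]] by (fastforce simp: algebra_simps)
      also have "Mb n * (1 / 2) ^ m n \<le> Mb n * real n * (1 / 2) ^ m n"
        using Mb0[of n] nn(3) by (intro mult_right_mono) (auto simp: mult_le_cancel_left1)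
      also have "\<dots> \<le> (1 / 2) ^ n / 32" by (rule key) simp
      also have "Mb n * (1 / 2) ^ m (Suc n) \<le> Mb n * real (Suc n) * (1 / 2) ^ m (Suc n)"
        using Mb0[of n] by (intro mult_right_mono) (auto simp: mult_le_cancel_left1)
      also have "\<dots> \<le> (1 / 2) ^ n / 32" by (rule key) simp
      finally show ?thesis by simp
    qed
    define U where "U = (\<lambda>z. \<Sum>n<n0. cmod (\<omega> n z) * P n z)"
    define V where "V = (\<lambda>z. \<Sum>n<n0. cmod (\<omega> n z) * Q n z)"
    have contU: "continuous_on (ball 0 1) U" unfolding U_def
      by (intro continuous_intros contP holomorphic_on_imp_continuous_on hol\<omega>)
    have contV: "continuous_on (ball 0 1) V" unfolding V_def
      by (intro continuous_intros continuous_on_subset[OF contQ] holomorphic_on_imp_continuous_on hol\<omega>) auto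
    \<comment> \<open>The finitely many terms below n0 are estimated on the real axis only;
      continuity carries the strict inequality to a complex neighbourhood. They and the tail get 1/4
      each.\<close>
    have "U (of_real t) \<le> (\<Sum>n<n0. (1 / 2) ^ n / 16)" unfolding U_def by (intro sum_mono real_term[OF t])
    also have "\<dots> = (\<Sum>n\<in>{0..<n0}. (1 / 2) ^ n) / 16" by (simp add: sum_divide_distrib atLeast0LessThan)
    also have "\<dots> \<le> 1 / 8" using sum_geometric_tail_le[of 0 n0] by simp
    finally have Ut: "U (of_real t) < 1 / 4" by simp
    have isU: "isCont U (of_real t)" "isCont V (of_real t)"
      using contU contV t by (auto simp: continuous_on_eq_continuous_at)
    have "\<forall>\<^sub>F z in nhds (of_real t). U z < 1 / 4 \<and> V z < V (of_real t) + 1 \<and> z \<in> ball 0 s"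
    proof (intro eventually_conj)
      show "\<forall>\<^sub>F z in nhds (of_real t). U z < 1 / 4"
        using order_tendstoD(2)[OF isU(1)[unfolded isCont_def tendsto_at_iff_tendsto_nhds] Ut] .
      show "\<forall>\<^sub>F z in nhds (of_real t). V z < V (of_real t) + 1"
        by (rule order_tendstoD(2)[OF isU(2)[unfolded isCont_def tendsto_at_iff_tendsto_nhds]]) simp
      show "\<forall>\<^sub>F z in nhds (complex_of_real t). z \<in> ball 0 s" by (rule eventually_nhds_in_open) (use s in \<open>auto simp: dist_norm\<close>)
    qed
    then obtain \<rho> where \<rho>: "\<rho> > 0" and near: "\<And>z. dist z (complex_of_real t) < \<rho> \<Longrightarrow>
      U z < 1 / 4 \<and> V z < V (of_real t) + 1 \<and> z \<in> ball 0 s"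
      unfolding eventually_nhds_metric by blast
    have "(\<Sum>n<N. cmod (\<omega> n z) * P n z) \<le> 1 / 2 \<and> (\<Sum>n<N. cmod (\<omega> n z) * Q n z) \<le> V (of_real t) + 2"
      if z: "z \<in> ball (complex_of_real t) \<rho>" for z N
    proof -
      have nz: "U z < 1 / 4" "V z < V (of_real t) + 1" "cmod z < s"
        using near[of z] z by (auto simp: dist_commute)
      then have z1: "cmod z < 1" using s by simp
      have split: "(\<Sum>n<N. f n) \<le> (\<Sum>n<n0. f n) + (\<Sum>n\<in>{n0..<N}. f n)" if "\<And>n. f n \<ge> 0" for f :: "nat \<Rightarrow> real"
      proof -
        have "(\<Sum>n<N. f n) \<le> sum f ({..<n0} \<union> {n0..<N})" using that by (intro sum_mono2) auto
        also have "\<dots> = (\<Sum>n<n0. f n) + (\<Sum>n\<in>{n0..<N}. f n)" by (intro sum.union_disjoint) auto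
        finally show ?thesis .
      qed
      have tl: "(\<Sum>n\<in>{n0..<N}. cmod (\<omega> n z) * Mb n) \<le> (1 / 2) ^ n0 / 4"
      proof -
        have "(\<Sum>n\<in>{n0..<N}. cmod (\<omega> n z) * Mb n) \<le> (\<Sum>n\<in>{n0..<N}. (1 / 2) ^ n / 8)"
          using nz by (intro sum_mono tail) auto
        also have "\<dots> = (\<Sum>n\<in>{n0..<N}. (1 / 2) ^ n) / 8" by (simp add: sum_divide_distrib)
        finally show ?thesis using sum_geometric_tail_le[of n0 N] by simp
      qed
      have gz: "growth (cmod z) \<le> growth s" using nz s by (intro growth_mono) auto
      have "(\<Sum>n\<in>{n0..<N}. cmod (\<omega> n z) * P n z) \<le> (\<Sum>n\<in>{n0..<N}. (cmod (\<omega> n z) * Mb n) * growth s)"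
      proof (rule sum_mono)
        fix n
        have "P n z \<le> Mb n * growth s" using PM[OF z1, of n] mult_left_mono[OF gz Mb0[of n]] by linarith
        then show "cmod (\<omega> n z) * P n z \<le> (cmod (\<omega> n z) * Mb n) * growth s"
          unfolding mult.assoc by (rule mult_left_mono) simp
      qed
      also have "\<dots> \<le> ((1 / 2) ^ n0 / 4) * growth s"
        unfolding sum_distrib_right[symmetric] using tl g1 by (intro mult_right_mono) auto
      also have "\<dots> \<le> 1 / 4" using pow by (simp add: mult.commute)
      finally have "(\<Sum>n\<in>{n0..<N}. cmod (\<omega> n z) * P n z) \<le> 1 / 4" .
      moreover have "(\<Sum>n<N. cmod (\<omega> n z) * P n z) \<le> U z + (\<Sum>n\<in>{n0..<N}. cmod (\<omega> n z) * P n z)"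
        unfolding U_def by (rule split) (simp add: P0[OF z1])
      ultimately have 1: "(\<Sum>n<N. cmod (\<omega> n z) * P n z) \<le> 1 / 2" using nz by linarith
      have "(\<Sum>n\<in>{n0..<N}. cmod (\<omega> n z) * Q n z) \<le> (\<Sum>n\<in>{n0..<N}. cmod (\<omega> n z) * Mb n)"
        by (intro sum_mono mult_left_mono QM[OF z1]) auto
      also have "\<dots> \<le> 1" using tl power_le_one[of "1 / 2 :: real" n0] by simp
      finally have "(\<Sum>n\<in>{n0..<N}. cmod (\<omega> n z) * Q n z) \<le> 1" .
      moreover have "(\<Sum>n<N. cmod (\<omega> n z) * Q n z) \<le> V z + (\<Sum>n\<in>{n0..<N}. cmod (\<omega> n z) * Q n z)"
        unfolding V_def by (rule split) (simp add: Q0)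
      ultimately show ?thesis using 1 nz by linarith
    qed
    moreover have "ball (complex_of_real t) \<rho> \<subseteq> ball 0 1"
      using near s by (force simp: dist_commute)
    ultimately show ?thesis using \<rho> by blast
  qed
  have S11: "S n \<subseteq> {-1<..<1}" for n using S1[of _ n] by (auto simp: abs_less_iff)
  have \<omega>R: "\<omega> n (complex_of_real t) \<in> \<real>" if "\<bar>t\<bar> < 1" for n t unfolding \<omega>r[OF that] by (rule Reals_of_real)
  show ?thesis
    unfolding weight_system_def
    by (intro exI[of _ S] exI[of _ b] exI[of _ \<omega>] conjI allI impI)
      (use Sr(1) S11 b hol\<omega> \<omega>R sums1 main in \<open>simp_all add: P_def Q_def\<close>)
qed

end

section \<open>Lifting on the unit disc\<close>

text \<open>Scalar functions with fixed vectors, bounded uniformly over finite subfamilies on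
  complex discs. \<open>pseries_nuclear\<close> turns this into analyticity, also after composing
  the scalar functions with a holomorphic map.\<close>

definition locally_nuclear :: "'i set \<Rightarrow> ('i \<Rightarrow> complex \<Rightarrow> complex) \<Rightarrow> ('i \<Rightarrow> 'x::real_normed_vector) \<Rightarrow> bool"
  where "locally_nuclear W \<Theta> v \<longleftrightarrow>
    (\<forall>w\<in>W. \<Theta> w holomorphic_on ball 0 1) \<and>
    (\<forall>t. \<bar>t\<bar> < 1 \<longrightarrow> (\<exists>\<rho>>0. \<exists>K. ball (complex_of_real t) \<rho> \<subseteq> ball 0 1 \<and>
      (\<forall>z\<in>ball (complex_of_real t) \<rho>. \<forall>X. finite X \<longrightarrow> X \<subseteq> W \<longrightarrow> (\<Sum>w\<in>X. cmod (\<Theta> w z) * norm (v w)) \<le> K)))"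

context disc_family
begin

text \<open>An index ((j, w), i) stands for the coefficient y j, a word w of error letters ((n, c),
  k), and the pair i = (n, c) at whose point c the last lift is taken. A letter lifts at c and then
  applies T k.\<close>

theorem disc_lift:
  assumes surj: "\<And>t. \<bar>t\<bar> < 1 \<Longrightarrow> surj (blinfun_apply (TT t))"
    and y: "\<And>s. 0 \<le> s \<Longrightarrow> s < 1 \<Longrightarrow> summable (\<lambda>n. norm (y n) * s ^ n)"
  shows "\<exists>(W :: ((nat \<times> ((nat \<times> real) \<times> nat) list) \<times> (nat \<times> real)) set) \<Theta> v.
    locally_nuclear W \<Theta> v \<and>
    (\<forall>t. \<bar>t\<bar> < 1 \<longrightarrow> TT t (\<Sum>\<^sub>\<infinity>w\<in>W. Re (\<Theta> w (of_real t)) *\<^sub>R v w) = (\<Sum>n. t ^ n *\<^sub>R y n))"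
proof -
  have "\<exists>C0\<ge>0. \<exists>F. \<forall>u. TT c (F u) = u \<and> norm (F u) \<le> C0 * norm u" if "\<bar>c\<bar> < 1" for c
    using surj_bounded_linear_lift_bound[OF surj[OF that]] by metis
  then obtain C0 F where F0: "\<And>c. \<bar>c\<bar> < 1 \<Longrightarrow> C0 c \<ge> 0" "\<And>c u. \<bar>c\<bar> < 1 \<Longrightarrow> TT c (F c u) = u"
    "\<And>c u. \<bar>c\<bar> < 1 \<Longrightarrow> norm (F c u) \<le> C0 c * norm u" by metis
  \<comment> \<open>The weights are built for constants at least 1. This also yields the summability
    of the bare weights in \<open>sum_r\<close>.\<close>
  define C where "C = (\<lambda>c. max 1 (C0 c))"
  have C1: "C c \<ge> 1" for c by (simp add: C_def)
  have FC: "norm (F c u) \<le> C c * norm u" if "\<bar>c\<bar> < 1" for c u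
    using F0(3)[OF that, of u] mult_right_mono[of "C0 c" "C c" "norm u"] by (simp add: C_def)
  obtain S b \<omega> where "weight_system C S b \<omega>" using localized_weights[of C, OF C1] by blast
  then have S: "\<And>n. finite (S n)" "\<And>n. S n \<subseteq> {-1<..<1::real}"
    and b: "\<And>n c. b n c holomorphic_on UNIV" "\<And>n c t. b n c (complex_of_real t) \<in> \<real>" "\<And>n z. (\<Sum>c\<in>S n. b n c z) = 1"
    and \<omega>: "\<And>n. \<omega> n holomorphic_on ball 0 1" "\<And>n t. \<bar>t\<bar> < 1 \<Longrightarrow> \<omega> n (complex_of_real t) \<in> \<real>"
      "\<And>t. \<bar>t\<bar> < 1 \<Longrightarrow> (\<lambda>n. \<omega> n (complex_of_real t)) sums 1"
    and near: "\<And>t. \<bar>t\<bar> < 1 \<Longrightarrow> \<exists>\<rho>>0. \<exists>B. ball (complex_of_real t) \<rho> \<subseteq> ball 0 1 \<and>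
      (\<forall>z\<in>ball (complex_of_real t) \<rho>. \<forall>N.
        (\<Sum>n<N. cmod (\<omega> n z) * (\<Sum>c\<in>S n. cmod (b n c z) * (C c * variation z c))) \<le> 1 / 2 \<and>
        (\<Sum>n<N. cmod (\<omega> n z) * (\<Sum>c\<in>S n. cmod (b n c z) * C c)) \<le> B)"
    unfolding weight_system_def by blast+
  define I where "I = Sigma (UNIV :: nat set) S"
  define \<psi> where "\<psi> = (\<lambda>i z. \<omega> (fst i) z * b (fst i) (snd i) z)"
  define F' where "F' = (\<lambda>i :: nat \<times> real. F (snd i))"
  define M where "M = I \<times> (UNIV :: nat set)"
  \<comment> \<open>As the \<psi> i add up to 1 at real t, u minus TT t of the glued lift is the sum
    of \<psi> i (TT c - TT t) (F c u), and TT c - TT t is the sum of (c^k - t^k) T k. These summands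
    are the letters.\<close>
  define \<phi> where "\<phi> = (\<lambda>m z. \<psi> (fst m) z * (of_real (snd (fst m)) ^ snd m - z ^ snd m))"
  define E where "E = (\<lambda>(m :: (nat \<times> real) \<times> nat) u. T (snd m) (F' (fst m) u))"
  define e where "e = (\<lambda>m :: (nat \<times> real) \<times> nat. norm (T (snd m)) * C (snd (fst m)))"
  have I1: "\<bar>snd i\<bar> < 1" if "i \<in> I" for i using that S(2) by (fastforce simp: I_def)
  have F': "norm (F' i u) \<le> C (snd i) * norm u" "C (snd i) \<ge> 0" if "i \<in> I" for i u
    using FC[OF I1[OF that]] C1[of "snd i"] by (auto simp: F'_def)
  have E: "norm (E m u) \<le> e m * norm u" "e m \<ge> 0" if "m \<in> M" for m u
  proof -
    have "fst m \<in> I" using that by (auto simp: M_def)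
    then have "norm (E m u) \<le> norm (T (snd m)) * (C (snd (fst m)) * norm u)"
      unfolding E_def using F'(1) norm_blinfun[of "T (snd m)"] by (meson mult_left_mono norm_ge_zero order_trans)
    then show "norm (E m u) \<le> e m * norm u" by (simp add: e_def mult.assoc)
    show "e m \<ge> 0" using F'(2)[OF \<open>fst m \<in> I\<close>] by (simp add: e_def)
  qed
  have finI: "\<exists>N. X \<subseteq> Sigma {..<N} S" if X: "finite X" "X \<subseteq> I" for X
  proof -
    obtain N where "fst ` X \<subseteq> {..<N}" using X finite_nat_iff_bounded by (metis finite_imageI)
    then have "X \<subseteq> Sigma {..<N} S" using X by (fastforce simp: I_def)
    then show ?thesis by blast
  qed
  have bI: "(\<Sum>i\<in>X. cmod (\<psi> i z) * C (snd i)) \<le> B"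
    if X: "finite X" "X \<subseteq> I" and B: "\<And>N. (\<Sum>n<N. cmod (\<omega> n z) * (\<Sum>c\<in>S n. cmod (b n c z) * C c)) \<le> B" for X z B
  proof -
    obtain N where N: "X \<subseteq> Sigma {..<N} S" using finI[OF X] by blast
    have "(\<Sum>i\<in>X. cmod (\<psi> i z) * C (snd i)) \<le> (\<Sum>i\<in>Sigma {..<N} S. cmod (\<psi> i z) * C (snd i))"
      using N S(1) by (intro sum_mono2 mult_nonneg_nonneg F'(2)) (auto simp: I_def)
    also have "\<dots> = (\<Sum>n<N. \<Sum>c\<in>S n. cmod (\<psi> (n, c) z) * C c)"
      using S(1) by (subst sum.Sigma) (auto simp: case_prod_unfold)
    also have "\<dots> = (\<Sum>n<N. cmod (\<omega> n z) * (\<Sum>c\<in>S n. cmod (b n c z) * C c))"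
      by (simp add: \<psi>_def norm_mult sum_distrib_left mult.assoc)
    finally show ?thesis using B[of N] by linarith
  qed
  have bM: "(\<Sum>m\<in>X. cmod (\<phi> m z) * e m) \<le> B"
    if X: "finite X" "X \<subseteq> M" and z: "cmod z < 1"
      and B: "\<And>N. (\<Sum>n<N. cmod (\<omega> n z) * (\<Sum>c\<in>S n. cmod (b n c z) * (C c * variation z c))) \<le> B" for X z B
  proof -
    have "fst ` X \<subseteq> I" using X by (auto simp: M_def)
    then obtain N where N: "fst ` X \<subseteq> Sigma {..<N} S" using finI[of "fst ` X"] X by auto
    obtain J where J: "snd ` X \<subseteq> {..<J}" using X finite_nat_iff_bounded by (metis finite_imageI)
    have sub: "X \<subseteq> Sigma {..<N} S \<times> {..<J}" using N J by (auto simp: subset_iff image_iff) (metis fst_conv snd_conv)+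
    have "(\<Sum>m\<in>X. cmod (\<phi> m z) * e m) \<le> (\<Sum>m\<in>Sigma {..<N} S \<times> {..<J}. cmod (\<phi> m z) * e m)"
      using sub S(1) by (intro sum_mono2 mult_nonneg_nonneg E(2)) (auto simp: I_def M_def)
    also have "\<dots> = (\<Sum>i\<in>Sigma {..<N} S. \<Sum>j<J. cmod (\<phi> (i, j) z) * e (i, j))"
      by (subst sum.cartesian_product) (auto simp: case_prod_unfold)
    also have "\<dots> = (\<Sum>n<N. \<Sum>c\<in>S n. \<Sum>j<J. cmod (\<phi> ((n, c), j) z) * e ((n, c), j))"
      using S(1) by (subst sum.Sigma) (auto simp: case_prod_unfold)
    also have "\<dots> \<le> (\<Sum>n<N. \<Sum>c\<in>S n. cmod (\<omega> n z) * (cmod (b n c z) * (C c * variation z c)))"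
    proof (intro sum_mono)
      fix n c assume "c \<in> S n"
      then have c: "(n, c) \<in> I" "\<bar>c\<bar> < 1" using I1[of "(n, c)"] by (auto simp: I_def)
      have "(\<Sum>j<J. cmod (\<phi> ((n, c), j) z) * e ((n, c), j)) =
        (cmod (\<omega> n z) * cmod (b n c z) * C c) * (\<Sum>j<J. norm (T j) * cmod (z ^ j - of_real c ^ j))"
        unfolding sum_distrib_left
        by (intro sum.cong refl) (simp add: \<phi>_def \<psi>_def e_def norm_mult norm_minus_commute)
      also have "\<dots> \<le> (cmod (\<omega> n z) * cmod (b n c z) * C c) * variation z c"
        using C1[of c] by (intro mult_left_mono variation_bounds(3) z c) auto
      finally show "(\<Sum>j<J. cmod (\<phi> ((n, c), j) z) * e ((n, c), j)) \<le> cmod (\<omega> n z) * (cmod (b n c z) * (C c * variation z c))"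
        by (simp add: mult.assoc)
    qed
    also have "\<dots> = (\<Sum>n<N. cmod (\<omega> n z) * (\<Sum>c\<in>S n. cmod (b n c z) * (C c * variation z c)))"
      by (simp add: sum_distrib_left)
    finally show ?thesis using B[of N] by linarith
  qed
  have real\<psi>: "\<psi> i (of_real t) = of_real (Re (\<psi> i (of_real t)))" if "\<bar>t\<bar> < 1" for i t
    unfolding \<psi>_def by (rule of_real_Re[symmetric]) (intro Reals_mult \<omega>(2) that b(2))
  have real\<phi>: "\<phi> m (of_real t) = of_real (Re (\<phi> m (of_real t)))" if "\<bar>t\<bar> < 1" for m t
  proof -
    have "\<phi> m (of_real t) \<in> \<real>" unfolding \<phi>_def
      by (intro Reals_mult Reals_diff Reals_power Reals_of_real, subst real\<psi>[OF that], rule Reals_of_real)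
    then show ?thesis by (simp add: of_real_Re)
  qed
  define W where "W = ((UNIV :: nat set) \<times> lists M) \<times> I"
  define \<Theta> where "\<Theta> = (\<lambda>x z. z ^ fst (fst x) * prod_list (map (\<lambda>m. \<phi> m z) (snd (fst x))) * \<psi> (snd x) z)"
  define v where "v = (\<lambda>x. F' (snd x) (word_apply E (snd (fst x)) (y (fst (fst x)))))"
  have hol\<psi>: "\<psi> i holomorphic_on ball 0 1" for i
    unfolding \<psi>_def by (intro holomorphic_intros \<omega> holomorphic_on_subset[OF b(1)]) auto
  have hol\<phi>: "\<phi> m holomorphic_on ball 0 1" for m
    unfolding \<phi>_def by (intro holomorphic_intros hol\<psi>)
  have holpl: "(\<lambda>z. prod_list (map (\<lambda>m. \<phi> m z) w)) holomorphic_on ball 0 1" for w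
    by (induction w) (auto intro!: holomorphic_intros hol\<phi>)
  have hol\<Theta>: "\<Theta> x holomorphic_on ball 0 1" for x
    unfolding \<Theta>_def by (intro holomorphic_intros hol\<psi> holpl)
  have pl_norm: "cmod (prod_list (map f w)) = prod_list (map (\<lambda>m. cmod (f m)) w)" for f :: "(nat \<times> real) \<times> nat \<Rightarrow> complex" and w
    by (induction w) (auto simp: norm_mult)
  have bound: "\<exists>\<rho>>0. \<exists>K. ball (complex_of_real t) \<rho> \<subseteq> ball 0 1 \<and>
      (\<forall>z\<in>ball (complex_of_real t) \<rho>. \<forall>X. finite X \<longrightarrow> X \<subseteq> W \<longrightarrow> (\<Sum>w\<in>X. cmod (\<Theta> w z) * norm (v w)) \<le> K)"
    if t: "\<bar>t\<bar> < 1" for t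
  proof -
    obtain \<rho> B where \<rho>: "\<rho> > 0" "ball (complex_of_real t) \<rho> \<subseteq> ball 0 1"
      and B: "\<And>z N. z \<in> ball (complex_of_real t) \<rho> \<Longrightarrow>
        (\<Sum>n<N. cmod (\<omega> n z) * (\<Sum>c\<in>S n. cmod (b n c z) * (C c * variation z c))) \<le> 1 / 2"
        "\<And>z N. z \<in> ball (complex_of_real t) \<rho> \<Longrightarrow> (\<Sum>n<N. cmod (\<omega> n z) * (\<Sum>c\<in>S n. cmod (b n c z) * C c)) \<le> B"
      using near[OF t] by blast
    obtain s where s: "\<bar>t\<bar> < s" "s < 1" using dense[OF t] by blast
    \<comment> \<open>Besides the bounds for the weights, |z| \<le> s < 1 is needed, so that the
      series of norm (y j) * s^j controls the coefficients of y.\<close>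
    define \<delta> where "\<delta> = min \<rho> (s - \<bar>t\<bar>)"
    have \<delta>: "\<delta> > 0" "\<delta> \<le> \<rho>" using \<rho> s by (auto simp: \<delta>_def)
    define D where "D = (\<Sum>j. norm (y j) * s ^ j)"
    have "(\<Sum>w\<in>X. cmod (\<Theta> w z) * norm (v w)) \<le> D * 2 * B"
      if z: "z \<in> ball (complex_of_real t) \<delta>" and X: "finite X" "X \<subseteq> W" for z X
    proof -
      have z\<rho>: "z \<in> ball (complex_of_real t) \<rho>" using z \<delta> by auto
      then have z1: "cmod z < 1" using \<rho>(2) by auto
      have "cmod z \<le> cmod (of_real t) + dist (of_real t) z"
        using norm_triangle_ineq[of "of_real t" "z - of_real t"] by (simp add: dist_norm norm_minus_commute)
      then have zs: "cmod z \<le> s" using z by (auto simp: \<delta>_def)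
      have "(\<Sum>j\<in>A. cmod z ^ j * norm (y j)) \<le> D" if "finite A" for A
      proof -
        have "(\<Sum>j\<in>A. cmod z ^ j * norm (y j)) \<le> (\<Sum>j\<in>A. norm (y j) * s ^ j)"
          using zs by (intro sum_mono, subst mult.commute, intro mult_left_mono power_mono) auto
        also have "\<dots> \<le> D" unfolding D_def using s that by (intro sum_le_suminf y) auto
        finally show ?thesis .
      qed
      then have "(\<Sum>((j, w), i)\<in>X. (cmod z ^ j * prod_list (map (\<lambda>m. cmod (\<phi> m z)) w) * cmod (\<psi> i z)) *
          norm (F' i (word_apply E w (y j)))) \<le> D * 2 * B"
        using X unfolding W_def
        by (intro neumann_bound[where M = M and e = e and I = I and C = "\<lambda>i. C (snd i)"] E F' bM bI B z\<rho> z1) auto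
      then show ?thesis by (simp add: \<Theta>_def v_def case_prod_unfold norm_mult norm_power pl_norm)
    qed
    moreover have "ball (complex_of_real t) \<delta> \<subseteq> ball 0 1" using \<rho>(2) subset_ball[OF \<delta>(2)] by blast
    ultimately show ?thesis using \<delta>(1) by blast
  qed
  \<comment> \<open>At real t all weights are real, so the identity in the real Banach spaces is the
    Neumann series of \<open>neumann_lift\<close>.\<close>
  have lift: "TT t (\<Sum>\<^sub>\<infinity>w\<in>W. Re (\<Theta> w (of_real t)) *\<^sub>R v w) = (\<Sum>n. t ^ n *\<^sub>R y n)" if t: "\<bar>t\<bar> < 1" for t
  proof -
    define p where "p = (\<lambda>m. Re (\<phi> m (of_real t)))"
    define r where "r = (\<lambda>i. Re (\<psi> i (of_real t)))"
    have p: "\<phi> m (of_real t) = of_real (p m)" for m unfolding p_def by (rule real\<phi>[OF t])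
    have r: "\<psi> i (of_real t) = of_real (r i)" for i unfolding r_def by (rule real\<psi>[OF t])
    obtain \<rho> B where "\<rho> > 0" and *: "\<forall>z\<in>ball (complex_of_real t) \<rho>. \<forall>N.
        (\<Sum>n<N. cmod (\<omega> n z) * (\<Sum>c\<in>S n. cmod (b n c z) * (C c * variation z c))) \<le> 1 / 2 \<and>
        (\<Sum>n<N. cmod (\<omega> n z) * (\<Sum>c\<in>S n. cmod (b n c z) * C c)) \<le> B"
      using near[OF t] by blast
    have B: "(\<Sum>n<N. cmod (\<omega> n (of_real t)) * (\<Sum>c\<in>S n. cmod (b n c (of_real t)) * (C c * variation (of_real t) c))) \<le> 1 / 2"
        "(\<Sum>n<N. cmod (\<omega> n (of_real t)) * (\<Sum>c\<in>S n. cmod (b n c (of_real t)) * C c)) \<le> B" for N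
      using bspec[OF *, of "of_real t"] \<open>\<rho> > 0\<close> by simp_all
    have pb: "(\<Sum>m\<in>A. \<bar>p m\<bar> * e m) \<le> 1 / 2" if "finite A" "A \<subseteq> M" for A
      using bM[OF that _ B(1)] t by (simp add: p)
    have rb: "(\<Sum>i\<in>A. \<bar>r i\<bar> * C (snd i)) \<le> B" if "finite A" "A \<subseteq> I" for A
      using bI[OF that B(2)] by (simp add: r)
    have sum_r: "r summable_on I"
    proof (rule abs_summable_if_finite_sums_bounded(2))
      fix A assume A: "finite A" "A \<subseteq> I"
      have "(\<Sum>i\<in>A. norm (r i)) \<le> (\<Sum>i\<in>A. \<bar>r i\<bar> * C (snd i))"
        using C1 by (intro sum_mono) (simp add: mult_le_cancel_left1)
      then show "(\<Sum>i\<in>A. norm (r i)) \<le> B" using rb[OF A] by linarith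
    qed
    have sum_rF: "(\<lambda>i. r i *\<^sub>R F' i u) summable_on I" for u
    proof (rule abs_summable_if_finite_sums_bounded(2))
      fix A assume A: "finite A" "A \<subseteq> I"
      have "(\<Sum>i\<in>A. norm (r i *\<^sub>R F' i u)) \<le> (\<Sum>i\<in>A. (\<bar>r i\<bar> * C (snd i)) * norm u)"
        using A F'(1) by (intro sum_mono) (auto simp: mult.assoc intro!: mult_left_mono)
      also have "\<dots> \<le> B * norm u" unfolding sum_distrib_right[symmetric] using rb[OF A] by (rule mult_right_mono) simp
      finally show "(\<Sum>i\<in>A. norm (r i *\<^sub>R F' i u)) \<le> B * norm u" .
    qed
    have sum_pE: "(\<lambda>m. p m *\<^sub>R E m u) summable_on M" for u
    proof (rule abs_summable_if_finite_sums_bounded(2))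
      fix A assume A: "finite A" "A \<subseteq> M"
      have "(\<Sum>m\<in>A. norm (p m *\<^sub>R E m u)) \<le> (\<Sum>m\<in>A. (\<bar>p m\<bar> * e m) * norm u)"
        using A E(1) by (intro sum_mono) (auto simp: mult.assoc intro!: mult_left_mono)
      also have "\<dots> \<le> (1 / 2) * norm u" unfolding sum_distrib_right[symmetric] using pb[OF A] by (rule mult_right_mono) simp
      finally show "(\<Sum>m\<in>A. norm (p m *\<^sub>R E m u)) \<le> (1 / 2) * norm u" .
    qed
    have r1: "(r has_sum 1) I"
    proof -
      have inner: "((\<lambda>c. r (n, c)) has_sum Re (\<omega> n (of_real t))) (S n)" for n
      proof -
        have "(\<Sum>c\<in>S n. \<psi> (n, c) (of_real t)) = \<omega> n (of_real t) * (\<Sum>c\<in>S n. b n c (of_real t))"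
          by (simp add: \<psi>_def sum_distrib_left)
        then have "(\<Sum>c\<in>S n. \<psi> (n, c) (of_real t)) = \<omega> n (of_real t)" by (simp add: b(3))
        then have "(\<Sum>c\<in>S n. r (n, c)) = Re (\<omega> n (of_real t))" unfolding r_def by (simp flip: Re_sum)
        then show ?thesis using has_sum_finite[OF S(1), of "\<lambda>c. r (n, c)" n] by simp
      qed
      have outer: "(r has_sum infsum r I) (Sigma UNIV S)"
        using has_sum_infsum[OF sum_r] by (simp only: I_def)
      have "((\<lambda>n. Re (\<omega> n (of_real t))) has_sum infsum r I) UNIV"
        by (rule has_sum_SigmaD[OF outer]) (rule inner)
      then have "(\<lambda>n. Re (\<omega> n (of_real t))) sums infsum r I" by (rule has_sum_imp_sums)
      moreover have "(\<lambda>n. Re (\<omega> n (of_real t))) sums 1" using sums_Re[OF \<omega>(3)[OF t]] by simp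
      ultimately have "infsum r I = 1" by (rule sums_unique2)
      then show ?thesis using has_sum_infsum[OF sum_r] by simp
    qed
    have id: "((\<lambda>m. p m *\<^sub>R E m u) has_sum (u - TT t (\<Sum>\<^sub>\<infinity>i\<in>I. r i *\<^sub>R F' i u))) M" for u
    proof -
      have "((\<lambda>i. r i *\<^sub>R u) has_sum 1 *\<^sub>R u) I"
        by (rule has_sum_bounded_linear[OF bounded_linear_scaleR_left r1])
      moreover have "((\<lambda>i. - TT t (r i *\<^sub>R F' i u)) has_sum - TT t (\<Sum>\<^sub>\<infinity>i\<in>I. r i *\<^sub>R F' i u)) I"
        unfolding has_sum_uminus
        by (simp, rule has_sum_bounded_linear[OF blinfun.bounded_linear_right has_sum_infsum[OF sum_rF]])
      ultimately have "((\<lambda>i. r i *\<^sub>R u + - TT t (r i *\<^sub>R F' i u)) has_sum (1 *\<^sub>R u + - TT t (\<Sum>\<^sub>\<infinity>i\<in>I. r i *\<^sub>R F' i u))) I"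
        by (rule has_sum_add)
      then have outer: "((\<lambda>i. r i *\<^sub>R (u - TT t (F' i u))) has_sum (u - TT t (\<Sum>\<^sub>\<infinity>i\<in>I. r i *\<^sub>R F' i u))) I"
        by (simp add: blinfun.scaleR_right scaleR_diff_right)
      have inner: "((\<lambda>j. p (i, j) *\<^sub>R E (i, j) u) has_sum r i *\<^sub>R (u - TT t (F' i u))) UNIV" if i: "i \<in> I" for i
      proof -
        let ?c = "snd i" and ?x = "F' i u"
        have c: "\<bar>?c\<bar> < 1" by (rule I1[OF i])
        have ev: "(\<lambda>j. (x ^ j *\<^sub>R T j) ?x) sums TT x ?x" if "\<bar>x\<bar> < 1" for x
          by (rule bounded_linear.sums[OF blinfun.bounded_linear_left TT[OF that]])
        have "(\<lambda>j. (?c ^ j - t ^ j) *\<^sub>R T j ?x) sums (TT ?c ?x - TT t ?x)"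
          using sums_diff[OF ev[OF c] ev[OF t]] by (simp add: blinfun.scaleR_left scaleR_diff_left)
        moreover have "TT ?c ?x = u" unfolding F'_def by (rule F0(2)[OF c])
        moreover have "summable (\<lambda>j. norm ((?c ^ j - t ^ j) *\<^sub>R T j ?x))"
        proof (rule summable_comparison_test'[of "\<lambda>j. (norm (T j) * cmod (of_real t ^ j - of_real ?c ^ j)) * norm ?x" 0])
          show "summable (\<lambda>j. (norm (T j) * cmod (of_real t ^ j - of_real ?c ^ j)) * norm ?x)"
            by (intro summable_mult2 variation_summable c) (use t in simp)
          fix j
          have "cmod (of_real t ^ j - of_real ?c ^ j) = \<bar>?c ^ j - t ^ j\<bar>"
            by (metis abs_minus_commute norm_of_real of_real_diff of_real_power)
          then show "norm (norm ((?c ^ j - t ^ j) *\<^sub>R T j ?x)) \<le> (norm (T j) * cmod (of_real t ^ j - of_real ?c ^ j)) * norm ?x"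
            using mult_left_mono[OF norm_blinfun[of "T j" ?x], of "\<bar>?c ^ j - t ^ j\<bar>"] by (simp add: mult_ac)
        qed
        ultimately have "((\<lambda>j. (?c ^ j - t ^ j) *\<^sub>R T j ?x) has_sum (u - TT t ?x)) UNIV"
          using norm_summable_imp_has_sum by metis
        then have "((\<lambda>j. r i *\<^sub>R ((?c ^ j - t ^ j) *\<^sub>R T j ?x)) has_sum r i *\<^sub>R (u - TT t ?x)) UNIV"
          by (rule has_sum_scaleR)
        moreover have "p (i, j) = r i * (?c ^ j - t ^ j)" for j
        proof -
          have "\<phi> (i, j) (of_real t) = of_real (r i * (?c ^ j - t ^ j))" by (simp add: \<phi>_def r)
          then show ?thesis by (simp add: p del: of_real_mult of_real_diff)
        qed
        ultimately show ?thesis by (simp add: E_def)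
      qed
      show ?thesis unfolding M_def
        by (rule has_sum_SigmaI[OF _ outer sum_pE[unfolded M_def]]) (rule inner)
    qed
    have ysum: "summable (\<lambda>j. norm (t ^ j *\<^sub>R y j))"
      using y[of "\<bar>t\<bar>"] t by (simp add: power_abs mult.commute)
    have yb: "(\<Sum>j\<in>A. \<bar>t ^ j\<bar> * norm (y j)) \<le> (\<Sum>j. norm (t ^ j *\<^sub>R y j))" if "finite A" for A
      using sum_le_suminf[OF ysum that] by simp
    have "TT t (\<Sum>\<^sub>\<infinity>((j, w), i)\<in>(UNIV \<times> lists M) \<times> I. (t ^ j * prod_list (map p w) * r i) *\<^sub>R F' i (word_apply E w (y j)))
      = (\<Sum>\<^sub>\<infinity>j. t ^ j *\<^sub>R y j)"
      by (rule neumann_lift[where e = e and C = "\<lambda>i. C (snd i)", OF E pb F' rb yb id])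
    also have "(\<Sum>\<^sub>\<infinity>j. t ^ j *\<^sub>R y j) = (\<Sum>n. t ^ n *\<^sub>R y n)"
      by (intro infsumI norm_summable_imp_has_sum ysum summable_sums summable_norm_cancel[OF ysum])
    also have "(\<Sum>\<^sub>\<infinity>((j, w), i)\<in>(UNIV \<times> lists M) \<times> I. (t ^ j * prod_list (map p w) * r i) *\<^sub>R F' i (word_apply E w (y j)))
      = (\<Sum>\<^sub>\<infinity>w\<in>W. Re (\<Theta> w (of_real t)) *\<^sub>R v w)"
    proof -
      have pl: "prod_list (map (\<lambda>m. \<phi> m (of_real t)) w) = of_real (prod_list (map p w))" for w
        by (induction w) (auto simp: p)
      have "\<Theta> x (of_real t) = of_real (t ^ fst (fst x) * prod_list (map p (snd (fst x))) * r (snd x))" for x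
        by (simp add: \<Theta>_def r pl)
      then show ?thesis by (simp add: W_def v_def case_prod_unfold del: of_real_mult of_real_power)
    qed
    finally show ?thesis .
  qed
  show ?thesis
    unfolding locally_nuclear_def
    by (rule exI[of _ W], rule exI[of _ \<Theta>], rule exI[of _ v]) (use hol\<Theta> bound lift in blast)
qed

end

section \<open>Symmetric Riemann maps\<close>

lemma has_field_derivative_reflect:
  assumes "(f has_field_derivative p) (at (cnj z))"
  shows "((\<lambda>z. cnj (f (cnj z))) has_field_derivative cnj p) (at z)"
proof -
  have "((\<lambda>z. f (cnj z)) has_derivative (\<lambda>h. p * cnj h)) (at z)"
    using has_derivative_compose[OF bounded_linear.has_derivative[OF bounded_linear_cnj has_derivative_ident], of f "(*) p" z UNIV] assms
    by (simp add: has_field_derivative_def)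
  from bounded_linear.has_derivative[OF bounded_linear_cnj this]
  show ?thesis by (simp add: has_field_derivative_def)
qed

lemma holomorphic_on_reflect:
  assumes "f holomorphic_on S" "open S" and sym: "\<And>z. z \<in> S \<Longrightarrow> cnj z \<in> S"
  shows "(\<lambda>z. cnj (f (cnj z))) holomorphic_on S"
proof (rule holomorphic_onI)
  fix z assume "z \<in> S"
  then have "cnj z \<in> S" by (rule sym)
  then obtain p where "(f has_field_derivative p) (at (cnj z))"
    using assms(1,2) by (metis holomorphic_derivI)
  then have "((\<lambda>z. cnj (f (cnj z))) has_field_derivative cnj p) (at z)" by (rule has_field_derivative_reflect)
  then show "(\<lambda>z. cnj (f (cnj z))) field_differentiable (at z within S)"
    by (meson field_differentiable_at_within field_differentiable_def)
qed

section \<open>Complex neighbourhoods of an interval\<close>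

definition complex_nbhd :: "real set \<Rightarrow> (real \<Rightarrow> real) \<Rightarrow> complex set"
  where "complex_nbhd J r = (\<Union>x\<in>J. ball (complex_of_real x) (r x))"

text \<open>Radii at most 1 keep 2 i outside the neighbourhood, which is thus not the whole plane.
  The last condition makes the discs meet the real axis only in \<open>J\<close>.\<close>

locale interval_radius =
  fixes J :: "real set" and r :: "real \<Rightarrow> real"
  assumes J: "connected J" "J \<noteq> {}"
    and r: "\<And>x. x \<in> J \<Longrightarrow> 0 < r x" "\<And>x. x \<in> J \<Longrightarrow> r x \<le> 1"
    and inJ: "\<And>x y. x \<in> J \<Longrightarrow> \<bar>y - x\<bar> < r x \<Longrightarrow> y \<in> J"
begin

lemma complex_nbhd_cnj: "z \<in> complex_nbhd J r \<Longrightarrow> cnj z \<in> complex_nbhd J r"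
  unfolding complex_nbhd_def by (auto simp: dist_norm) (metis complex_cnj_complex_of_real complex_cnj_diff complex_mod_cnj)

lemma Re_complex_nbhd: "z \<in> complex_nbhd J r \<Longrightarrow> Re z \<in> J"
proof -
  assume "z \<in> complex_nbhd J r"
  then obtain x where x: "x \<in> J" "cmod (z - of_real x) < r x"
    by (auto simp: complex_nbhd_def dist_norm norm_minus_commute)
  then have "\<bar>Re z - x\<bar> < r x" using abs_Re_le_cmod[of "z - of_real x"] by simp
  then show ?thesis using inJ x by blast
qed

lemma of_real_in_complex_nbhd: "x \<in> J \<Longrightarrow> complex_of_real x \<in> complex_nbhd J r"
  using r(1) by (force simp: complex_nbhd_def)

text \<open>The vertical projection to the real axis stays in each disc, since the centres are real;
  the interval then contracts to a point.\<close>

lemma simply_connected_complex_nbhd: "simply_connected (complex_nbhd J r)"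
proof (rule contractible_imp_simply_connected)
  let ?U = "complex_nbhd J r"
  obtain x0 where x0: "x0 \<in> J" using J by blast
  have h1: "homotopic_with_canon (\<lambda>z. True) ?U ?U id (\<lambda>z. complex_of_real (Re z))"
  proof (rule homotopic_with_linear)
    fix z assume "z \<in> ?U"
    then obtain x where x: "x \<in> J" "z \<in> ball (complex_of_real x) (r x)" by (auto simp: complex_nbhd_def)
    have "cmod (of_real x - of_real (Re z)) \<le> cmod (of_real x - z)"
      using abs_Re_le_cmod[of "of_real x - z"] by (simp flip: of_real_diff)
    then have "complex_of_real (Re z) \<in> ball (complex_of_real x) (r x)" using x by (simp add: dist_norm)
    then have "closed_segment z (complex_of_real (Re z)) \<subseteq> ball (complex_of_real x) (r x)"
      using x(2) by (intro closed_segment_subset) auto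
    then show "closed_segment (id z) (complex_of_real (Re z)) \<subseteq> ?U" using x(1) by (auto simp: complex_nbhd_def)
  qed (auto intro!: continuous_intros)
  have h2: "homotopic_with_canon (\<lambda>z. True) ?U ?U (\<lambda>z. complex_of_real (Re z)) (\<lambda>z. of_real x0)"
  proof (rule homotopic_with_linear)
    fix z assume "z \<in> ?U"
    then have "Re z \<in> J" by (rule Re_complex_nbhd)
    then have "closed_segment (Re z) x0 \<subseteq> J"
      using x0 J(1) by (meson closed_segment_subset convex_real_interval is_interval_connected_1 is_interval_convex_1)
    then show "closed_segment (complex_of_real (Re z)) (of_real x0) \<subseteq> ?U"
      unfolding closed_segment_of_real using of_real_in_complex_nbhd by blast
  qed (auto intro!: continuous_intros)
  show "contractible ?U" unfolding contractible_def using homotopic_with_trans[OF h1 h2] by blast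
qed

text \<open>A Riemann map normalized by \<open>\<phi> x\<^sub>0 = 0\<close> and \<open>\<phi>' x\<^sub>0 > 0\<close> is its own reflection, by the
  Schwarz lemma.\<close>
lemma symmetric_riemann_map:
  shows "\<exists>\<phi> g. \<phi> holomorphic_on complex_nbhd J r \<and> g holomorphic_on ball 0 1 \<and>
    (\<forall>w\<in>ball 0 1. g w \<in> complex_nbhd J r) \<and>
    (\<forall>x\<in>J. \<exists>t. \<bar>t\<bar> < 1 \<and> \<phi> (complex_of_real x) = of_real t \<and> g (of_real t) = of_real x) \<and>
    (\<forall>t. \<bar>t\<bar> < 1 \<longrightarrow> (\<exists>x\<in>J. g (complex_of_real t) = of_real x)) \<and>
    (\<forall>z\<in>complex_nbhd J r. \<phi> z \<in> ball 0 1)"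
proof -
  let ?U = "complex_nbhd J r"
  have openU: "open ?U" by (auto simp: complex_nbhd_def)
  obtain x0 where x0: "x0 \<in> J" using J by blast
  have x0U: "of_real x0 \<in> ?U" by (rule of_real_in_complex_nbhd[OF x0])
  have "2 * \<i> \<notin> ?U"
  proof
    assume "2 * \<i> \<in> ?U"
    then obtain x where "x \<in> J" "cmod (2 * \<i> - of_real x) < 1"
      using r(2) by (force simp: complex_nbhd_def dist_norm norm_minus_commute)
    then show False using abs_Im_le_cmod[of "2 * \<i> - of_real x"] by simp
  qed
  then have "?U \<noteq> {}" "?U \<noteq> UNIV" using x0U by auto
  then obtain f h where f: "f holomorphic_on ?U" "h holomorphic_on ball 0 1"
    "\<And>z. z \<in> ?U \<Longrightarrow> f z \<in> ball 0 1" "\<And>z. z \<in> ?U \<Longrightarrow> h (f z) = z"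
    "\<And>w. w \<in> ball 0 1 \<Longrightarrow> h w \<in> ?U" "\<And>w. w \<in> ball 0 1 \<Longrightarrow> f (h w) = w"
    using Riemann_mapping_theorem[of ?U] openU simply_connected_complex_nbhd by metis
  \<comment> \<open>An automorphism of the disc moves the image of x0 to 0. The rotation by
    \<open>\<alpha>\<close> below then makes the derivative there positive.\<close>
  obtain m k where m: "m (f (of_real x0)) = 0" "m holomorphic_on ball 0 1" "m ` ball 0 1 \<subseteq> ball 0 1"
    "k holomorphic_on ball 0 1" "k ` ball 0 1 \<subseteq> ball 0 1"
    "\<And>z. z \<in> ball 0 1 \<Longrightarrow> m (k z) = z" "\<And>z. z \<in> ball 0 1 \<Longrightarrow> k (m z) = z"
    using ball_biholomorphism_exists[OF f(3)[OF x0U]] by blast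
  define f1 where "f1 = (\<lambda>z. m (f z))"
  define g1 where "g1 = (\<lambda>w. h (k w))"
  have f1: "f1 holomorphic_on ?U" unfolding f1_def
    using holomorphic_on_compose_gen[OF f(1) m(2) image_subsetI[OF f(3)]] by (simp add: o_def)
  have g1: "g1 holomorphic_on ball 0 1" unfolding g1_def
    using holomorphic_on_compose_gen[OF m(4) f(2) m(5)] by (simp add: o_def)
  have f1b: "f1 z \<in> ball 0 1" "g1 (f1 z) = z" if "z \<in> ?U" for z
  proof -
    show "f1 z \<in> ball 0 1" unfolding f1_def using f(3)[OF that] m(3) by blast
    show "g1 (f1 z) = z" unfolding f1_def g1_def using m(7)[OF f(3)[OF that]] f(4)[OF that] by simp
  qed
  have g1b: "g1 w \<in> ?U" "f1 (g1 w) = w" if "w \<in> ball 0 1" for w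
  proof -
    have "k w \<in> ball 0 1" using that m(5) by blast
    then show "g1 w \<in> ?U" "f1 (g1 w) = w" unfolding f1_def g1_def
      using f(5)[of "k w"] f(6)[of "k w"] m(6)[OF that] by simp_all
  qed
  have f10: "f1 (of_real x0) = 0" by (simp add: f1_def m(1))
  have g10: "g1 0 = of_real x0" using f1b(2)[OF x0U] f10 by simp
  define d where "d = deriv f1 (of_real x0)"
  have df: "(f1 has_field_derivative d) (at (of_real x0))"
    unfolding d_def by (rule holomorphic_derivI[OF f1 openU x0U])
  have dg: "(g1 has_field_derivative deriv g1 0) (at 0)"
    by (rule holomorphic_derivI[OF g1]) auto
  have "((\<lambda>w. f1 (g1 w)) has_field_derivative d * deriv g1 0) (at 0)"
    by (rule DERIV_chain2[OF _ dg]) (simp add: g10 df)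
  moreover have "((\<lambda>w. f1 (g1 w)) has_field_derivative 1) (at 0)"
  proof (rule has_field_derivative_transform_within_open[where S = "ball 0 1" and f = "\<lambda>w. w"])
    show "w = f1 (g1 w)" if "w \<in> ball 0 1" for w using g1b(2)[OF that] by simp
    show "((\<lambda>w. w) has_field_derivative 1) (at (0 :: complex))" by (rule DERIV_ident)
  qed auto
  ultimately have dd: "d * deriv g1 0 = 1" by (rule DERIV_unique)
  then have d0: "d \<noteq> 0" by auto
  define \<alpha> where "\<alpha> = cnj d / of_real (cmod d)"
  have \<alpha>: "cmod \<alpha> = 1" "\<alpha> \<noteq> 0" using d0 by (auto simp: \<alpha>_def norm_divide)
  define \<phi> where "\<phi> = (\<lambda>z. \<alpha> * f1 z)"
  define g where "g = (\<lambda>w. g1 (w / \<alpha>))"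
  have \<alpha>ball: "w / \<alpha> \<in> ball 0 1" if "w \<in> ball 0 1" for w using that \<alpha> by (simp add: norm_divide)
  have hol\<phi>: "\<phi> holomorphic_on ?U" unfolding \<phi>_def by (intro holomorphic_intros f1)
  have holg: "g holomorphic_on ball 0 1"
  proof -
    have "(\<lambda>w. w / \<alpha>) holomorphic_on ball 0 1" using \<alpha> by (intro holomorphic_intros) auto
    from holomorphic_on_compose_gen[OF this g1 image_subsetI[OF \<alpha>ball]] show ?thesis by (simp add: g_def o_def)
  qed
  have \<phi>b: "\<phi> z \<in> ball 0 1" "g (\<phi> z) = z" if "z \<in> ?U" for z
    using f1b[OF that] \<alpha> by (auto simp: \<phi>_def g_def norm_mult)
  have gb: "g w \<in> ?U" "\<phi> (g w) = w" if "w \<in> ball 0 1" for w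
    using g1b[OF \<alpha>ball[OF that]] \<alpha> by (auto simp: \<phi>_def g_def)
  have nd: "cnj d * d = of_real (cmod d) * of_real (cmod d)"
    using complex_norm_square[of d] by (simp add: power2_eq_square mult.commute)
  have \<alpha>d: "\<alpha> * d = of_real (cmod d)" unfolding \<alpha>_def times_divide_eq_left nd using d0 by simp
  then have d\<phi>: "(\<phi> has_field_derivative of_real (cmod d)) (at (cnj (of_real x0)))"
    unfolding \<phi>_def using DERIV_cmult[OF df, of \<alpha>] by simp
  have dgg: "(g has_field_derivative deriv g1 0 / \<alpha>) (at 0)"
  proof -
    have "((\<lambda>w. w / \<alpha>) has_field_derivative 1 / \<alpha>) (at 0)" by (rule DERIV_cdivide[OF DERIV_ident])
    from DERIV_chain2[OF _ this, of g1 "deriv g1 0"] show ?thesis using dg by (simp add: g_def)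
  qed
  \<comment> \<open>The reflected map after the inverse of \<phi>: a self-map of the disc that fixes
    0 and has the derivative |d| g1'(0) / \<alpha> = d g1'(0) = 1 there, because |d| = \<alpha> d.
    Once it is the identity, \<phi> commutes with conjugation and real points go to real
    points.\<close>
  define \<omega> where "\<omega> = (\<lambda>w. cnj (\<phi> (cnj (g w))))"
  have hol\<omega>: "\<omega> holomorphic_on ball 0 1"
    using holomorphic_on_compose_gen[OF holg holomorphic_on_reflect[OF hol\<phi> openU complex_nbhd_cnj] image_subsetI[OF gb(1)]]
    by (simp add: \<omega>_def o_def)
  have g0: "g 0 = of_real x0" by (simp add: g_def g10)
  have "(\<omega> has_field_derivative cnj (of_real (cmod d)) * (deriv g1 0 / \<alpha>)) (at 0)"
    unfolding \<omega>_def
    by (rule DERIV_chain2[where f = "\<lambda>z. cnj (\<phi> (cnj z))", OF _ dgg]) (unfold g0, rule has_field_derivative_reflect[OF d\<phi>])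
  moreover have "cnj (of_real (cmod d)) * (deriv g1 0 / \<alpha>) = 1"
  proof -
    have "cnj (of_real (cmod d)) = \<alpha> * d" using \<alpha>d by simp
    then have "cnj (of_real (cmod d)) * (deriv g1 0 / \<alpha>) = \<alpha> * d * (deriv g1 0 / \<alpha>)" by (simp only:)
    also have "\<dots> = d * deriv g1 0" using \<alpha>(2) by simp
    finally show ?thesis using dd by (simp only:)
  qed
  ultimately have d\<omega>: "(\<omega> has_field_derivative 1) (at 0)" by (simp only:)
  have \<omega>0: "\<omega> 0 = 0" by (simp add: \<omega>_def g0 \<phi>_def f10)
  have \<omega>b: "cmod (\<omega> w) < 1" if "cmod w < 1" for w
    using \<phi>b(1)[OF complex_nbhd_cnj[OF gb(1)]] that by (simp add: \<omega>_def)
  have "cmod (deriv \<omega> 0) = 1" using DERIV_imp_deriv[OF d\<omega>] by simp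
  then obtain \<beta> where \<beta>: "\<And>z. cmod z < 1 \<Longrightarrow> \<omega> z = \<beta> * z"
    using Schwarz_Lemma(3)[OF hol\<omega> \<omega>0 \<omega>b, of 0] by auto
  have "(\<omega> has_field_derivative \<beta>) (at 0)"
  proof (rule has_field_derivative_transform_within_open[where S = "ball 0 1" and f = "\<lambda>z. \<beta> * z"])
    show "((\<lambda>z. \<beta> * z) has_field_derivative \<beta>) (at 0)" using DERIV_cmult[OF DERIV_ident, of \<beta> 0 UNIV] by simp
  qed (use \<beta> in auto)
  then have "\<beta> = 1" using d\<omega> by (rule DERIV_unique)
  then have \<omega>id: "\<omega> w = w" if "cmod w < 1" for w using \<beta>[OF that] by simp
  have realx: "\<exists>t. \<bar>t\<bar> < 1 \<and> \<phi> (complex_of_real x) = of_real t \<and> g (of_real t) = of_real x" if "x \<in> J" for x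
  proof -
    have xU: "of_real x \<in> ?U" by (rule of_real_in_complex_nbhd[OF that])
    have "\<omega> (\<phi> (of_real x)) = \<phi> (of_real x)" using \<phi>b(1)[OF xU] by (intro \<omega>id) simp
    then have "cnj (\<phi> (of_real x)) = \<phi> (of_real x)" using \<phi>b(2)[OF xU] by (simp add: \<omega>_def)
    then obtain t where t: "\<phi> (of_real x) = of_real t" by (metis Reals_cases Reals_cnj_iff)
    then show ?thesis using \<phi>b[OF xU] by (intro exI[of _ t]) auto
  qed
  have realt: "\<exists>x\<in>J. g (complex_of_real t) = of_real x" if "\<bar>t\<bar> < 1" for t
  proof -
    have tb: "complex_of_real t \<in> ball 0 1" using that by simp
    have "cnj (\<phi> (cnj (g (of_real t)))) = of_real t" using \<omega>id[of "of_real t"] that by (simp add: \<omega>_def)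
    then have "\<phi> (cnj (g (of_real t))) = of_real t" by (metis complex_cnj_cnj complex_cnj_complex_of_real)
    then have "cnj (g (of_real t)) = g (of_real t)"
      using \<phi>b(2)[OF complex_nbhd_cnj[OF gb(1)[OF tb]]] by simp
    then obtain x where x: "g (of_real t) = of_real x" by (metis Reals_cases Reals_cnj_iff)
    then have "x \<in> J" using Re_complex_nbhd[OF gb(1)[OF tb]] by simp
    then show ?thesis using x by blast
  qed
  show ?thesis
    by (intro exI[of _ \<phi>] exI[of _ g]) (use hol\<phi> holg gb(1) realx realt \<phi>b(1) in auto)
qed

section \<open>Scalar extension and pull-back of power series\<close>

lemma scalar_extension:
  fixes h :: "real \<Rightarrow> real" and a :: "real \<Rightarrow> nat \<Rightarrow> real"
  assumes summ: "\<And>x. x \<in> J \<Longrightarrow> summable (\<lambda>n. \<bar>a x n\<bar> * r x ^ n)"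
    and h: "\<And>x y. x \<in> J \<Longrightarrow> \<bar>y - x\<bar> < r x \<Longrightarrow> (\<lambda>n. a x n * (y - x) ^ n) sums h y"
  shows "\<exists>H. H holomorphic_on complex_nbhd J r \<and>
    (\<forall>x\<in>J. \<forall>z\<in>ball (complex_of_real x) (r x). (\<lambda>n. of_real (a x n) * (z - of_real x) ^ n) sums H z)"
proof -
  define Hx where "Hx = (\<lambda>x z. \<Sum>n. complex_of_real (a x n) * (z - of_real x) ^ n)"
  have Hs: "(\<lambda>n. of_real (a x n) * (z - of_real x) ^ n) sums Hx x z"
    if x: "x \<in> J" and z: "z \<in> ball (complex_of_real x) (r x)" for x z
  proof -
    have "cmod (z - of_real x) \<le> r x" using z by (simp add: dist_norm norm_minus_commute)
    then have "norm (of_real (a x n) * (z - of_real x) ^ n) \<le> \<bar>a x n\<bar> * r x ^ n" for n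
      unfolding norm_mult norm_power norm_of_real by (intro mult_left_mono power_mono) auto
    then show ?thesis unfolding Hx_def
      by (intro summable_sums summable_comparison_test'[OF summ[OF x], of 0]) auto
  qed
  have holHx: "Hx x holomorphic_on ball (of_real x) (r x)" if "x \<in> J" for x
    by (rule power_series_holomorphic) (rule Hs[OF that])
  have Hreal: "Hx x (of_real y) = of_real (h y)" if "x \<in> J" "\<bar>y - x\<bar> < r x" for x y
  proof -
    have "(\<lambda>n. complex_of_real (a x n * (y - x) ^ n)) sums of_real (h y)" by (rule sums_of_real[OF h[OF that]])
    moreover have "(\<lambda>n. of_real (a x n) * (complex_of_real y - of_real x) ^ n) sums Hx x (of_real y)"
      by (rule Hs) (use that in \<open>auto simp: dist_norm abs_minus_commute simp flip: of_real_diff\<close>)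
    ultimately show ?thesis by (simp add: sums_iff)
  qed
  \<comment> \<open>Two of the discs meet in a convex set that contains Re z with every z, because
    the centres are real. Both local sums equal h on its real points, and the identity theorem
    applies.\<close>
  have agree: "Hx x z = Hx x' z" if x: "x \<in> J" "x' \<in> J" and z: "z \<in> ball (complex_of_real x) (r x)" "z \<in> ball (complex_of_real x') (r x')" for x x' z
  proof -
    let ?V = "ball (complex_of_real x) (r x) \<inter> ball (complex_of_real x') (r x')"
    define y0 where "y0 = Re z"
    have Rin: "complex_of_real y0 \<in> ball (complex_of_real u) (r u)" if "z \<in> ball (complex_of_real u) (r u)" for u
    proof -
      have "cmod (of_real u - of_real y0) \<le> cmod (of_real u - z)"
        using abs_Re_le_cmod[of "of_real u - z"] by (simp add: y0_def flip: of_real_diff)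
      then show ?thesis using that by (simp add: dist_norm)
    qed
    have y0V: "of_real y0 \<in> ?V" using Rin z by auto
    have openV: "open ?V" by auto
    have "Hx x z - Hx x' z = 0"
    proof (rule analytic_continuation[where f = "\<lambda>w. Hx x w - Hx x' w" and w = z and S = ?V and U = "?V \<inter> \<real>" and \<xi> = "of_real y0"])
      show "(\<lambda>w. Hx x w - Hx x' w) holomorphic_on ?V"
        by (intro holomorphic_intros holomorphic_on_subset[OF holHx[OF x(1)]] holomorphic_on_subset[OF holHx[OF x(2)]]) auto
      show "connected ?V" by (intro convex_connected convex_Int convex_ball)
      show "complex_of_real y0 islimpt ?V \<inter> \<real>"
        unfolding islimpt_approachable
      proof (intro allI impI)
        fix e :: real assume e: "e > 0"
        obtain \<delta> where \<delta>: "\<delta> > 0" "ball (of_real y0) \<delta> \<subseteq> ?V" using openV y0V by (meson open_contains_ball)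
        define y where "y = y0 + min e \<delta> / 2"
        have "dist (complex_of_real y0) (of_real y) = \<bar>y0 - y\<bar>" by (simp add: dist_norm flip: of_real_diff)
        also have "\<dots> = min e \<delta> / 2" using e \<delta>(1) by (simp add: y_def)
        finally have dy: "dist (complex_of_real y0) (of_real y) = min e \<delta> / 2" .
        then have "of_real y \<in> ball (complex_of_real y0) \<delta>" using e \<delta>(1) by simp
        then have "complex_of_real y \<in> ?V" by (rule subsetD[OF \<delta>(2)])
        then have yV: "complex_of_real y \<in> ?V \<inter> \<real>" by (rule IntI[OF _ Reals_of_real])
        moreover have "complex_of_real y \<noteq> complex_of_real y0" using e \<delta>(1) by (simp add: y_def)
        moreover have "dist (complex_of_real y) (of_real y0) < e" using dy e \<delta>(1) by (simp add: dist_commute)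
        ultimately show "\<exists>x'\<in>?V \<inter> \<real>. x' \<noteq> complex_of_real y0 \<and> dist x' (of_real y0) < e"
          by (intro bexI[OF _ yV] conjI)
      qed
      fix w assume w: "w \<in> ?V \<inter> \<real>"
      then obtain y where y: "w = of_real y" by (auto elim: Reals_cases)
      then have "\<bar>y - x\<bar> < r x" "\<bar>y - x'\<bar> < r x'"
        using w by (auto simp: dist_norm abs_minus_commute simp flip: of_real_diff)
      then show "Hx x w - Hx x' w = 0" using Hreal x y by simp
    qed (use openV y0V z in auto)
    then show ?thesis by simp
  qed
  define ch where "ch = (\<lambda>z. SOME x. x \<in> J \<and> z \<in> ball (complex_of_real x) (r x))"
  define H where "H = (\<lambda>z. Hx (ch z) z)"
  have HH: "H z = Hx x z" if "x \<in> J" "z \<in> ball (complex_of_real x) (r x)" for x z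
  proof -
    have "ch z \<in> J \<and> z \<in> ball (complex_of_real (ch z)) (r (ch z))"
      unfolding ch_def by (rule someI[of _ x]) (use that in auto)
    then show ?thesis unfolding H_def using agree that by blast
  qed
  have "H holomorphic_on complex_nbhd J r"
    unfolding complex_nbhd_def
  proof (rule holomorphic_on_UN_open)
    fix x assume x: "x \<in> J"
    show "H holomorphic_on ball (complex_of_real x) (r x)"
      by (rule holomorphic_transform[OF holHx[OF x]]) (rule HH[OF x, symmetric])
  qed auto
  moreover have "(\<lambda>n. of_real (a x n) * (z - of_real x) ^ n) sums H z"
    if "x \<in> J" "z \<in> ball (complex_of_real x) (r x)" for x z
    using Hs[OF that] HH[OF that] by simp
  ultimately show ?thesis by blast
qed

text \<open>A vector-valued f has no values at complex points, so its composition with g is studied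
  through real functionals l. Each l (f x) extends to a scalar holomorphic function whose
  composition with g lives on the whole disc; Cauchy's inequalities, uniform over norm l \<le> 1,
  bound the vector coefficients.\<close>

lemma pull_back_power_series:
  fixes f :: "real \<Rightarrow> 'z::banach" and a :: "real \<Rightarrow> nat \<Rightarrow> 'z"
  assumes g: "g holomorphic_on ball 0 1" "\<And>w. w \<in> ball 0 1 \<Longrightarrow> g w \<in> complex_nbhd J r"
    and \<xi>: "\<And>t. \<bar>t\<bar> < 1 \<Longrightarrow> \<xi> t \<in> J" "\<And>t. \<bar>t\<bar> < 1 \<Longrightarrow> g (complex_of_real t) = of_real (\<xi> t)"
    and summ: "\<And>x. x \<in> J \<Longrightarrow> summable (\<lambda>n. norm (a x n) * r x ^ n)"
    and f: "\<And>x y. x \<in> J \<Longrightarrow> \<bar>y - x\<bar> < r x \<Longrightarrow> (\<lambda>n. (y - x) ^ n *\<^sub>R a x n) sums f y"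
  shows "\<exists>A. (\<forall>s. 0 \<le> s \<longrightarrow> s < 1 \<longrightarrow> summable (\<lambda>n. norm (A n) * s ^ n)) \<and>
    (\<forall>t. \<bar>t\<bar> < 1 \<longrightarrow> (\<lambda>n. t ^ n *\<^sub>R A n) sums f (\<xi> t))"
proof -
  define x0 where "x0 = \<xi> 0"
  have x0: "x0 \<in> J" "g 0 = of_real x0" using \<xi>[of 0] by (auto simp: x0_def)
  define G where "G = fps_expansion (\<lambda>w. g w - g 0) 0"
  have G: "(\<lambda>w. g w - g 0) has_fps_expansion G"
    unfolding G_def by (rule has_fps_expansion_fps_expansion[of "ball 0 1"]) (auto intro!: holomorphic_intros g)
  have G0: "fps_nth G 0 = 0" using has_fps_expansion_imp_0_eq_fps_nth_0[OF G] by simp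
  \<comment> \<open>Formal composition of the expansion of f at x0 with that of g - g 0. The real
    part makes the coefficients of G^i scalars of the real space.\<close>
  define A where "A = (\<lambda>n. \<Sum>i=0..n. Re (fps_nth (G ^ i) n) *\<^sub>R a x0 i)"
  define Mx where "Mx = (\<lambda>x. \<Sum>n. norm (a x n) * r x ^ n)"
  have Mx0: "Mx x \<ge> 0" if "x \<in> J" for x
    unfolding Mx_def using r(1)[OF that] by (intro suminf_nonneg summ that) auto
  have functional: "\<exists>K. K holomorphic_on ball 0 1 \<and> (\<forall>n. Re ((deriv ^^ n) K 0 / fact n) = l (A n)) \<and>
    (\<forall>t. \<bar>t\<bar> < 1 \<longrightarrow> Re (K (of_real t)) = l (f (\<xi> t))) \<and>
    (\<forall>w x. w \<in> ball 0 1 \<longrightarrow> x \<in> J \<longrightarrow> g w \<in> ball (of_real x) (r x) \<longrightarrow> cmod (K w) \<le> norm l * Mx x)"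
    for l :: "'z \<Rightarrow>\<^sub>L real"
  proof -
    have la: "\<bar>l (a x n)\<bar> * r x ^ n \<le> norm l * (norm (a x n) * r x ^ n)" if "x \<in> J" for x n
      using mult_right_mono[OF norm_blinfun[of l "a x n"], of "r x ^ n"] r(1)[OF that] by (simp add: mult.assoc)
    have ls: "summable (\<lambda>n. \<bar>l (a x n)\<bar> * r x ^ n)" if x: "x \<in> J" for x
    proof (rule summable_comparison_test'[OF summable_mult[OF summ[OF x], of "norm l"], of 0])
      fix n
      show "norm (\<bar>l (a x n)\<bar> * r x ^ n) \<le> norm l * (norm (a x n) * r x ^ n)"
        using la[OF x, of n] r(1)[OF x] by simp
    qed
    have lf: "(\<lambda>n. l (a x n) * (y - x) ^ n) sums l (f y)" if "x \<in> J" "\<bar>y - x\<bar> < r x" for x y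
      using bounded_linear.sums[OF blinfun.bounded_linear_right[of l] f[OF that]]
      by (simp add: blinfun.scaleR_right mult.commute)
    obtain H where H: "H holomorphic_on complex_nbhd J r"
      "\<And>x z. x \<in> J \<Longrightarrow> z \<in> ball (complex_of_real x) (r x) \<Longrightarrow> (\<lambda>n. of_real (l (a x n)) * (z - of_real x) ^ n) sums H z"
      using scalar_extension[of "\<lambda>x n. l (a x n)" "\<lambda>y. l (f y)", OF ls lf] by blast
    have Hb: "cmod (H z) \<le> norm l * Mx x" if x: "x \<in> J" and z: "z \<in> ball (complex_of_real x) (r x)" for x z
    proof -
      have zr: "cmod (z - of_real x) \<le> r x" using z by (simp add: dist_norm norm_minus_commute)
      have le: "cmod (of_real (l (a x n)) * (z - of_real x) ^ n) \<le> norm l * (norm (a x n) * r x ^ n)" for n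
      proof -
        have "cmod (of_real (l (a x n)) * (z - of_real x) ^ n) \<le> \<bar>l (a x n)\<bar> * r x ^ n"
          unfolding norm_mult norm_power norm_of_real by (intro mult_left_mono power_mono zr) auto
        then show ?thesis using la[OF x, of n] by linarith
      qed
      note sm = summable_mult[OF summ[OF x], of "norm l"]
      have sn: "summable (\<lambda>n. cmod (of_real (l (a x n)) * (z - of_real x) ^ n))"
        by (rule summable_comparison_test'[OF sm, of 0]) (use le in simp)
      have "cmod (H z) \<le> (\<Sum>n. cmod (of_real (l (a x n)) * (z - of_real x) ^ n))"
        using summable_norm[OF sn] sums_unique[OF H(2)[OF x z]] by simp
      also have "\<dots> \<le> (\<Sum>n. norm l * (norm (a x n) * r x ^ n))" by (rule suminf_le[OF le sn sm])
      also have "\<dots> = norm l * Mx x" unfolding Mx_def by (rule suminf_mult[OF summ[OF x]])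
      finally show ?thesis .
    qed
    define K where "K = (\<lambda>w. H (g w))"
    define F where "F = Abs_fps (\<lambda>i. complex_of_real (l (a x0 i)))"
    have "(\<lambda>z. H (g 0 + z)) has_fps_expansion F"
    proof (rule has_fps_expansionI)
      have "\<forall>\<^sub>F z in nhds 0. z \<in> ball (0 :: complex) (r x0)"
        by (rule eventually_nhds_in_open) (use r(1)[OF x0(1)] in auto)
      then show "\<forall>\<^sub>F z in nhds 0. (\<lambda>n. fps_nth F n * z ^ n) sums H (g 0 + z)"
      proof eventually_elim
        case (elim z)
        then show ?case using H(2)[OF x0(1), of "g 0 + z"] by (simp add: F_def x0(2) dist_norm)
      qed
    qed
    from has_fps_expansion_compose[OF this G G0]
    have Kexp: "K has_fps_expansion fps_compose F G" by (simp add: K_def o_def)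
    have holK: "K holomorphic_on ball 0 1" unfolding K_def
      using holomorphic_on_compose_gen[OF g(1) H(1) image_subsetI[OF g(2)]] by (simp add: o_def)
    have "(deriv ^^ n) K 0 / fact n = fps_nth (fps_compose F G) n" for n
      using fps_expansion_eqI[OF Kexp] by (auto simp: fps_expansion_def fps_eq_iff)
    moreover have "Re (fps_nth (fps_compose F G) n) = l (A n)" for n
      by (simp add: fps_compose_nth F_def A_def blinfun.sum_right blinfun.scaleR_right mult.commute)
    ultimately have coeff: "Re ((deriv ^^ n) K 0 / fact n) = l (A n)" for n by simp
    have "Re (K (of_real t)) = l (f (\<xi> t))" if t: "\<bar>t\<bar> < 1" for t
    proof -
      have "(\<lambda>n. of_real (l (a (\<xi> t) n)) * (of_real (\<xi> t) - of_real (\<xi> t)) ^ n) sums H (complex_of_real (\<xi> t))"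
        by (rule H(2)[OF \<xi>(1)[OF t]]) (use r(1)[OF \<xi>(1)[OF t]] in simp)
      moreover have "(\<lambda>n. complex_of_real (l (a (\<xi> t) n) * (\<xi> t - \<xi> t) ^ n)) sums of_real (l (f (\<xi> t)))"
        by (rule sums_of_real[OF lf[OF \<xi>(1)[OF t]]]) (use r(1)[OF \<xi>(1)[OF t]] in simp)
      ultimately have "H (complex_of_real (\<xi> t)) = of_real (l (f (\<xi> t)))" by (simp add: sums_iff)
      then show ?thesis by (simp add: K_def \<xi>(2)[OF t])
    qed
    moreover have "cmod (K w) \<le> norm l * Mx x" if "x \<in> J" "g w \<in> ball (of_real x) (r x)" for w x
      unfolding K_def by (rule Hb[OF that])
    ultimately show ?thesis using holK coeff by blast
  qed
  have Abound: "\<exists>C. \<forall>n. norm (A n) * s ^ n \<le> C" if s: "0 < s" "s < 1" for s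
  proof -
    \<comment> \<open>Finitely many of the discs cover the image of the closed disc of radius s, so
      the sum of their majorants is a bound that is the same for all l with norm l \<le> 1.\<close>
    have "compact (g ` cball 0 s)"
      using s by (intro compact_continuous_image holomorphic_on_imp_continuous_on holomorphic_on_subset[OF g(1)]) auto
    moreover have "g ` cball 0 s \<subseteq> (\<Union>x\<in>J. ball (complex_of_real x) (r x))"
      using g(2) s unfolding complex_nbhd_def by fastforce
    ultimately obtain D where D: "D \<subseteq> J" "finite D" "g ` cball 0 s \<subseteq> (\<Union>x\<in>D. ball (complex_of_real x) (r x))"
      by (elim compactE_image) auto
    have "norm (A n) \<le> (\<Sum>x\<in>D. Mx x) / s ^ n" for n
    proof (rule norm_le_if_functionals_le)
      fix l :: "'z \<Rightarrow>\<^sub>L real" assume l: "norm l \<le> 1"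
      obtain K where K: "K holomorphic_on ball 0 1" "\<And>n. Re ((deriv ^^ n) K 0 / fact n) = l (A n)"
        "\<And>w x. w \<in> ball 0 1 \<Longrightarrow> x \<in> J \<Longrightarrow> g w \<in> ball (of_real x) (r x) \<Longrightarrow> cmod (K w) \<le> norm l * Mx x"
        using functional[of l] by blast
      have "cmod ((deriv ^^ n) K 0 / fact n) * s ^ n \<le> (\<Sum>x\<in>D. Mx x)"
      proof (rule taylor_coeff_bound[OF K(1) s])
        fix w :: complex assume w: "dist 0 w = s"
        then have "g w \<in> g ` cball 0 s" by auto
        then obtain x where x: "x \<in> D" "g w \<in> ball (complex_of_real x) (r x)" using D(3) by blast
        then have xJ: "x \<in> J" using D(1) by blast
        have "cmod (K w) \<le> norm l * Mx x" by (rule K(3)[OF _ xJ x(2)]) (use w s in auto)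
        also have "\<dots> \<le> 1 * Mx x" using l Mx0[OF xJ] by (intro mult_right_mono) auto
        also have "\<dots> \<le> (\<Sum>x\<in>D. Mx x)" using x(1) D(1,2) by (auto intro!: member_le_sum Mx0)
        finally show "cmod (K w) \<le> (\<Sum>x\<in>D. Mx x)" .
      qed
      moreover have "\<bar>l (A n)\<bar> \<le> cmod ((deriv ^^ n) K 0 / fact n)"
        using abs_Re_le_cmod[of "(deriv ^^ n) K 0 / fact n"] by (simp only: K(2))
      then have "\<bar>l (A n)\<bar> * s ^ n \<le> cmod ((deriv ^^ n) K 0 / fact n) * s ^ n"
        by (rule mult_right_mono) (use s in simp)
      ultimately have "\<bar>l (A n)\<bar> * s ^ n \<le> (\<Sum>x\<in>D. Mx x)" by (rule order_trans[rotated])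
      then show "\<bar>blinfun_apply l (A n)\<bar> \<le> (\<Sum>x\<in>D. Mx x) / s ^ n" using s by (simp add: pos_le_divide_eq)
    qed
    then have "\<forall>n. norm (A n) * s ^ n \<le> (\<Sum>x\<in>D. Mx x)" using s by (simp add: pos_le_divide_eq)
    then show ?thesis by blast
  qed
  have summA: "summable (\<lambda>n. norm (A n) * s ^ n)" if s: "0 \<le> s" "s < 1" for s
  proof -
    obtain s' where s': "s < s'" "s' < 1" using dense[OF s(2)] by blast
    then have s'0: "s' > 0" using s by simp
    obtain C where C: "\<And>n. norm (A n) * s' ^ n \<le> C" using Abound[OF s'0 s'(2)] by blast
    have "summable (\<lambda>n. C * (s / s') ^ n)"
      using s s' s'0 by (intro summable_mult summable_geometric) (simp add: divide_less_eq)
    then show ?thesis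
    proof (rule summable_comparison_test'[of _ 0])
      fix n
      have "norm (A n) * s ^ n = (norm (A n) * s' ^ n) * (s / s') ^ n" using s'0 by (simp add: power_divide)
      also have "\<dots> \<le> C * (s / s') ^ n" using s s'0 by (intro mult_right_mono C) auto
      finally show "norm (norm (A n) * s ^ n) \<le> C * (s / s') ^ n" using s by simp
    qed
  qed
  have "(\<lambda>n. t ^ n *\<^sub>R A n) sums f (\<xi> t)" if t: "\<bar>t\<bar> < 1" for t
  proof -
    have "summable (\<lambda>n. norm (t ^ n *\<^sub>R A n))"
      using summA[of "\<bar>t\<bar>"] t by (simp add: power_abs mult.commute)
    from summable_norm_cancel[OF this] obtain B where B: "(\<lambda>n. t ^ n *\<^sub>R A n) sums B"
      unfolding summable_def by blast
    \<comment> \<open>The sum is identified by testing with functionals, since only the scalar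
      compositions are known to equal their Taylor series.\<close>
    have "B = f (\<xi> t)"
    proof (rule eq_if_functionals_agree)
      fix l :: "'z \<Rightarrow>\<^sub>L real"
      obtain K where K: "K holomorphic_on ball 0 1" "\<And>n. Re ((deriv ^^ n) K 0 / fact n) = l (A n)"
        "\<And>t. \<bar>t\<bar> < 1 \<Longrightarrow> Re (K (of_real t)) = l (f (\<xi> t))"
        using functional[of l] by blast
      have "(\<lambda>n. (deriv ^^ n) K 0 / fact n * (of_real t - 0) ^ n) sums K (of_real t)"
        by (rule holomorphic_power_series[OF K(1)]) (use t in simp)
      from sums_Re[OF this] have "(\<lambda>n. Re ((deriv ^^ n) K 0 / fact n * (of_real t - 0) ^ n)) sums l (f (\<xi> t))"
        by (simp only: K(3)[OF t])
      moreover have "Re ((deriv ^^ n) K 0 / fact n * (of_real t - 0) ^ n) = l (t ^ n *\<^sub>R A n)" for n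
      proof -
        have "Re (c * (of_real t - 0) ^ n) = t ^ n *\<^sub>R Re c" for c by (simp flip: of_real_power)
        then show ?thesis by (simp only: K(2) blinfun.scaleR_right)
      qed
      ultimately have "(\<lambda>n. l (t ^ n *\<^sub>R A n)) sums l (f (\<xi> t))" by simp
      moreover have "(\<lambda>n. l (t ^ n *\<^sub>R A n)) sums l B"
        by (rule bounded_linear.sums[OF blinfun.bounded_linear_right B])
      ultimately show "l B = l (f (\<xi> t))" by (rule sums_unique2[symmetric])
    qed
    with B show ?thesis by simp
  qed
  with summA show ?thesis by blast
qed

end

section \<open>Lifting analytic maps\<close>

lemma pseries_coefficients:
  assumes "\<And>l. l \<in> J \<Longrightarrow> \<exists>M. pseries f l (r l) M"
  obtains a where "\<And>l. l \<in> J \<Longrightarrow> summable (\<lambda>n. norm (a l n) * r l ^ n)"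
    "\<And>l u. l \<in> J \<Longrightarrow> \<bar>u - l\<bar> < r l \<Longrightarrow> (\<lambda>n. (u - l) ^ n *\<^sub>R a l n) sums f u"
proof -
  have "\<exists>a. summable (\<lambda>n. norm (a n) * r l ^ n) \<and> (\<forall>u. \<bar>u - l\<bar> < r l \<longrightarrow> (\<lambda>n. (u - l) ^ n *\<^sub>R a n) sums f u)"
    if "l \<in> J" for l using assms[OF that] unfolding pseries_def by blast
  then show ?thesis using that by metis
qed

text \<open>The data are pulled back to the disc along g, lifted there, and the lift is returned
  along \<phi>. The return only composes the scalar functions \<Theta> with \<phi>, the vectors
  being fixed.\<close>

lemma analytic_lift_on_interval:
  fixes T :: "real \<Rightarrow> 'x::banach \<Rightarrow>\<^sub>L 'y::banach" and y :: "real \<Rightarrow> 'y"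
  assumes J: "open J" "connected J" "J \<noteq> {}"
    and T: "real_analytic_on T J" and y: "real_analytic_on y J"
    and surj: "\<And>l. l \<in> J \<Longrightarrow> surj (blinfun_apply (T l))"
  shows "\<exists>x. real_analytic_on x J \<and> (\<forall>l\<in>J. T l (x l) = y l)"
proof -
  have "\<exists>\<rho>. 0 < \<rho> \<and> \<rho> \<le> 1 \<and> (\<forall>u. \<bar>u - l\<bar> < \<rho> \<longrightarrow> u \<in> J) \<and> (\<exists>M. pseries T l \<rho> M) \<and> (\<exists>M. pseries y l \<rho> M)"
    if l: "l \<in> J" for l
  proof -
    obtain \<rho>1 M1 where 1: "pseries T l \<rho>1 M1" using T l unfolding real_analytic_on_iff_pser[OF J(1)] by blast
    obtain \<rho>2 M2 where 2: "pseries y l \<rho>2 M2" using y l unfolding real_analytic_on_iff_pser[OF J(1)] by blast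
    obtain d where d: "d > 0" "\<And>u. \<bar>u - l\<bar> < d \<Longrightarrow> u \<in> J"
      using J(1) l unfolding open_dist dist_real_def by blast
    have pos: "\<rho>1 > 0" "\<rho>2 > 0" using 1 2 by (auto elim: pseriesE)
    define \<rho> where "\<rho> = min (min \<rho>1 \<rho>2) (min d 1)"
    have \<rho>: "0 < \<rho>" "\<rho> \<le> \<rho>1" "\<rho> \<le> \<rho>2" "\<rho> \<le> d" "\<rho> \<le> 1" using pos d(1) by (auto simp: \<rho>_def)
    have "pseries T l \<rho> M1" "pseries y l \<rho> M2"
      using pseries_radius_mono[OF 1 \<rho>(1,2)] pseries_radius_mono[OF 2 \<rho>(1,3)] .
    moreover have "\<forall>u. \<bar>u - l\<bar> < \<rho> \<longrightarrow> u \<in> J" using d(2) \<rho>(4) by auto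
    ultimately show ?thesis using \<rho>(1,5) by blast
  qed
  then obtain r where r: "\<And>l. l \<in> J \<Longrightarrow> 0 < r l" "\<And>l. l \<in> J \<Longrightarrow> r l \<le> 1"
    "\<And>l u. l \<in> J \<Longrightarrow> \<bar>u - l\<bar> < r l \<Longrightarrow> u \<in> J"
    and rT: "\<And>l. l \<in> J \<Longrightarrow> \<exists>M. pseries T l (r l) M" and ry: "\<And>l. l \<in> J \<Longrightarrow> \<exists>M. pseries y l (r l) M" by metis
  obtain aT where aT: "\<And>l. l \<in> J \<Longrightarrow> summable (\<lambda>n. norm (aT l n) * r l ^ n)"
    "\<And>l u. l \<in> J \<Longrightarrow> \<bar>u - l\<bar> < r l \<Longrightarrow> (\<lambda>n. (u - l) ^ n *\<^sub>R aT l n) sums T u"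
    by (rule pseries_coefficients[of J T r, OF rT], assumption) (rule that)
  obtain ay where ay: "\<And>l. l \<in> J \<Longrightarrow> summable (\<lambda>n. norm (ay l n) * r l ^ n)"
    "\<And>l u. l \<in> J \<Longrightarrow> \<bar>u - l\<bar> < r l \<Longrightarrow> (\<lambda>n. (u - l) ^ n *\<^sub>R ay l n) sums y u"
    by (rule pseries_coefficients[of J y r, OF ry], assumption) (rule that)
  interpret nb: interval_radius J r using J r by unfold_locales blast+
  let ?U = "complex_nbhd J r"
  obtain \<phi> g where \<phi>: "\<phi> holomorphic_on ?U" and g: "g holomorphic_on ball 0 1" "\<And>w. w \<in> ball 0 1 \<Longrightarrow> g w \<in> ?U"
    and \<phi>J: "\<And>x. x \<in> J \<Longrightarrow> \<exists>t. \<bar>t\<bar> < 1 \<and> \<phi> (complex_of_real x) = of_real t \<and> g (of_real t) = of_real x"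
    and gt: "\<And>t. \<bar>t\<bar> < 1 \<Longrightarrow> \<exists>x\<in>J. g (complex_of_real t) = of_real x"
    using nb.symmetric_riemann_map by blast
  obtain \<xi> where \<xi>: "\<And>t. \<bar>t\<bar> < 1 \<Longrightarrow> \<xi> t \<in> J" "\<And>t. \<bar>t\<bar> < 1 \<Longrightarrow> g (complex_of_real t) = of_real (\<xi> t)"
    using gt by metis
  obtain AT where AT: "\<And>s. 0 \<le> s \<Longrightarrow> s < 1 \<Longrightarrow> summable (\<lambda>n. norm (AT n) * s ^ n)"
    "\<And>t. \<bar>t\<bar> < 1 \<Longrightarrow> (\<lambda>n. t ^ n *\<^sub>R AT n) sums T (\<xi> t)"
    using nb.pull_back_power_series[of g \<xi> aT T] g \<xi> aT by blast
  obtain Ay where Ay: "\<And>s. 0 \<le> s \<Longrightarrow> s < 1 \<Longrightarrow> summable (\<lambda>n. norm (Ay n) * s ^ n)"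
    "\<And>t. \<bar>t\<bar> < 1 \<Longrightarrow> (\<lambda>n. t ^ n *\<^sub>R Ay n) sums y (\<xi> t)"
    using nb.pull_back_power_series[of g \<xi> ay y] g \<xi> ay by blast
  interpret disc_family AT "\<lambda>t. T (\<xi> t)" by unfold_locales (use AT in auto)
  have sj: "surj (blinfun_apply (T (\<xi> t)))" if "\<bar>t\<bar> < 1" for t by (rule surj[OF \<xi>(1)[OF that]])
  have "\<exists>(W :: ((nat \<times> ((nat \<times> real) \<times> nat) list) \<times> (nat \<times> real)) set) \<Theta> v. locally_nuclear W \<Theta> v \<and>
    (\<forall>t. \<bar>t\<bar> < 1 \<longrightarrow> T (\<xi> t) (\<Sum>\<^sub>\<infinity>w\<in>W. Re (\<Theta> w (of_real t)) *\<^sub>R v w) = (\<Sum>n. t ^ n *\<^sub>R Ay n))"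
    by (rule disc_lift) (fact sj Ay(1))+
  then obtain W :: "((nat \<times> ((nat \<times> real) \<times> nat) list) \<times> (nat \<times> real)) set" and \<Theta> v where
    nuc: "locally_nuclear W \<Theta> v" and
    lift: "\<And>t. \<bar>t\<bar> < 1 \<Longrightarrow> T (\<xi> t) (\<Sum>\<^sub>\<infinity>w\<in>W. Re (\<Theta> w (of_real t)) *\<^sub>R v w) = (\<Sum>n. t ^ n *\<^sub>R Ay n)"
    by blast
  have hol: "\<And>w. w \<in> W \<Longrightarrow> \<Theta> w holomorphic_on ball 0 1"
    and bound: "\<And>t. \<bar>t\<bar> < 1 \<Longrightarrow> \<exists>\<rho>>0. \<exists>K. ball (complex_of_real t) \<rho> \<subseteq> ball 0 1 \<and>
      (\<forall>z\<in>ball (complex_of_real t) \<rho>. \<forall>X. finite X \<longrightarrow> X \<subseteq> W \<longrightarrow> (\<Sum>w\<in>X. cmod (\<Theta> w z) * norm (v w)) \<le> K)"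
    using nuc unfolding locally_nuclear_def by blast+
  define x where "x = (\<lambda>l. \<Sum>\<^sub>\<infinity>w\<in>W. Re (\<Theta> w (\<phi> (of_real l))) *\<^sub>R v w)"
  have "T l (x l) = y l" if l: "l \<in> J" for l
  proof -
    obtain t where t: "\<bar>t\<bar> < 1" "\<phi> (complex_of_real l) = of_real t" "g (of_real t) = of_real l" using \<phi>J[OF l] by blast
    then have "\<xi> t = l" using \<xi>(2)[OF t(1)] by simp
    then show ?thesis using lift[OF t(1)] Ay(2)[OF t(1)] t(2) by (simp add: x_def sums_iff)
  qed
  moreover have "real_analytic_on x J"
    unfolding real_analytic_on_iff_pser[OF J(1)]
  proof
    fix l assume l: "l \<in> J"
    obtain t where t: "\<bar>t\<bar> < 1" "\<phi> (complex_of_real l) = of_real t" using \<phi>J[OF l] by blast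
    obtain \<rho> K where \<rho>: "\<rho> > 0" "ball (complex_of_real t) \<rho> \<subseteq> ball 0 1"
      and K: "\<forall>z\<in>ball (complex_of_real t) \<rho>. \<forall>X. finite X \<longrightarrow> X \<subseteq> W \<longrightarrow> (\<Sum>w\<in>X. cmod (\<Theta> w z) * norm (v w)) \<le> K"
      using bound[OF t(1)] by blast
    have openU: "open ?U" by (auto simp: complex_nbhd_def)
    have "open (?U \<inter> \<phi> -` ball (of_real t) \<rho>)"
      by (rule continuous_open_preimage[OF holomorphic_on_imp_continuous_on[OF \<phi>] openU open_ball])
    moreover have "of_real l \<in> ?U \<inter> \<phi> -` ball (of_real t) \<rho>"
      using t(2) \<rho>(1) nb.of_real_in_complex_nbhd[OF l] by simp
    ultimately obtain \<delta> where \<delta>: "\<delta> > 0" "ball (of_real l) \<delta> \<subseteq> ?U \<inter> \<phi> -` ball (of_real t) \<rho>"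
      by (meson open_contains_ball)
    have "\<exists>\<delta> K. pseries (\<lambda>l. \<Sum>\<^sub>\<infinity>w\<in>W. Re (\<Theta> w (\<phi> (of_real l))) *\<^sub>R v w) l \<delta> K"
    proof (rule pseries_nuclear[OF \<delta>(1), where \<phi> = "\<lambda>w z. \<Theta> w (\<phi> z)"])
      fix w assume w: "w \<in> W"
      have "\<phi> holomorphic_on ball (of_real l) \<delta>" using \<delta>(2) by (intro holomorphic_on_subset[OF \<phi>]) auto
      moreover have "\<phi> ` ball (of_real l) \<delta> \<subseteq> ball 0 1" using \<delta>(2) \<rho>(2) by blast
      ultimately show "(\<lambda>z. \<Theta> w (\<phi> z)) holomorphic_on ball (of_real l) \<delta>"
        using holomorphic_on_compose_gen[OF _ hol[OF w]] by (simp add: o_def)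
    next
      fix X and z :: complex assume X: "finite X" "X \<subseteq> W" and z: "z \<in> ball (of_real l) \<delta>"
      then have "\<phi> z \<in> ball (of_real t) \<rho>" using \<delta>(2) by blast
      then show "(\<Sum>i\<in>X. cmod (\<Theta> i (\<phi> z)) * norm (v i)) \<le> K" using K X by (meson)
    qed
    then show "\<exists>\<rho> M. pseries x l \<rho> M" by (simp add: x_def[abs_def])
  qed
  ultimately show ?thesis by blast
qed

theorem analytic_lift:
  fixes T :: "real \<Rightarrow> 'x::banach \<Rightarrow>\<^sub>L 'y::banach" and y :: "real \<Rightarrow> 'y"
  assumes G: "open G" and T: "real_analytic_on T G" and y: "real_analytic_on y G"
    and surj: "\<And>l. l \<in> G \<Longrightarrow> surj (blinfun_apply (T l))"
  shows "\<exists>x. real_analytic_on x G \<and> (\<forall>l\<in>G. T l (x l) = y l)"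
proof -
  define C where "C = connected_component_set G"
  have C: "open (C l)" "connected (C l)" "C l \<subseteq> G" for l
    unfolding C_def using G by (auto simp: open_connected_component connected_component_subset)
  have lC: "l \<in> C l" if "l \<in> G" for l unfolding C_def using that by simp
  have "\<exists>x. real_analytic_on x (C l) \<and> (\<forall>u\<in>C l. T u (x u) = y u)" if l: "l \<in> G" for l
  proof (rule analytic_lift_on_interval)
    show "C l \<noteq> {}" using lC[OF l] by blast
    show "real_analytic_on T (C l)" "real_analytic_on y (C l)"
      using T y C(3) unfolding real_analytic_on_def by (meson subsetD)+
    show "surj (blinfun_apply (T u))" if "u \<in> C l" for u using surj C(3) that by blast
  qed (rule C)+
  \<comment> \<open>The choice is made once per component and not per point, so that x agrees with a
    single analytic map on each component.\<close>
  then have "\<forall>D\<in>C ` G. \<exists>x. real_analytic_on x D \<and> (\<forall>u\<in>D. T u (x u) = y u)" by blast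
  then obtain X where X: "\<And>D. D \<in> C ` G \<Longrightarrow> real_analytic_on (X D) D" "\<And>D u. D \<in> C ` G \<Longrightarrow> u \<in> D \<Longrightarrow> T u (X D u) = y u"
    by metis
  define x where "x = (\<lambda>l. X (C l) l)"
  have "T l (x l) = y l" if "l \<in> G" for l unfolding x_def by (rule X(2)) (use that lC in auto)
  moreover have "real_analytic_on x G"
    unfolding real_analytic_on_iff_pser[OF G]
  proof
    fix l assume l: "l \<in> G"
    have "real_analytic_on (X (C l)) (C l)" using l by (intro X(1)) auto
    then obtain \<rho> M where p: "pseries (X (C l)) l \<rho> M"
      unfolding real_analytic_on_iff_pser[OF C(1)] using lC[OF l] by blast
    obtain d where d: "d > 0" "\<And>u. \<bar>u - l\<bar> < d \<Longrightarrow> u \<in> C l"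
      using C(1)[of l] lC[OF l] unfolding open_dist dist_real_def by blast
    have \<rho>: "\<rho> > 0" using p by (rule pseriesE)
    have "pseries (X (C l)) l (min \<rho> d) M" by (rule pseries_radius_mono[OF p]) (use \<rho> d in auto)
    then have "pseries x l (min \<rho> d) M"
    proof (rule pseries_cong)
      fix u assume "\<bar>u - l\<bar> < min \<rho> d"
      then have "u \<in> C l" using d(2) by simp
      then have "C u = C l" unfolding C_def by (simp add: connected_component_eq)
      then show "X (C l) u = x u" by (simp add: x_def)
    qed
    then show "\<exists>\<rho> M. pseries x l \<rho> M" by blast
  qed
  ultimately show ?thesis by blast
qed

section \<open>Orthogonal idempotents\<close>

context
  fixes G :: "real set"
  assumes G: "open G"
begin

lemma real_analytic_on_const: "real_analytic_on (\<lambda>_. c) G"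
  unfolding real_analytic_on_iff_pser[OF G] using pseries_const[of 1 c] by (auto intro!: exI)

lemma real_analytic_on_common_radius:
  assumes "real_analytic_on f G" "real_analytic_on g G" "x0 \<in> G"
  obtains r M N where "pseries f x0 r M" "pseries g x0 r N"
proof -
  obtain \<rho>1 M1 where 1: "pseries f x0 \<rho>1 M1" using assms unfolding real_analytic_on_iff_pser[OF G] by blast
  obtain \<rho>2 M2 where 2: "pseries g x0 \<rho>2 M2" using assms unfolding real_analytic_on_iff_pser[OF G] by blast
  have "\<rho>1 > 0" "\<rho>2 > 0" using 1 2 by (auto elim: pseriesE)
  then show ?thesis
    using that[of "min \<rho>1 \<rho>2" M1 M2] pseries_radius_mono[OF 1, of "min \<rho>1 \<rho>2"] pseries_radius_mono[OF 2, of "min \<rho>1 \<rho>2"]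
    by auto
qed

lemma real_analytic_on_add:
  assumes "real_analytic_on f G" "real_analytic_on g G"
  shows "real_analytic_on (\<lambda>x. f x + g x) G"
  unfolding real_analytic_on_iff_pser[OF G]
proof
  fix x0 assume "x0 \<in> G"
  then obtain r M N where "pseries f x0 r M" "pseries g x0 r N" using real_analytic_on_common_radius[OF assms] by blast
  then show "\<exists>\<rho> M. pseries (\<lambda>x. f x + g x) x0 \<rho> M" using pseries_add by blast
qed

lemma real_analytic_on_mult:
  fixes f g :: "real \<Rightarrow> 'a::{real_normed_algebra,banach}"
  assumes "real_analytic_on f G" "real_analytic_on g G"
  shows "real_analytic_on (\<lambda>x. f x * g x) G"
  unfolding real_analytic_on_iff_pser[OF G]
proof
  fix x0 assume "x0 \<in> G"
  then obtain r M N where "pseries f x0 r M" "pseries g x0 r N" using real_analytic_on_common_radius[OF assms] by blast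
  then show "\<exists>\<rho> M. pseries (\<lambda>x. f x * g x) x0 \<rho> M" using pseries_mult by blast
qed

lemma real_analytic_on_linear:
  assumes "real_analytic_on f G" "bounded_linear h"
  shows "real_analytic_on (\<lambda>x. h (f x)) G"
  unfolding real_analytic_on_iff_pser[OF G]
proof
  fix x0 assume "x0 \<in> G"
  then obtain r M where "pseries f x0 r M" using assms(1) unfolding real_analytic_on_iff_pser[OF G] by blast
  moreover obtain K where "K \<ge> 0" "\<And>v. norm (h v) \<le> K * norm v"
    using bounded_linear.nonneg_bounded[OF assms(2)] by (auto simp: mult.commute)
  ultimately have "pseries (\<lambda>x. h (f x)) x0 r (K * M)" using pseries_linear[OF _ assms(2)] by blast
  then show "\<exists>\<rho> M. pseries (\<lambda>x. h (f x)) x0 \<rho> M" by blast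
qed

lemma real_analytic_on_diff:
  assumes "real_analytic_on f G" "real_analytic_on g G"
  shows "real_analytic_on (\<lambda>x. f x - g x) G"
  using real_analytic_on_add[OF assms(1) real_analytic_on_linear[OF assms(2) bounded_linear_minus[OF bounded_linear_ident]]]
  by simp

lemma real_analytic_on_sum:
  assumes "\<And>i. i \<in> K \<Longrightarrow> real_analytic_on (f i) G"
  shows "real_analytic_on (\<lambda>x. \<Sum>i\<in>K. f i x) G"
  using assms
  by (induction K rule: infinite_finite_induct) (auto intro: real_analytic_on_const real_analytic_on_add)

end

section \<open>Involutions as bounded real-linear maps\<close>

lemma bounded_linear_if_continuous:
  fixes h :: "'a::real_normed_vector \<Rightarrow> 'b::real_normed_vector"
  assumes add: "\<And>x y. h (x + y) = h x + h y" and hom: "\<And>r x. h (r *\<^sub>R x) = r *\<^sub>R h x"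
    and cont: "continuous_on UNIV h"
  shows "bounded_linear h"
proof -
  have h0: "h 0 = 0" using hom[of 0 0] by simp
  obtain d where d: "d > 0" "\<And>x. norm x < d \<Longrightarrow> norm (h x) < 1"
    using cont[unfolded continuous_on_iff, rule_format, of 0 1] by (auto simp: h0)
  have "norm (h x) \<le> norm x * (2 / d)" for x
  proof (cases "x = 0")
    case True then show ?thesis by (simp add: h0)
  next
    case False
    define c where "c = d / (2 * norm x)"
    have c: "c > 0" using d False by (simp add: c_def)
    have "norm (h (c *\<^sub>R x)) < 1" by (rule d(2)) (use d(1) False in \<open>simp add: c_def\<close>)
    then have "c * norm (h x) < 1" using c by (simp add: hom)
    then have "norm (h x) < 1 / c" using c by (simp add: pos_less_divide_eq mult.commute)
    also have "1 / c = norm x * (2 / d)" by (simp add: c_def)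
    finally show ?thesis by simp
  qed
  then show ?thesis using add hom by (intro bounded_linear_intro)
qed

lemma bounded_linear_involution:
  assumes "continuous_involution star"
  shows "bounded_linear star"
proof (rule bounded_linear_if_continuous)
  show "star (r *\<^sub>R x) = r *\<^sub>R star x" for r x
    using assms by (simp add: continuous_involution_def scaleR_scaleC)
qed (use assms in \<open>auto simp: continuous_involution_def\<close>)

lemma involution_one:
  assumes "continuous_involution star"
  shows "star 1 = 1"
proof -
  have s: "star (star x) = x" "star (x * y) = star y * star x" for x y
    using assms by (auto simp: continuous_involution_def)
  show ?thesis using s(2)[of "star 1" 1] s(1)[of 1] by simp
qed

text \<open>Compressing a self-adjoint lift to the complement of the sum of the earlier idempotents and
  then applying the power series for the idempotent keeps it orthogonal to them.\<close>
lemma lift_orthogonal_idempotent: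
  fixes \<pi> :: "real \<Rightarrow> 'a::complex_banach_algebra_1 \<Rightarrow>\<^sub>L 'b::complex_banach_algebra_1"
  assumes G: "open G" and starA: "continuous_involution starA" and starB: "continuous_involution starB"
    and \<pi>: "real_analytic_on \<pi> G"
    and hom: "\<And>l. l \<in> G \<Longrightarrow> star_homomorphism starA starB (blinfun_apply (\<pi> l))"
    and surj: "\<And>l. l \<in> G \<Longrightarrow> surj (blinfun_apply (\<pi> l))"
    and ker: "\<And>l x. l \<in> G \<Longrightarrow> blinfun_apply (\<pi> l) x = 0 \<Longrightarrow> spectrum x = {0}"
    and K: "finite K"
    and p: "\<And>j. j \<in> K \<Longrightarrow> real_analytic_on (p j) G"
      "\<And>j l. j \<in> K \<Longrightarrow> l \<in> G \<Longrightarrow> p j l \<in> selfadjoint_idempotents starA"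
      "\<And>j k l. j \<in> K \<Longrightarrow> k \<in> K \<Longrightarrow> j \<noteq> k \<Longrightarrow> l \<in> G \<Longrightarrow> p j l * p k l = 0"
    and q: "real_analytic_on q G" "\<And>l. l \<in> G \<Longrightarrow> q l \<in> selfadjoint_idempotents starB"
      "\<And>j l. j \<in> K \<Longrightarrow> l \<in> G \<Longrightarrow> \<pi> l (p j l) * q l = 0 \<and> q l * \<pi> l (p j l) = 0"
  shows "\<exists>p'. real_analytic_on p' G \<and> (\<forall>l\<in>G. p' l \<in> selfadjoint_idempotents starA \<and> \<pi> l (p' l) = q l \<and>
    (\<forall>j\<in>K. p j l * p' l = 0 \<and> p' l * p j l = 0))"
proof -
  have star: "starA (starA x) = x" "starA (x + y) = starA x + starA y" "starA (x * y) = starA y * starA x" for x y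
    using starA by (auto simp: continuous_involution_def)
  note bl = bounded_linear_involution[OF starA]
  interpret S: bounded_linear starA by (rule bl)
  have h: "\<pi> l (x * y) = \<pi> l x * \<pi> l y" "\<pi> l 1 = 1" "\<pi> l (starA x) = starB (\<pi> l x)" if "l \<in> G" for l x y
    using hom[OF that] by (auto simp: star_homomorphism_def)
  obtain f0 where f0: "real_analytic_on f0 G" "\<And>l. l \<in> G \<Longrightarrow> \<pi> l (f0 l) = q l"
    using analytic_lift[OF G \<pi> q(1)] surj by blast
  \<comment> \<open>Passing to the self-adjoint part does not change the image under \<pi>, because
    q l is self-adjoint.\<close>
  define f1 where "f1 = (\<lambda>l. (1 / 2) *\<^sub>R (f0 l + starA (f0 l)))"
  define P where "P = (\<lambda>l. \<Sum>j\<in>K. p j l)"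
  define f where "f = (\<lambda>l. (1 - P l) * f1 l * (1 - P l))"
  have anf: "real_analytic_on f G"
    unfolding f_def f1_def P_def
    by (intro real_analytic_on_mult[OF G] real_analytic_on_diff[OF G] real_analytic_on_const[OF G] real_analytic_on_sum[OF G]
        real_analytic_on_linear[OF G _ bounded_linear_scaleR_right] real_analytic_on_add[OF G]
        real_analytic_on_linear[OF G _ bl] f0 p)
  have f1: "starA (f1 l) = f1 l" for l by (simp add: f1_def S.scaleR star add.commute)
  have starP: "starA (P l) = P l" if "l \<in> G" for l
    unfolding P_def S.sum using p(2) that by (intro sum.cong) (auto simp: selfadjoint_idempotents_def)
  have starf: "starA (f l) = f l" if "l \<in> G" for l
    by (simp add: f_def star S.diff involution_one[OF starA] starP[OF that] f1 mult.assoc)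
  have pP: "p j l * P l = p j l" "P l * p j l = p j l" if "j \<in> K" "l \<in> G" for j l
  proof -
    have pp: "p j l * p j l = p j l" using p(2)[OF that] by (simp add: selfadjoint_idempotents_def power2_eq_square)
    have "p j l * P l = (\<Sum>k\<in>K. if k = j then p j l else 0)"
      unfolding P_def sum_distrib_left using pp p(3)[OF that(1) _ _ that(2)] by (intro sum.cong) auto
    then show "p j l * P l = p j l" using K that(1) by simp
    have "P l * p j l = (\<Sum>k\<in>K. if k = j then p j l else 0)"
      unfolding P_def sum_distrib_right using pp p(3)[OF _ that(1) _ that(2)] by (intro sum.cong) auto
    then show "P l * p j l = p j l" using K that(1) by simp
  qed
  have pf: "p j l * f l = 0" "f l * p j l = 0" if "j \<in> K" "l \<in> G" for j l
  proof -
    have "p j l * (1 - P l) = 0" "(1 - P l) * p j l = 0" using pP[OF that] by (simp_all add: algebra_simps)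
    then show "p j l * f l = 0" "f l * p j l = 0"
      unfolding f_def by (metis mult.assoc mult_zero_left) (simp add: mult.assoc \<open>(1 - P l) * p j l = 0\<close>)
  qed
  \<comment> \<open>q l is orthogonal to the image of P l, so the compression by 1 - P l is
    invisible after applying \<pi>.\<close>
  have \<pi>f: "\<pi> l (f l) = q l" if l: "l \<in> G" for l
  proof -
    have "starB (q l) = q l" using q(2)[OF l] by (simp add: selfadjoint_idempotents_def)
    then have "\<pi> l (f1 l) = (1 / 2) *\<^sub>R (q l + q l)"
      unfolding f1_def by (simp add: blinfun.scaleR_right blinfun.add_right h[OF l] f0(2)[OF l])
    then have 1: "\<pi> l (f1 l) = q l" by (simp flip: scaleR_2)
    have "\<pi> l (P l) * q l = 0" "q l * \<pi> l (P l) = 0"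
      unfolding P_def blinfun.sum_right sum_distrib_left sum_distrib_right using q(3)[OF _ l] by (auto intro!: sum.neutral)
    moreover have "\<pi> l (f l) = (1 - \<pi> l (P l)) * q l * (1 - \<pi> l (P l))"
      by (simp add: f_def h[OF l] blinfun.diff_right 1)
    ultimately show ?thesis by (simp add: left_diff_distrib right_diff_distrib)
  qed
  have qq: "q l * q l = q l" if "l \<in> G" for l
    using q(2)[OF that] by (simp add: selfadjoint_idempotents_def power2_eq_square)
  \<comment> \<open>\<pi> sends f f - f to q q - q = 0; here the hypothesis on the kernels
    enters.\<close>
  have qn: "\<exists>B. \<forall>n. norm ((f l * f l - f l) ^ n) * s ^ n \<le> B" if "l \<in> G" "s > 0" for l s
    by (rule quasinilpotent_power_bound[OF ker[OF that(1)] that(2)])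
      (simp add: blinfun.diff_right h[OF that(1)] \<pi>f[OF that(1)] qq[OF that(1)])
  have an: "real_analytic_on (\<lambda>l. idempotent_near (f l)) G"
    by (rule analytic_idempotent_near(1)[OF G anf]) (fact qn)
  have sm: "summable (\<lambda>k. norm (idempotent_defect (f l) ^ k))" if "l \<in> G" for l
    by (rule analytic_idempotent_near(2)[OF G anf]) (fact qn that)+
  define p' where "p' = (\<lambda>l. idempotent_near (f l))"
  have "p' l \<in> selfadjoint_idempotents starA \<and> \<pi> l (p' l) = q l \<and> (\<forall>j\<in>K. p j l * p' l = 0 \<and> p' l * p j l = 0)"
    if l: "l \<in> G" for l
  proof (intro conjI ballI)
    note sm = sm[OF l]
    show "p' l \<in> selfadjoint_idempotents starA"
      unfolding p'_def selfadjoint_idempotents_def power2_eq_square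
      using idempotent_near_square[OF sm]
        idempotent_near_star[OF sm bl star(3) involution_one[OF starA] starf[OF l]] by simp
    have "\<pi> l (idempotent_near (f l)) = \<pi> l (f l)"
      by (rule idempotent_near_hom[OF sm blinfun.bounded_linear_right h(1)[OF l] h(2)[OF l]])
        (simp add: \<pi>f[OF l] qq[OF l])
    then show "\<pi> l (p' l) = q l" by (simp add: p'_def \<pi>f[OF l])
    fix j assume j: "j \<in> K"
    show "p j l * p' l = 0" "p' l * p j l = 0"
      unfolding p'_def by (rule idempotent_near_annihilate[OF sm], rule pf[OF j l])+
  qed
  then show ?thesis using an unfolding p'_def by blast
qed

theorem theorem4:
  fixes G :: "real set"
    and starA :: "'a::complex_banach_algebra_1 \<Rightarrow> 'a"
    and starB :: "'b::complex_banach_algebra_1 \<Rightarrow> 'b"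
    and \<pi> :: "real \<Rightarrow> 'a \<Rightarrow>\<^sub>L 'b"
    and I :: "nat set"
    and q :: "nat \<Rightarrow> real \<Rightarrow> 'b"
  assumes "open G"
    and "continuous_involution starA"
    and "continuous_involution starB"
    and "real_analytic_on \<pi> G"
    and "\<And>l. l \<in> G \<Longrightarrow> star_homomorphism starA starB (blinfun_apply (\<pi> l))"
    and "\<And>l. l \<in> G \<Longrightarrow> surj (blinfun_apply (\<pi> l))"
    and "\<And>l x. l \<in> G \<Longrightarrow> blinfun_apply (\<pi> l) x = 0 \<Longrightarrow> spectrum x = {0}"
    and "\<And>i. i \<in> I \<Longrightarrow> real_analytic_on (q i) G"
    and "\<And>i l. i \<in> I \<Longrightarrow> l \<in> G \<Longrightarrow> q i l \<in> selfadjoint_idempotents starB"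
    and "\<And>i j l. i \<in> I \<Longrightarrow> j \<in> I \<Longrightarrow> i \<noteq> j \<Longrightarrow> l \<in> G \<Longrightarrow>
      orthogonal_idempotents (q i l) (q j l)"
  shows "\<exists>p :: nat \<Rightarrow> real \<Rightarrow> 'a.
    (\<forall>i\<in>I. real_analytic_on (p i) G) \<and>
    (\<forall>i\<in>I. \<forall>l\<in>G. p i l \<in> selfadjoint_idempotents starA) \<and>
    (\<forall>i\<in>I. \<forall>j\<in>I. i \<noteq> j \<longrightarrow> (\<forall>l\<in>G. orthogonal_idempotents (p i l) (p j l))) \<and>
    (\<forall>i\<in>I. \<forall>l\<in>G. blinfun_apply (\<pi> l) (p i l) = q i l)"
proof -
  \<comment> \<open>Only indices of \<open>I\<close> below n are constrained, so a step with n
    outside \<open>I\<close> changes nothing, and finite and infinite index sets are treated alike.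
    One product suffices, as i and j range over both orders.\<close>
  define good where "good = (\<lambda>n (p :: nat \<Rightarrow> real \<Rightarrow> 'a). \<forall>i\<in>I \<inter> {..<n}. real_analytic_on (p i) G \<and>
    (\<forall>l\<in>G. p i l \<in> selfadjoint_idempotents starA \<and> \<pi> l (p i l) = q i l \<and>
      (\<forall>j\<in>I \<inter> {..<n}. i \<noteq> j \<longrightarrow> p i l * p j l = 0)))"
  have goodD: "real_analytic_on (p i) G"
    "\<And>l. l \<in> G \<Longrightarrow> p i l \<in> selfadjoint_idempotents starA"
    "\<And>l. l \<in> G \<Longrightarrow> \<pi> l (p i l) = q i l"
    "\<And>l j. l \<in> G \<Longrightarrow> j \<in> I \<Longrightarrow> j < n \<Longrightarrow> i \<noteq> j \<Longrightarrow> p i l * p j l = 0"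
    if "good n p" "i \<in> I" "i < n" for n p i
    using that unfolding good_def by auto
  have good_cong: "good n p'" if "good n p" "\<And>i. i < n \<Longrightarrow> p' i = p i" for n p p'
    using that unfolding good_def by auto
  have step: "\<exists>p'. good (Suc n) p' \<and> (\<forall>i<n. p' i = p i)" if p: "good n p" for n p
  proof (cases "n \<in> I")
    case False
    then have "I \<inter> {..<Suc n} = I \<inter> {..<n}" by (auto simp: less_Suc_eq)
    then show ?thesis using p by (intro exI[of _ p]) (simp add: good_def)
  next
    case True
    let ?K = "I \<inter> {..<n}"
    note pD = goodD[OF p]
    have orth: "\<pi> l (p j l) * q n l = 0 \<and> q n l * \<pi> l (p j l) = 0" if "j \<in> ?K" "l \<in> G" for j l
    proof -
      have "\<pi> l (p j l) = q j l" by (rule pD(3)) (use that in auto)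
      then show ?thesis using assms(10)[of j n l] that True by (auto simp: orthogonal_idempotents_def)
    qed
    have "\<exists>p'. real_analytic_on p' G \<and> (\<forall>l\<in>G. p' l \<in> selfadjoint_idempotents starA \<and> \<pi> l (p' l) = q n l \<and>
      (\<forall>j\<in>?K. p j l * p' l = 0 \<and> p' l * p j l = 0))"
    proof (rule lift_orthogonal_idempotent[OF assms(1-4)])
      show "real_analytic_on (p j) G" if "j \<in> ?K" for j by (rule pD(1)) (use that in auto)
      show "p j l \<in> selfadjoint_idempotents starA" if "j \<in> ?K" "l \<in> G" for j l by (rule pD(2)) (use that in auto)
      show "p j l * p k l = 0" if "j \<in> ?K" "k \<in> ?K" "j \<noteq> k" "l \<in> G" for j k l by (rule pD(4)) (use that in auto)
      show "finite ?K" by simp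
    qed (fact assms(5-7) assms(8,9)[OF True] orth)+
    then obtain p' where p': "real_analytic_on p' G" "\<And>l. l \<in> G \<Longrightarrow> p' l \<in> selfadjoint_idempotents starA"
      "\<And>l. l \<in> G \<Longrightarrow> \<pi> l (p' l) = q n l" "\<And>j l. j \<in> ?K \<Longrightarrow> l \<in> G \<Longrightarrow> p j l * p' l = 0 \<and> p' l * p j l = 0" by blast
    have "good (Suc n) (p(n := p'))"
      unfolding good_def
    proof (intro ballI conjI impI)
      fix i assume i: "i \<in> I \<inter> {..<Suc n}"
      show "real_analytic_on ((p(n := p')) i) G" using i p'(1) pD(1)[of i] by (auto simp: less_Suc_eq)
      fix l assume l: "l \<in> G"
      show "(p(n := p')) i l \<in> selfadjoint_idempotents starA" "\<pi> l ((p(n := p')) i l) = q i l"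
        using i l p'(2,3) pD(2,3)[of i] by (auto simp: less_Suc_eq)
      fix j assume j: "j \<in> I \<inter> {..<Suc n}" and ij: "i \<noteq> j"
      consider "i = n" "j \<in> ?K" | "j = n" "i \<in> ?K" | "i \<in> ?K" "j \<in> ?K" "i \<noteq> n" "j \<noteq> n"
        using i j ij by (auto simp: less_Suc_eq)
      then show "(p(n := p')) i l * (p(n := p')) j l = 0"
        by cases (use p'(4)[OF _ l] pD(4)[of i l j] l ij in auto)
    qed
    then show ?thesis by (intro exI[of _ "p(n := p')"]) auto
  qed
  \<comment> \<open>Dependent choice: stage n + 1 extends stage n without altering any index below
    n.\<close>
  have "\<exists>P. \<forall>n. good n (P n) \<and> (\<forall>i<n. P (Suc n) i = P n i)"
    by (rule dependent_nat_choice[where P = good and Q = "\<lambda>n p p'. \<forall>i<n. p' i = p i"])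
      (simp add: good_def, rule step)
  then obtain P where "\<forall>n. good n (P n) \<and> (\<forall>i<n. P (Suc n) i = P n i)" ..
  then have P: "good n (P n)" and PS: "i < n \<Longrightarrow> P (Suc n) i = P n i" for n i by simp_all
  have stable: "i < n \<Longrightarrow> P n i = P (Suc i) i" for n i
  proof (induction n)
    case (Suc n)
    show ?case
    proof (cases "i = n")
      case False
      then have "i < n" using Suc.prems by simp
      then show ?thesis using PS[of i n] Suc.IH by simp
    qed simp
  qed simp
  \<comment> \<open>Diagonal of the stages: stage n settles the indices below n, so index i is final
    from stage i + 1 on.\<close>
  define p where "p = (\<lambda>i. P (Suc i) i)"
  have good: "good n p" for n
    by (rule good_cong[OF P[of n]]) (unfold p_def, rule stable[symmetric])
  have sq: "e\<^sup>2 = e" if "e \<in> selfadjoint_idempotents starA" for e using that by (simp add: selfadjoint_idempotents_def)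
  show ?thesis
  proof (intro exI[of _ p] conjI ballI impI)
    fix i assume i: "i \<in> I"
    note D = goodD[OF good[of "Suc i"] i lessI]
    show "real_analytic_on (p i) G" by (rule D(1))
    fix l assume l: "l \<in> G"
    show "p i l \<in> selfadjoint_idempotents starA" "\<pi> l (p i l) = q i l" by (rule D(2)[OF l], rule D(3)[OF l])
  next
    fix i j l assume ij: "i \<in> I" "j \<in> I" "i \<noteq> j" and l: "l \<in> G"
    let ?n = "Suc (max i j)"
    have n: "i < ?n" "j < ?n" by auto
    note Di = goodD[OF good[of ?n] ij(1) n(1)] and Dj = goodD[OF good[of ?n] ij(2) n(2)]
    show "orthogonal_idempotents (p i l) (p j l)"
      unfolding orthogonal_idempotents_def
      using sq[OF Di(2)[OF l]] sq[OF Dj(2)[OF l]] Di(4)[OF l ij(2) n(2) ij(3)] Dj(4)[OF l ij(1) n(1) ij(3)[symmetric]]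
      by blast
  qed
qed

end
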